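(* Let $k\ge 0$ be an integer, let $f\colon\mathbb{H}^{2k+1}\to\mathbb{H}^{2k+1}$ be a Lipschitz map with respect to the Carnot–Carathéodory metric $d_{cc}$, let $U\subset\mathbb{H}^{2k+1}$ be an open set, and let $p\in\mathbb{H}^{2k+1}\setminus f(\partial U)$. Let $S\subset \mathbb{H}^{2k+1}$ be the singular set of $f$, i.e. the set of all points at which either $f$ is not $P$-differentiable, or $f$ is $P$-differentiable but its $P$-differential is not injective. If $p\notin f(S)$, then $$\deg(f,U,p)\ge 0 .$$
   Context: Heisenberg group: $\mathbb{H}^n:=\mathbb{R}^n\times\mathbb{R}^n\times\mathbb{R}$ with group operation $(x,y,t)\ast(x',y',t')=(x+x',\,y+y',\,t+t'+2(y\cdot x'-x\cdot y'))$, where $\cdot$ between vectors of $\mathbb{R}^n$ is the Euclidean scalar product. Homogeneous dilations: $\delta_s(x,y,t)=(sx,sy,s^2t)$ for $s>0$. The vector fields $X_i=\frac{\partial}{\partial x_i}+2y_i\frac{\partial}{\partial t}$ and $Y_i=\frac{\partial}{\partial y_i}-2x_i\frac{\partial}{\partial t}$, $i=1,\dots,n$, are left invariant; the horizontal plane at $p\in\mathbb{H}^n$ is $H_p=\mathrm{span}\{X_i(p),Y_i(p): i=1,\dots,n\}$, with the inner product (norm $|\cdot|$) making these vectors orthonormal. Carnot–Carathéodory metric: a Lipschitz curve $\gamma\colon[0,1]\to\mathbb{H}^n$ is horizontal if $\gamma'(\tau)\in H_{\gamma(\tau)}$ for a.e. $\tau\in[0,1]$. For $p,q\in\mathbb{H}^n$,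 $d_{cc}(p,q):=\inf\int_0^1|\gamma'(\tau)|\,d\tau$, the infimum being over all horizontal curves connecting $p$ and $q$. $P$-differentiability: a Lipschitz map $f\colon\mathbb{H}^n\to\mathbb{H}^n$ is $P$-differentiable at $p\in\mathbb{H}^n$ if there exists a group homomorphism $P(f)(p)\colon\mathbb{H}^n\to\mathbb{H}^n$ (its $P$-differential at $p$) such that $$\lim_{s\to 0}\delta_{1/s}\bigl(f(p)^{-1}\ast f(p\ast\delta_s q)\bigr)=P(f)(p)(q)\quad\text{for all } q\in\mathbb{H}^n,$$ where $s>0$ and $f(p)^{-1}$ denotes the group inverse. Degree: $\deg(f,U,p)$ denotes the mapping degree (in the sense of classical Brouwer degree theory) of $f$ on $U$ at the point $p\notin f(\partial U)$, where $\mathbb{H}^{2k+1}$ is identified with $\mathbb{R}^{4k+3}$ (both source and target, with the same orientation). *)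

theory Defs
  imports "HOL-Analysis.Analysis" "HOL-Algebra.Group"
begin

section \<open>The Heisenberg group\<close>

type_synonym 'n heis = "(real ^ 'n) \<times> (real ^ 'n) \<times> real"

fun heis_mult :: "'n::finite heis \<Rightarrow> 'n heis \<Rightarrow> 'n heis" where
  "heis_mult (x, y, t) (x', y', t') = (x + x', y + y', t + t' + 2 * (y \<bullet> x' - x \<bullet> y'))"

definition heis_group :: "'n::finite heis monoid" where
  "heis_group = \<lparr>carrier = UNIV, mult = heis_mult, one = 0\<rparr>"

lemma group_heis_group: "group (heis_group :: 'n::finite heis monoid)"
proof (rule groupI)
  fix p :: "'n heis"
  obtain x y t where p: "p = (x, y, t)" by (cases p)
  have "(- x, - y, - t) \<otimes>\<^bsub>heis_group\<^esub> p = \<one>\<^bsub>heis_group\<^esub>"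
    by (simp add: p heis_group_def inner_commute zero_prod_def)
  then show "\<exists>q\<in>carrier heis_group. q \<otimes>\<^bsub>heis_group\<^esub> p = \<one>\<^bsub>heis_group\<^esub>"
    by (auto simp: heis_group_def)
qed (auto simp: heis_group_def zero_prod_def inner_add_left inner_add_right algebra_simps)

fun heis_dilation :: "real \<Rightarrow> 'n::finite heis \<Rightarrow> 'n heis" where
  "heis_dilation s (x, y, t) = (s *\<^sub>R x, s *\<^sub>R y, s\<^sup>2 * t)"


section \<open>Horizontal curves and the Carnot--Caratheodory distance\<close>

fun heis_X :: "'n::finite \<Rightarrow> 'n heis \<Rightarrow> 'n heis" where
  "heis_X i (x, y, t) = (axis i 1, 0, 2 * (y $ i))"

fun heis_Y :: "'n::finite \<Rightarrow> 'n heis \<Rightarrow> 'n heis" where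
  "heis_Y i (x, y, t) = (0, axis i 1, - 2 * (x $ i))"

definition horizontal_plane :: "'n::finite heis \<Rightarrow> 'n heis set" where
  "horizontal_plane p = span (range (\<lambda>i. heis_X i p) \<union> range (\<lambda>i. heis_Y i p))"

text \<open>
  The norm on the horizontal plane at \<open>p\<close> for which the \<open>X\<^sub>i(p)\<close>, \<open>Y\<^sub>i(p)\<close> are orthonormal.
  It is only meaningful for \<open>v\<close> in that plane; there the coefficients are unique, since
  they are the first \<open>2n\<close> coordinates of \<open>v\<close>.
\<close>

definition horizontal_norm :: "'n::finite heis \<Rightarrow> 'n heis \<Rightarrow> real" where
  "horizontal_norm p v =
     (THE r. \<exists>a b. v = (\<Sum>i\<in>UNIV. a i *\<^sub>R heis_X i p + b i *\<^sub>R heis_Y i p) \<and>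
                   r = sqrt (\<Sum>i\<in>UNIV. (a i)\<^sup>2 + (b i)\<^sup>2))"

definition horizontal_curve :: "(real \<Rightarrow> 'n::finite heis) \<Rightarrow> bool" where
  "horizontal_curve \<gamma> \<longleftrightarrow>
     (\<exists>L. L-lipschitz_on {0..1} \<gamma>) \<and>
     (AE \<tau> in lebesgue_on {0..1}.
        \<gamma> differentiable (at \<tau>) \<and> vector_derivative \<gamma> (at \<tau>) \<in> horizontal_plane (\<gamma> \<tau>))"

definition horizontal_length :: "(real \<Rightarrow> 'n::finite heis) \<Rightarrow> real" where
  "horizontal_length \<gamma> =
     (LINT \<tau>|lebesgue_on {0..1}. horizontal_norm (\<gamma> \<tau>) (vector_derivative \<gamma> (at \<tau>)))"

definition d_cc :: "'n::finite heis \<Rightarrow> 'n heis \<Rightarrow> real" where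
  "d_cc p q = Inf {horizontal_length \<gamma> | \<gamma>. horizontal_curve \<gamma> \<and> \<gamma> 0 = p \<and> \<gamma> 1 = q}"

definition cc_lipschitz :: "('n::finite heis \<Rightarrow> 'n heis) \<Rightarrow> bool" where
  "cc_lipschitz f \<longleftrightarrow> (\<exists>L\<ge>0. \<forall>p q. d_cc (f p) (f q) \<le> L * d_cc p q)"


section \<open>P-differentiability\<close>

definition has_P_differential ::
    "('n::finite heis \<Rightarrow> 'n heis) \<Rightarrow> 'n heis \<Rightarrow> ('n heis \<Rightarrow> 'n heis) \<Rightarrow> bool" where
  "has_P_differential f p A \<longleftrightarrow>
     A \<in> hom heis_group heis_group \<and>
     (\<forall>q. ((\<lambda>s. heis_dilation (1 / s)
                  (inv\<^bsub>heis_group\<^esub> (f p) \<otimes>\<^bsub>heis_group\<^esub> f (p \<otimes>\<^bsub>heis_group\<^esub> heis_dilation s q)))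
            \<longlongrightarrow> A q) (at_right 0))"

definition P_differentiable :: "('n::finite heis \<Rightarrow> 'n heis) \<Rightarrow> 'n heis \<Rightarrow> bool" where
  "P_differentiable f p \<longleftrightarrow> (\<exists>A. has_P_differential f p A)"

definition P_differential :: "('n::finite heis \<Rightarrow> 'n heis) \<Rightarrow> 'n heis \<Rightarrow> 'n heis \<Rightarrow> 'n heis" where
  "P_differential f p = (THE A. has_P_differential f p A)"

definition P_singular_set :: "('n::finite heis \<Rightarrow> 'n heis) \<Rightarrow> 'n heis set" where
  "P_singular_set f = {p. \<not> P_differentiable f p \<or> \<not> inj (P_differential f p)}"


section \<open>The Brouwer degree\<close>

text \<open>
  The determinant of an endomorphism of a Euclidean space (Leibniz formula for its matrix in the
  standard orthonormal basis). Using the same basis for source and target fixes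
  the same orientation on both.
\<close>

definition endo_det :: "('a::euclidean_space \<Rightarrow> 'a) \<Rightarrow> real" where
  "endo_det A = (\<Sum>\<pi> | \<pi> permutes Basis. of_int (sign \<pi>) * (\<Prod>b\<in>Basis. A b \<bullet> \<pi> b))"

definition C1_map :: "('a::euclidean_space \<Rightarrow> 'a) \<Rightarrow> bool" where
  "C1_map g \<longleftrightarrow>
     (\<exists>g'. continuous_on UNIV g' \<and> (\<forall>x. (g has_derivative blinfun_apply (g' x)) (at x)))"

definition regular_value_on :: "('a::euclidean_space \<Rightarrow> 'a) \<Rightarrow> 'a set \<Rightarrow> 'a \<Rightarrow> bool" where
  "regular_value_on g V p \<longleftrightarrow> (\<forall>x\<in>V. g x = p \<longrightarrow> endo_det (frechet_derivative g (at x)) \<noteq> 0)"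

text \<open>
  For bounded open \<open>V\<close>, \<open>f\<close> continuous on the closure of \<open>V\<close> and \<open>p\<close> outside the image of the
  boundary, \<open>d\<close> is the degree of \<open>f\<close> on \<open>V\<close> at \<open>p\<close>: the signed number of preimages of \<open>p\<close> under
  a C1 map \<open>g\<close> with regular value \<open>p\<close> that is closer to \<open>f\<close> than the distance from
  \<open>p\<close> to the image of the boundary.
\<close>

definition has_brouwer_degree ::
    "('a::euclidean_space \<Rightarrow> 'a) \<Rightarrow> 'a set \<Rightarrow> 'a \<Rightarrow> int \<Rightarrow> bool" where
  "has_brouwer_degree f V p d \<longleftrightarrow>
     (\<exists>g. C1_map g \<and> regular_value_on g V p \<and>
          (\<forall>x\<in>closure V. dist (f x) (g x) < infdist p (f ` frontier V)) \<and>
          d = (\<Sum>x | x \<in> V \<and> g x = p.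
                 if endo_det (frechet_derivative g (at x)) > 0 then 1 else - 1))"

text \<open>
  The degree for continuous \<open>f\<close>, open \<open>U\<close> and \<open>p\<close> outside the image of the boundary of \<open>U\<close>.
  If \<open>U\<close> is bounded, then \<open>V = U\<close> is admissible below, and by excision every admissible \<open>V\<close>
  gives the same value. If \<open>U\<close> is unbounded, the degree is still defined as long as the set of
  preimages of \<open>p\<close> in \<open>U\<close> is bounded (hence compact), by excision to a bounded \<open>V\<close>.
  When that set is unbounded there is no classical degree; the value 0 there is a convention.
\<close>

definition brouwer_degree :: "('a::euclidean_space \<Rightarrow> 'a) \<Rightarrow> 'a set \<Rightarrow> 'a \<Rightarrow> int" where
  "brouwer_degree f U p =
     (if bounded {x \<in> U. f x = p}
      then (THE d. \<exists>V. open V \<and> bounded V \<and> V \<subseteq> U \<and> {x \<in> U. f x = p} \<subseteq> V \<and>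
                       has_brouwer_degree f V p d)
      else 0)"

end

theory Submission
  imports Defs
begin

text \<open>
  At a preimage \<open>x\<close> of \<open>p\<close> the \<open>P\<close>-differential is a homogeneous automorphism
  \<open>(z, t) \<mapsto> (M z, c t)\<close> with \<open>M\<close> conformally symplectic of factor \<open>c\<close>. A symplectic map is reduced to
  the identity by transvections, which are squares and hence have positive determinant; up to a
  dilation and a reflection of determinant \<open>(- 1) ^ (n + 1) = 1\<close> this covers every \<open>M\<close>, so the
  automorphism preserves orientation. A Lipschitz map is comparable with its homogeneous tangent
  map near \<open>x\<close>: the blow-ups converge to it uniformly, so the straight homotopy between them avoids
  \<open>p\<close> on small spheres around \<open>x\<close>. Hence the fibre is finite, each of its points contributes \<open>1\<close>, and the
  degree is the cardinality of the fibre.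

  The degree is well defined because the signed count of a regular \<open>C\<^sup>1\<close> map is, up to a constant,
  the integral of the Jacobian of a truncation of the map, and the integral of the Jacobian of a
  compactly supported map \<open>\<zeta>\<close> vanishes: \<open>x + t \<zeta> x\<close> permutes a ball for small \<open>t\<close>, so the integral of its Jacobian is
  a constant polynomial in \<open>t\<close>.
\<close>

section \<open>C1 maps and integrals of Jacobian determinants\<close>

text \<open>The comparison with the tangent map is therefore made on Koranyi spheres, which
  dilations permute. It works with straight homotopies because left translations are affine and
  dilations linear. The parity of the dimension matters only for \<open>c < 0\<close>: dilations and
  symplectic maps produce positive factors only, and the remaining case is reached by
  \<open>(x, y, t) |-> (x, - y, - t)\<close>, whose determinant depends on \<open>n\<close>.

  Since \<open>brouwer_degree\<close> is a definite description over all admissible \<open>V\<close>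
  and all close regular maps, the count has to be computed for an arbitrary choice of both. The area
  formula is used on \<open>real^'m\<close> with a well-ordered index type; a bijection from
  \<open>'n bit1\<close> to the standard basis transports the counts there.\<close>

definition C1_with ::
    "('a::euclidean_space \<Rightarrow> 'b::euclidean_space) \<Rightarrow> ('a \<Rightarrow> 'a \<Rightarrow> 'b) \<Rightarrow> bool" where
  "C1_with f f' \<longleftrightarrow>
     (\<forall>x. (f has_derivative f' x) (at x)) \<and> (\<forall>v. continuous_on UNIV (\<lambda>x. f' x v))"

lemma C1_withI:
  assumes "\<And>x. (f has_derivative f' x) (at x)" "\<And>v. continuous_on UNIV (\<lambda>x. f' x v)"
  shows "C1_with f f'"
  using assms by (simp add: C1_with_def)

lemma C1_withD:
  assumes "C1_with f f'"
  shows "(f has_derivative f' x) (at x)" "continuous_on S (\<lambda>x. f' x v)" "linear (f' x)"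
    "continuous_on S f"
proof -
  show d: "(f has_derivative f' x) (at x)" for x
    using assms by (simp add: C1_with_def)
  show "continuous_on S (\<lambda>x. f' x v)"
    using assms continuous_on_subset[of UNIV "\<lambda>x. f' x v" S] by (auto simp: C1_with_def)
  show "linear (f' x)"
    using d has_derivative_linear by blast
  show "continuous_on S f"
    using d by (meson continuous_at_imp_continuous_on has_derivative_continuous)
qed

text \<open>In finite dimension, continuity of the derivative in each fixed direction gives
  continuity in operator norm. Keeping the derivative as a plain function lets \<open>matrix\<close>
  and \<open>det\<close> act on it directly; the operator form is recovered here for compactness
  arguments, the inverse function theorem and \<open>C1_map\<close>.\<close>

lemma C1_with_blinfun:
  assumes "C1_with f f'"
  shows "continuous_on S (\<lambda>x. Blinfun (f' x))" "blinfun_apply (Blinfun (f' x)) = f' x"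
proof -
  show *: "blinfun_apply (Blinfun (f' x)) = f' x" for x
    by (rule bounded_linear_Blinfun_apply) (use C1_withD(1)[OF assms] has_derivative_bounded_linear in blast)
  show "continuous_on S (\<lambda>x. Blinfun (f' x))"
    by (rule continuous_on_blinfun_componentwise) (simp add: * C1_withD(2)[OF assms])
qed

lemma C1_with_euclidean_expansion:
  assumes "C1_with f f'"
  shows "f' x v = (\<Sum>b\<in>Basis. (v \<bullet> b) *\<^sub>R f' x b)"
proof -
  have "f' x (\<Sum>b\<in>Basis. (v \<bullet> b) *\<^sub>R b) = (\<Sum>b\<in>Basis. (v \<bullet> b) *\<^sub>R f' x b)"
    by (simp add: linear_sum[OF C1_withD(3)[OF assms]] linear_scale[OF C1_withD(3)[OF assms]])
  then show ?thesis by (simp add: euclidean_representation)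
qed

text \<open>Continuity is known only for fixed directions, so the moving direction is expanded in
  the basis.\<close>

lemma C1_with_continuous2:
  assumes f: "C1_with f f'" and g: "continuous_on S g" and h: "continuous_on S h"
  shows "continuous_on S (\<lambda>x. f' (g x) (h x))"
proof -
  have "continuous_on S (\<lambda>x. f' (g x) b)" for b
    using continuous_on_compose2[OF C1_withD(2)[OF f, of UNIV] g] by simp
  then show ?thesis
    by (subst C1_with_euclidean_expansion[OF f]) (intro continuous_intros h)
qed

lemma C1_with_const: "C1_with (\<lambda>x. c) (\<lambda>x v. 0)"
  by (rule C1_withI) auto

lemma C1_with_linear: "linear f \<Longrightarrow> C1_with f (\<lambda>x. f)"
  by (rule C1_withI) (auto simp: linear_imp_has_derivative)

lemma C1_with_add:
  "C1_with f f' \<Longrightarrow> C1_with g g' \<Longrightarrow> C1_with (\<lambda>x. f x + g x) (\<lambda>x v. f' x v + g' x v)"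
  by (auto simp: C1_with_def intro!: has_derivative_add continuous_on_add)

lemma C1_with_diff:
  "C1_with f f' \<Longrightarrow> C1_with g g' \<Longrightarrow> C1_with (\<lambda>x. f x - g x) (\<lambda>x v. f' x v - g' x v)"
  by (auto simp: C1_with_def intro!: has_derivative_diff continuous_on_diff)

lemma C1_with_scaleR:
  assumes "C1_with c c'" "C1_with g g'"
  shows "C1_with (\<lambda>x. c x *\<^sub>R g x) (\<lambda>x v. c x *\<^sub>R g' x v + c' x v *\<^sub>R g x)"
  by (rule C1_withI)
    (auto intro!: has_derivative_scaleR continuous_intros C1_withD(1,2)[OF assms(1)] C1_withD(1,2)[OF assms(2)]
      C1_withD(4)[OF assms(1)] C1_withD(4)[OF assms(2)])

lemma C1_with_compose:
  assumes f: "C1_with f f'" and g: "C1_with g g'"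
  shows "C1_with (\<lambda>x. g (f x)) (\<lambda>x v. g' (f x) (f' x v))"
proof (rule C1_withI)
  show "((\<lambda>x. g (f x)) has_derivative (\<lambda>v. g' (f x) (f' x v))) (at x)" for x
    using has_derivative_compose[OF C1_withD(1)[OF f] C1_withD(1)[OF g]] .
  show "continuous_on UNIV (\<lambda>x. g' (f x) (f' x v))" for v
    by (intro C1_with_continuous2[OF g] C1_withD[OF f])
qed

lemma C1_with_sum:
  assumes "\<And>i. i \<in> I \<Longrightarrow> C1_with (f i) (f' i)"
  shows "C1_with (\<lambda>x. \<Sum>i\<in>I. f i x) (\<lambda>x v. \<Sum>i\<in>I. f' i x v)"
  using assms by (auto simp: C1_with_def intro!: has_derivative_sum continuous_on_sum)

text \<open>Derivatives are local. This carries them across the cut-offs below and is the reason why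
  a cut-off has to equal 1 on an open set.\<close>

lemma C1_with_derivative_eq:
  assumes f: "C1_with f f'" and g: "C1_with g g'" and U: "open U" "x \<in> U" "\<And>y. y \<in> U \<Longrightarrow> f y = g y"
  shows "f' x = g' x"
proof -
  have "(g has_derivative f' x) (at x)"
    using has_derivative_transform_within_open[OF C1_withD(1)[OF f, of x] U(1,2)] U(3) by blast
  then show ?thesis
    using C1_withD(1)[OF g] has_derivative_unique by blast
qed

lemma C1_with_lipschitz:
  assumes f: "C1_with f f'" and supp: "\<And>x. R \<le> norm x \<Longrightarrow> f x = 0"
  obtains L where "L > 0" "\<And>x y. norm (f x - f y) \<le> L * norm (x - y)" "\<And>x v. norm (f' x v) \<le> L * norm v"
proof -
  have "compact ((\<lambda>x. norm (Blinfun (f' x))) ` cball 0 R)"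
    by (intro compact_continuous_image continuous_intros C1_with_blinfun[OF f]) auto
  then obtain B where B: "\<And>x. x \<in> cball 0 R \<Longrightarrow> norm (Blinfun (f' x)) \<le> B"
    by (force dest!: compact_imp_bounded simp: bounded_iff)
  \<comment> \<open>The maximum with 1 keeps the constant positive even if the ball is empty or
    \<open>f\<close> vanishes.\<close>
  define L where "L = max B 1"
  have out: "f' x = (\<lambda>v. 0)" if "norm x > R" for x
    by (rule C1_with_derivative_eq[OF f C1_with_const[of 0], of "- cball 0 R"])
      (use that supp in \<open>auto simp: open_Compl\<close>)
  have on: "onorm (f' x) \<le> L" for x
  proof (cases "norm x > R")
    case True
    then show ?thesis by (simp add: out onorm_zero L_def)
  next
    case False
    then have "norm (Blinfun (f' x)) \<le> L" using B[of x] by (simp add: L_def)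
    then show ?thesis by (simp add: norm_blinfun.rep_eq C1_with_blinfun(2)[OF f])
  qed
  show ?thesis
  proof
    show "L > 0" by (simp add: L_def)
    show "norm (f x - f y) \<le> L * norm (x - y)" for x y
      by (rule differentiable_bound[of UNIV]) (use C1_withD(1)[OF f] on in auto)
    show "norm (f' x v) \<le> L * norm v" for x v
      by (rule order_trans[OF onorm[of "f' x"]])
        (use on C1_withD(1)[OF f] has_derivative_bounded_linear in \<open>auto intro!: mult_right_mono\<close>)
  qed
qed

section \<open>Jacobians of small perturbations of the identity\<close>

lemma continuous_on_det [continuous_intros]:
  fixes A :: "'a::topological_space \<Rightarrow> real^'n^'n"
  assumes "\<And>i j. continuous_on S (\<lambda>x. A x $ i $ j)"
  shows "continuous_on S (\<lambda>x. det (A x))"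
  unfolding det_def by (intro continuous_intros assms)

lemma C1_with_det_continuous:
  fixes f :: "real^'n \<Rightarrow> real^'n"
  assumes "C1_with f f'"
  shows "continuous_on S (\<lambda>x. det (matrix (f' x)))"
  by (intro continuous_on_det) (auto simp: matrix_def intro!: continuous_intros C1_withD(2)[OF assms])

text \<open>On the path \<open>v + s * A v\<close> the determinant starts at 1 and can become
  nonpositive only through a zero. A kernel vector there would satisfy
  \<open>norm v = norm (s * A v) < norm v\<close>.\<close>

lemma det_id_plus_small_pos:
  fixes A :: "real^'n \<Rightarrow> real^'n"
  assumes A: "linear A" and small: "\<And>v. v \<noteq> 0 \<Longrightarrow> norm (A v) < norm v"
  shows "det (matrix (\<lambda>v. v + A v)) > 0"
proof (rule ccontr)
  assume neg: "\<not> ?thesis"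
  define h where "h s = det (matrix (\<lambda>v. v + s *\<^sub>R A v))" for s :: real
  have "continuous_on {0..1} h"
    unfolding h_def by (intro continuous_on_det) (auto simp: matrix_def intro!: continuous_intros)
  moreover have "h 0 = 1"
    by (simp add: h_def flip: id_def)
  moreover have "h 1 \<le> 0"
    using neg by (simp add: h_def)
  ultimately obtain s where s: "0 \<le> s" "s \<le> 1" "h s = 0"
    using IVT2'[of h 1 0 0] by auto
  have lin: "linear (\<lambda>v. v + s *\<^sub>R A v)"
    by (intro linear_compose_add linear_compose_scale_right A linear_id[unfolded id_def])
  have "\<not> inj (\<lambda>v. v + s *\<^sub>R A v)"
    using s(3) det_nz_iff_inj[OF lin] by (simp add: h_def)
  then obtain v where v: "v \<noteq> 0" "v + s *\<^sub>R A v = 0"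
    using linear_injective_0[OF lin] by auto
  have "norm v = norm (s *\<^sub>R A v)"
    using v(2) by (metis add_eq_0_iff norm_minus_cancel)
  also have "\<dots> \<le> norm (A v)"
    using s by (simp add: mult_left_le_one_le)
  finally show False using small[OF v(1)] by simp
qed

text \<open>Solving \<open>x + \<zeta> x = y\<close> means finding a fixed point of the contraction
  that sends \<open>x\<close> to \<open>y - \<zeta> x\<close>. Off \<open>S\<close> the map is the
  identity, so by injectivity no point of \<open>S\<close> can leave \<open>S\<close>.\<close>

lemma perturbation_maps_ball_onto_itself:
  fixes \<zeta> :: "'a::euclidean_space \<Rightarrow> 'a"
  assumes lip: "\<And>x y. norm (\<zeta> x - \<zeta> y) \<le> c * norm (x - y)" and c: "0 \<le> c" "c < 1"
    and supp: "\<And>x. x \<notin> S \<Longrightarrow> \<zeta> x = 0"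
  shows "inj (\<lambda>x. x + \<zeta> x)" "(\<lambda>x. x + \<zeta> x) ` S = S"
proof -
  show inj: "inj (\<lambda>x. x + \<zeta> x)"
  proof (rule injI, rule ccontr)
    fix x y assume eq: "x + \<zeta> x = y + \<zeta> y" and "x \<noteq> y"
    have "norm (x - y) = norm (\<zeta> x - \<zeta> y)"
    proof -
      have "x - y = - (\<zeta> x - \<zeta> y)" using eq by (simp add: algebra_simps)
      then show ?thesis by (metis norm_minus_cancel)
    qed
    also have "\<dots> \<le> c * norm (x - y)" by (rule lip)
    also have "\<dots> < norm (x - y)" using \<open>x \<noteq> y\<close> c by simp
    finally show False by simp
  qed
  show "(\<lambda>x. x + \<zeta> x) ` S = S"
  proof (intro equalityI subsetI)
    fix y assume "y \<in> (\<lambda>x. x + \<zeta> x) ` S"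
    then obtain x where x: "x \<in> S" "y = x + \<zeta> x" by auto
    show "y \<in> S"
    proof (rule ccontr)
      assume "y \<notin> S"
      then have "y + \<zeta> y = x + \<zeta> x" using supp x by simp
      then have "y = x" using injD[OF inj] by blast
      then show False using x \<open>y \<notin> S\<close> by simp
    qed
  next
    fix y assume y: "y \<in> S"
    have "\<exists>!x. y - \<zeta> x = x"
      by (rule banach_fix_type[OF c])
        (use lip in \<open>auto simp: dist_norm norm_minus_commute\<close>)
    then obtain x where x: "y = x + \<zeta> x" by (metis diff_add_cancel)
    then have "x \<in> S" using supp[of x] y by (cases "x \<in> S") simp_all
    then show "y \<in> (\<lambda>x. x + \<zeta> x) ` S" using x by blast
  qed
qed

lemma absolutely_integrable_continuous_on_compact:
  fixes f :: "'a::euclidean_space \<Rightarrow> real"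
  assumes "compact S" "continuous_on S f"
  shows "f absolutely_integrable_on S"
proof -
  have "integrable lborel (\<lambda>x. indicator S x *\<^sub>R f x)"
    using borel_integrable_compact[OF assms] by (simp add: indicator_scaleR_eq_if)
  then show ?thesis
    unfolding set_integrable_def by (rule integrable_completion[THEN iffD2, rotated]) 
      (use \<open>integrable lborel _\<close> in measurable)
qed

lemma integrable_continuous_on_compact:
  fixes f :: "'a::euclidean_space \<Rightarrow> real"
  assumes "compact S" "continuous_on S f"
  shows "f integrable_on S"
  using absolutely_integrable_continuous_on_compact[OF assms] set_lebesgue_integral_eq_integral(1) by blast

text \<open>For \<open>t * L < 1\<close> the map permutes the ball and its Jacobian is positive, so
  the area formula holds without the absolute value.\<close>

lemma integral_det_id_plus_small:
  fixes \<zeta> :: "real^'m::{finite,wellorder} \<Rightarrow> real^'m::_"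
  assumes \<zeta>: "C1_with \<zeta> \<zeta>'" and supp: "\<And>x. R \<le> norm x \<Longrightarrow> \<zeta> x = 0"
  obtains e where "e > 0" "\<And>t. 0 \<le> t \<Longrightarrow> t < e \<Longrightarrow>
    integral (cball 0 R) (\<lambda>x. det (matrix (\<lambda>v. v + t *\<^sub>R \<zeta>' x v))) = measure lebesgue (cball (0::real^'m::{finite,wellorder}) R)"
proof -
  obtain L where L: "L > 0" "\<And>x y. norm (\<zeta> x - \<zeta> y) \<le> L * norm (x - y)" "\<And>x v. norm (\<zeta>' x v) \<le> L * norm v"
    using C1_with_lipschitz[OF \<zeta> supp] by blast
  show ?thesis
  proof
    show "inverse L > 0" using L by simp
    fix t :: real assume t: "0 \<le> t" "t < inverse L"
    have tL: "0 \<le> t * L" "t * L < 1" using t L by (auto simp: field_simps)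
    let ?D = "\<lambda>x v. v + t *\<^sub>R \<zeta>' x v"
    have C: "C1_with (\<lambda>x. x + t *\<^sub>R \<zeta> x) ?D"
      using C1_with_add[OF C1_with_linear[OF linear_id[unfolded id_def]]
          C1_with_scaleR[OF C1_with_const[of t] \<zeta>]] by simp
    have pos: "det (matrix (?D x)) > 0" for x
    proof (rule det_id_plus_small_pos)
      show "linear (\<lambda>v. t *\<^sub>R \<zeta>' x v)"
        by (intro linear_compose_scale_right C1_withD[OF \<zeta>])
      fix v :: "real^'m::_" assume "v \<noteq> 0"
      have "norm (t *\<^sub>R \<zeta>' x v) \<le> t * L * norm v"
        using L(3)[of x v] t by (simp add: mult_left_mono mult.assoc)
      also have "\<dots> < norm v" using tL \<open>v \<noteq> 0\<close> by simp
      finally show "norm (t *\<^sub>R \<zeta>' x v) < norm v" .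
    qed
    have lip: "norm (t *\<^sub>R \<zeta> x - t *\<^sub>R \<zeta> y) \<le> (t * L) * norm (x - y)" for x y
      using L(2)[of x y] t by (simp add: mult_left_mono mult.assoc flip: scaleR_diff_right)
    note onto = perturbation_maps_ball_onto_itself[OF lip tL, of "cball 0 R"]
    have z: "x \<notin> cball 0 R \<Longrightarrow> t *\<^sub>R \<zeta> x = 0" for x using supp by auto
    have int: "(\<lambda>x. \<bar>det (matrix (?D x))\<bar>) integrable_on cball 0 R"
      by (intro integrable_continuous_on_compact continuous_intros C1_with_det_continuous[OF C]) auto
    have "measure lebesgue ((\<lambda>x. x + t *\<^sub>R \<zeta> x) ` cball 0 R) = integral (cball 0 R) (\<lambda>x. \<bar>det (matrix (?D x))\<bar>)"
      by (rule measure_differentiable_image_eq)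
        (use C1_withD(1)[OF C] onto(1) z int in \<open>auto intro: has_derivative_at_withinI inj_on_subset\<close>)
    also have "(\<lambda>x. x + t *\<^sub>R \<zeta> x) ` cball 0 R = cball 0 R"
      using onto(2) z by blast
    also have "(\<lambda>x. \<bar>det (matrix (?D x))\<bar>) = (\<lambda>x. det (matrix (?D x)))"
      using pos by (simp add: less_imp_le)
    finally show "integral (cball 0 R) (\<lambda>x. det (matrix (?D x))) = measure lebesgue (cball (0::real^'m::_) R)" by simp
  qed
qed

text \<open>For small \<open>t\<close> the map \<open>x + t \<zeta> x\<close> is a bijection of the ball, so the integral of its Jacobian
  determinant, a polynomial in \<open>t\<close>, is constant; the assertion is the vanishing of its leading
  coefficient.\<close>

lemma integral_det_compact_support:
  fixes \<zeta> :: "real^'m::{finite,wellorder} \<Rightarrow> real^'m::_"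
  assumes \<zeta>: "C1_with \<zeta> \<zeta>'" and supp: "\<And>x. R \<le> norm x \<Longrightarrow> \<zeta> x = 0"
  shows "integral (cball 0 R) (\<lambda>x. det (matrix (\<zeta>' x))) = 0"
proof -
  define B where "B = cball (0::real^'m::_) R"
  define V where "V = measure lebesgue B"
  obtain e where e: "e > 0" "\<And>t. 0 \<le> t \<Longrightarrow> t < e \<Longrightarrow>
      integral B (\<lambda>x. det (matrix (\<lambda>v. v + t *\<^sub>R \<zeta>' x v))) = V"
    using integral_det_id_plus_small[OF \<zeta> supp] unfolding B_def V_def by blast
  \<comment> \<open>\<open>X\<close> is the set of rows in which the factor of the Leibniz product
    is taken from the derivative rather than from the identity; each such row carries one power of
    \<open>t\<close>.\<close>
  define c where "c X x = (\<Sum>p | p permutes (UNIV::'m set). of_int (sign p) *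
      ((\<Prod>i\<in>X. \<zeta>' x (axis (p i) 1) $ i) * (\<Prod>i\<in>UNIV-X. axis (p i) (1::real) $ i)))" for X :: "'m set" and x
  have det_eq: "det (matrix (\<lambda>v. v + t *\<^sub>R \<zeta>' x v)) = (\<Sum>X\<in>UNIV. t ^ card X * c X x)" for t x
  proof -
    have "det (matrix (\<lambda>v. v + t *\<^sub>R \<zeta>' x v)) =
      (\<Sum>p | p permutes (UNIV::'m set). of_int (sign p) *
        (\<Prod>i\<in>UNIV. t * \<zeta>' x (axis (p i) 1) $ i + axis (p i) 1 $ i))"
      unfolding det_def matrix_def by (intro sum.cong refl arg_cong2[of _ _ _ _ "(*)"] prod.cong) simp
    also have "\<dots> = (\<Sum>p | p permutes (UNIV::'m set). \<Sum>X\<in>UNIV. of_int (sign p) *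
        (t ^ card X * ((\<Prod>i\<in>X. \<zeta>' x (axis (p i) 1) $ i) * (\<Prod>i\<in>UNIV-X. axis (p i) 1 $ i))))"
      by (intro sum.cong refl, subst prod_add)
        (simp_all only: finite prod.distrib prod_constant sum_distrib_left mult.assoc Pow_UNIV)
    also have "\<dots> = (\<Sum>X\<in>UNIV. t ^ card X * c X x)"
      by (subst sum.swap) (simp add: c_def sum_distrib_left mult_ac)
    finally show ?thesis .
  qed
  have c_cont: "continuous_on B (c X)" for X
    unfolding c_def by (intro continuous_intros C1_withD(2)[OF \<zeta>])
  have c_int: "c X integrable_on B" for X
    by (intro integrable_continuous_on_compact c_cont) (simp add: B_def)
  define P where "P = (\<Sum>X\<in>UNIV. monom (integral B (c X)) (card (X::'m set)))"
  have P: "poly P t = integral B (\<lambda>x. det (matrix (\<lambda>v. v + t *\<^sub>R \<zeta>' x v)))" for t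
  proof -
    have "integral B (\<lambda>x. \<Sum>X\<in>UNIV. t ^ card X * c X x) = (\<Sum>X\<in>UNIV. integral B (\<lambda>x. t ^ card X * c X x))"
      by (rule integral_sum) (use integrable_cmul[OF c_int] in simp_all)
    then show ?thesis
      by (simp add: det_eq P_def poly_sum poly_monom mult.commute)
  qed
  \<comment> \<open>The difference would have the whole interval \<open>{0<..<e}\<close> among its
    roots.\<close>
  have "P = [:V:]"
  proof (rule ccontr)
    assume "P \<noteq> [:V:]"
    then have "finite {t. poly (P - [:V:]) t = 0}"
      by (intro poly_roots_finite) auto
    moreover have "{0<..<e} \<subseteq> {t. poly (P - [:V:]) t = 0}"
      using e(2) P by auto
    ultimately show False
      using e(1) infinite_Ioo finite_subset by blast
  qed
  \<comment> \<open>\<open>CARD('m)\<close> is positive, so this is not the constant coefficient;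
    only \<open>X = UNIV\<close> contributes to it.\<close>
  then have "coeff P CARD('m) = 0"
    by (simp add: coeff_eq_0)
  moreover have "coeff P CARD('m) = integral B (c UNIV)"
  proof -
    have "coeff P CARD('m) = (\<Sum>X\<in>UNIV. if card X = CARD('m) then integral B (c X) else 0)"
      by (simp add: P_def coeff_sum)
    also have "\<dots> = (\<Sum>X\<in>UNIV. if X = UNIV then integral B (c X) else 0)"
      by (intro sum.cong refl) (metis card_subset_eq finite subset_UNIV)
    finally show ?thesis by simp
  qed
  moreover have "c UNIV = (\<lambda>x. det (matrix (\<zeta>' x)))"
    by (simp add: c_def det_def matrix_def fun_eq_iff)
  ultimately show ?thesis by (simp add: B_def)
qed

section \<open>Cut-off functions\<close>

text \<open>A simple function that is \<open>C1\<close> and vanishes on a half-line; cut-offs and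
  bumps are built from it, since only first derivatives occur.\<close>

lemma C1_with_max_0_square:
  "C1_with (\<lambda>s::real. (max 0 s)\<^sup>2) (\<lambda>s h. 2 * max 0 s * h)"
proof (rule C1_withI)
  fix s :: real
  have "((\<lambda>s::real. (max 0 s)\<^sup>2) has_real_derivative 2 * max 0 s) (at s)"
  proof (cases s "0::real" rule: linorder_cases)
    case less
    show ?thesis
      by (rule DERIV_cong[OF has_field_derivative_transform_within_open[of "\<lambda>_. 0" 0 s "{..<0}"]])
        (use less in auto)
  next
    case greater
    have "((\<lambda>s::real. s\<^sup>2) has_real_derivative 2 * max 0 s) (at s)"
      using greater by (auto intro!: derivative_eq_intros)
    then show ?thesis
      by (rule has_field_derivative_transform_within_open[of _ _ _ "{0<..}"]) (use greater in auto)
  next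
    case equal
    have "((\<lambda>h::real. (max 0 h)\<^sup>2 / h) \<longlongrightarrow> 0) (at 0)"
    proof (rule Lim_null_comparison)
      show "\<forall>\<^sub>F h in at 0. norm ((max 0 h)\<^sup>2 / h) \<le> \<bar>h::real\<bar>"
        by (rule always_eventually) (auto simp: max_def power2_eq_square)
      show "((\<lambda>h::real. \<bar>h\<bar>) \<longlongrightarrow> 0) (at 0)"
        by (auto intro!: tendsto_eq_intros)
    qed
    then show ?thesis
      using equal by (simp add: DERIV_def)
  qed
  then show "((\<lambda>s::real. (max 0 s)\<^sup>2) has_derivative (\<lambda>h. 2 * max 0 s * h)) (at s)"
    by (simp add: has_field_derivative_def)
qed (intro continuous_intros)

lemma C1_with_dist_square:
  fixes a :: "'a::euclidean_space"
  shows "C1_with (\<lambda>x. (norm (x - a))\<^sup>2) (\<lambda>x v. 2 * ((x - a) \<bullet> v))"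
proof (rule C1_withI)
  show "((\<lambda>x. (norm (x - a))\<^sup>2) has_derivative (\<lambda>v. 2 * ((x - a) \<bullet> v))) (at x)" for x
    unfolding power2_norm_eq_inner
    by (auto intro!: derivative_eq_intros simp: inner_commute)
qed (intro continuous_intros)

text \<open>Finitely many bumps on balls inside \<open>U\<close> add up to a function
  \<open>S\<close> that is positive on \<open>K\<close>. It is composed with a \<open>C1\<close>
  profile that is 0 at 0 and 1 from \<open>c\<close> on.\<close>

lemma C1_cutoff:
  fixes K :: "'a::euclidean_space set"
  assumes K: "compact K" and U: "open U" "K \<subseteq> U"
  obtains \<rho> :: "'a \<Rightarrow> real" and \<rho>' T C
  where "C1_with \<rho> \<rho>'" "open T" "K \<subseteq> T" "\<And>x. x \<in> T \<Longrightarrow> \<rho> x = 1"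
    "compact C" "C \<subseteq> U" "\<And>x. x \<notin> C \<Longrightarrow> \<rho> x = 0" "\<And>x. \<rho> x \<in> {0..1}"
proof (cases "K = {}")
  case True
  then show ?thesis
    using that[OF C1_with_const[of 0], of "{}" "{}"] by auto
next
  case False
  have "\<exists>r>0. cball x r \<subseteq> U" if "x \<in> K" for x
    using that U open_contains_cball by (metis subsetD)
  then obtain r where r: "\<And>x. x \<in> K \<Longrightarrow> r x > 0 \<and> cball x (r x) \<subseteq> U" by metis
  obtain F where F: "F \<subseteq> K" "finite F" "K \<subseteq> (\<Union>x\<in>F. ball x (r x))"
    by (rule compactE_image[OF K, of K "\<lambda>x. ball x (r x)"]) (use r in force)+
  define m where "m s = (max 0 s)\<^sup>2" for s :: real
  note m = C1_with_max_0_square[folded m_def]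
  define \<psi> where "\<psi> a x = m (1 - (1 / (r a)\<^sup>2) *\<^sub>R (norm (x - a))\<^sup>2)" for a x
  have \<psi>: "\<exists>\<psi>'. C1_with (\<psi> a) \<psi>'" for a
    unfolding \<psi>_def
    using C1_with_compose[OF C1_with_diff[OF C1_with_const
        C1_with_scaleR[OF C1_with_const C1_with_dist_square]] m] by blast
  then obtain \<psi>' where \<psi>': "\<And>a. C1_with (\<psi> a) (\<psi>' a)" by metis
  have \<psi>_nonneg: "0 \<le> \<psi> a x" for a x by (simp add: \<psi>_def m_def)
  have \<psi>_pos: "0 < \<psi> a x" if "a \<in> F" "x \<in> ball a (r a)" for a x
  proof -
    have "(norm (x - a))\<^sup>2 < (r a)\<^sup>2"
      using that by (intro power_strict_mono) (auto simp: dist_norm norm_minus_commute)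
    then have "(norm (x - a))\<^sup>2 / (r a)\<^sup>2 < 1"
      using le_less_trans[OF zero_le_power2] by (subst divide_less_eq_1_pos) blast+
    then have "0 < max 0 (1 - (1 / (r a)\<^sup>2) *\<^sub>R (norm (x - a))\<^sup>2)" by simp
    then show ?thesis unfolding \<psi>_def m_def by (rule zero_less_power)
  qed
  have \<psi>_zero: "\<psi> a x = 0" if "a \<in> F" "x \<notin> cball a (r a)" for a x
  proof -
    have "(r a)\<^sup>2 \<le> (norm (x - a))\<^sup>2"
      using that r[of a] F by (intro power_mono) (auto simp: dist_norm norm_minus_commute less_imp_le)
    then show ?thesis using r[of a] that F by (auto simp: \<psi>_def m_def field_simps max_def)
  qed
  define S where "S x = (\<Sum>a\<in>F. \<psi> a x)" for x
  have S: "C1_with S (\<lambda>x v. \<Sum>a\<in>F. \<psi>' a x v)"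
    unfolding S_def by (intro C1_with_sum \<psi>')
  have S_nonneg: "0 \<le> S x" for x
    unfolding S_def by (intro sum_nonneg \<psi>_nonneg)
  have S_pos: "0 < S x" if x: "x \<in> K" for x
  proof -
    obtain a where "a \<in> F" "x \<in> ball a (r a)" using F x by blast
    then show ?thesis
      unfolding S_def using F by (intro sum_pos2[of F a]) (auto intro: \<psi>_nonneg \<psi>_pos)
  qed
  obtain z where z: "z \<in> K" "\<And>x. x \<in> K \<Longrightarrow> S z \<le> S x"
    using continuous_attains_inf[OF K False C1_withD(4)[OF S]] by blast
  \<comment> \<open>With half the minimum over \<open>K\<close>, the set where \<open>S\<close>
    exceeds \<open>c\<close> is an open neighbourhood of \<open>K\<close>, and the cut-off is 1 on
    all of it.\<close>
  define c where "c = S z / 2"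
  have c: "c > 0" using S_pos z by (simp add: c_def)
  define \<rho> where "\<rho> x = 1 - m (1 - (1 / c) *\<^sub>R S x)" for x
  obtain \<rho>' where \<rho>: "C1_with \<rho> \<rho>'"
    using C1_with_diff[OF C1_with_const C1_with_compose[OF C1_with_diff[OF C1_with_const
        C1_with_scaleR[OF C1_with_const S]] m]] unfolding \<rho>_def by blast
  show ?thesis
  proof (rule that[OF \<rho>])
    show "open {x. c < S x}"
      using C1_withD(4)[OF S] by (intro open_Collect_less continuous_intros)
    show "K \<subseteq> {x. c < S x}"
      using z(2) S_pos[OF z(1)] by (force simp: c_def)
    show "\<rho> x = 1" if "x \<in> {x. c < S x}" for x
      using that c by (simp add: \<rho>_def m_def max_def field_simps)
    show "compact (\<Union>a\<in>F. cball a (r a))"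
      using F by (intro compact_UN) auto
    show "(\<Union>a\<in>F. cball a (r a)) \<subseteq> U"
      using r F by auto
    show "\<rho> x = 0" if "x \<notin> (\<Union>a\<in>F. cball a (r a))" for x
    proof -
      have "S x = 0" unfolding S_def using that \<psi>_zero by (intro sum.neutral) auto
      then show ?thesis by (simp add: \<rho>_def m_def)
    qed
    show "\<rho> x \<in> {0..1}" for x
    proof -
      have "0 \<le> max 0 (1 - S x / c)" "max 0 (1 - S x / c) \<le> 1"
        using S_nonneg[of x] c by (auto simp: field_simps)
      then show ?thesis by (auto simp: \<rho>_def m_def power_le_one)
    qed
  qed
qed

text \<open>Both maps are multiplied by a common cut-off that is 1 near \<open>K\<close>; each
  product has compact support and Jacobian integral 0. Off \<open>K\<close> the two Jacobians agree
  with or without the cut-off, and on \<open>K\<close> the cut-off changes nothing, so the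
  difference of the Jacobians is unaffected.\<close>

lemma integral_det_eq_off_compact:
  fixes G0 G1 :: "real^'m::{finite,wellorder} \<Rightarrow> real^'m::_"
  assumes G0: "C1_with G0 G0'" and G1: "C1_with G1 G1'" and K: "compact K"
    and eq: "\<And>x. x \<notin> K \<Longrightarrow> G0 x = G1 x" and S: "K \<subseteq> S"
  shows "((\<lambda>x. det (matrix (G0' x)) - det (matrix (G1' x))) has_integral 0) S"
proof -
  obtain R where R: "K \<subseteq> cball 0 R"
    using compact_imp_bounded[OF K] by (force simp: bounded_iff)
  obtain \<rho> :: "real^'m::_ \<Rightarrow> real" and \<rho>' T C where \<rho>: "C1_with \<rho> \<rho>'" "open T" "cball 0 R \<subseteq> T"
      "\<And>x. x \<in> T \<Longrightarrow> \<rho> x = 1" "C \<subseteq> ball 0 (R+1)" "\<And>x. x \<notin> C \<Longrightarrow> \<rho> x = 0"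
    by (rule C1_cutoff[of "cball (0::real^'m::_) R" "ball 0 (R+1)"]) auto
  define B where "B = cball (0::real^'m::_) (R+1)"
  define D where "D G G' x v = \<rho> x *\<^sub>R G' x v + \<rho>' x v *\<^sub>R G x" for G :: "real^'m::_ \<Rightarrow> real^'m::_" and G' x v
  have C: "C1_with (\<lambda>x. \<rho> x *\<^sub>R G x) (D G G')" if "C1_with G G'" for G G'
    unfolding D_def by (rule C1_with_scaleR[OF \<rho>(1) that])
  have int0: "((\<lambda>x. det (matrix (D G G' x))) has_integral 0) B" if G: "C1_with G G'" for G G'
  proof -
    have "(\<lambda>x. det (matrix (D G G' x))) integrable_on B"
      by (intro integrable_continuous_on_compact C1_with_det_continuous[OF C[OF G]]) (simp add: B_def)
    moreover have "integral B (\<lambda>x. det (matrix (D G G' x))) = 0"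
      unfolding B_def
      by (rule integral_det_compact_support[OF C[OF G]]) (use \<rho>(5,6) in force)
    ultimately show ?thesis using has_integral_integrable_integral by blast
  qed
  define d where "d x = det (matrix (D G0 G0' x)) - det (matrix (D G1 G1' x))" for x
  define e where "e x = det (matrix (G0' x)) - det (matrix (G1' x))" for x
  have d0: "d x = 0" if "x \<notin> K" for x
  proof -
    have "D G0 G0' x = D G1 G1' x"
      by (rule C1_with_derivative_eq[OF C[OF G0] C[OF G1], of "- K"])
        (use that eq K in \<open>auto simp: compact_imp_closed open_Compl\<close>)
    then show ?thesis by (simp add: d_def)
  qed
  have e0: "e x = 0" if "x \<notin> K" for x
  proof -
    have "G0' x = G1' x"
      by (rule C1_with_derivative_eq[OF G0 G1, of "- K"])
        (use that eq K in \<open>auto simp: compact_imp_closed open_Compl\<close>)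
    then show ?thesis by (simp add: e_def)
  qed
  have de: "d x = e x" for x
  proof (cases "x \<in> K")
    case True
    then have "x \<in> T" using R \<rho>(3) by auto
    then have "D G G' x = G' x" if "C1_with G G'" for G G'
      by (intro C1_with_derivative_eq[OF C[OF that] that \<rho>(2)]) (auto simp: \<rho>(4))
    then show ?thesis using G0 G1 by (simp add: d_def e_def)
  qed (simp add: d0 e0)
  have "(d has_integral 0) B"
    using has_integral_diff[OF int0[OF G0] int0[OF G1]] by (simp add: d_def[abs_def])
  moreover have "d = e" using de by auto
  moreover have "e x = 0" if "x \<notin> B" for x
    using that R by (intro e0) (auto simp: B_def)
  ultimately have "(e has_integral 0) UNIV"
    using has_integral_on_superset[of e 0 B UNIV] by auto
  moreover have "(\<lambda>x. if x \<in> S then e x else 0) = e"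
  proof
    show "(if x \<in> S then e x else 0) = e x" for x
      using e0[of x] S by auto
  qed
  ultimately show ?thesis
    using has_integral_restrict_UNIV[of S e 0] by (simp add: e_def[abs_def])
qed

section \<open>Bump functions and signed counts of preimages\<close>

definition hat :: "real \<Rightarrow> real \<Rightarrow> real" where
  "hat r s = max 0 (r - \<bar>s\<bar>)"

text \<open>The tent \<open>hat r\<close> is the second difference, with step \<open>r\<close>, of
  the positive part; this primitive is the same difference of half the squared positive
  part.\<close>

definition hat_int :: "real \<Rightarrow> real \<Rightarrow> real" where
  "hat_int r s = ((max 0 (s + r))\<^sup>2 - 2 * (max 0 s)\<^sup>2 + (max 0 (s - r))\<^sup>2) / 2"

lemma C1_with_hat_int:
  assumes "r > 0"
  shows "C1_with (hat_int r) (\<lambda>s h. hat r s * h)"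
proof (rule C1_withI)
  fix s
  have d: "((\<lambda>s. (max 0 (s + c))\<^sup>2) has_real_derivative 2 * max 0 (s + c)) (at s)" for c :: real
  proof -
    have a: "((\<lambda>s::real. (max 0 s)\<^sup>2) has_real_derivative 2 * max 0 (s + c)) (at (s + c))"
      using C1_withD(1)[OF C1_with_max_0_square] by (simp add: has_field_derivative_def)
    have b: "((\<lambda>s. s + c) has_real_derivative 1) (at s)"
      by (auto intro!: derivative_eq_intros)
    show ?thesis using DERIV_chain2[OF a b] by simp
  qed
  have "((\<lambda>s. ((max 0 (s + r))\<^sup>2 - 2 * (max 0 (s + 0))\<^sup>2 + (max 0 (s + - r))\<^sup>2) / 2) has_real_derivative
      (2 * max 0 (s + r) - 2 * (2 * max 0 (s + 0)) + 2 * max 0 (s + - r)) / 2) (at s)"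
    by (intro DERIV_cdivide DERIV_add DERIV_diff DERIV_cmult d)
  also have "(\<lambda>s. ((max 0 (s + r))\<^sup>2 - 2 * (max 0 (s + 0))\<^sup>2 + (max 0 (s + - r))\<^sup>2) / 2) = hat_int r"
    by (simp add: hat_int_def[abs_def])
  also have "(2 * max 0 (s + r) - 2 * (2 * max 0 (s + 0)) + 2 * max 0 (s + - r)) / 2 = hat r s"
    using assms by (simp add: hat_def max_def)
  finally show "(hat_int r has_derivative (\<lambda>h. hat r s * h)) (at s)"
    by (simp add: has_field_derivative_def)
qed (auto simp: hat_def intro!: continuous_intros)

text \<open>A product of tents is itself a Jacobian determinant, namely that of
  \<open>bump_map\<close>, which acts on each coordinate separately.\<close>

definition bump :: "real \<Rightarrow> real^'m \<Rightarrow> real^'m \<Rightarrow> real" where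
  "bump r p y = (\<Prod>i\<in>UNIV. hat r (y $ i - p $ i))"

lemma bump_eq_0:
  fixes r :: real
  assumes "y \<notin> cball p (r * CARD('m))"
  shows "bump r p (y :: real^'m) = 0"
proof (rule ccontr)
  assume "bump r p y \<noteq> 0"
  then have *: "\<bar>(y - p) $ i\<bar> \<le> r" for i
    by (auto simp: bump_def hat_def max_def split: if_splits)
  \<comment> \<open>The support lies in a cube of half-side \<open>r\<close>; this estimate is the
    origin of the radius \<open>r * CARD('m)\<close>.\<close>
  have "norm (y - p) \<le> (\<Sum>i\<in>UNIV. \<bar>(y - p) $ i\<bar>)"
    by (rule norm_le_l1_cart)
  also have "\<dots> \<le> r * CARD('m)"
    using sum_bounded_above[of UNIV "\<lambda>i. \<bar>(y - p) $ i\<bar>" r] * by (simp add: mult.commute)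
  finally show False using assms by (simp add: dist_norm norm_minus_commute)
qed

lemma continuous_on_bump: "continuous_on S (bump r p)"
  unfolding bump_def hat_def by (intro continuous_intros)

lemma absolutely_integrable_bump:
  fixes p :: "real^'m" and r :: real
  assumes "cball p (r * CARD('m)) \<subseteq> S"
  shows "bump r p absolutely_integrable_on S"
    "integral S (bump r p) = integral UNIV (bump r p)"
proof -
  let ?C = "cball p (r * CARD('m))"
  have abs: "bump r p absolutely_integrable_on ?C"
    by (intro absolutely_integrable_continuous_on_compact continuous_on_bump) auto
  have eq: "(if x \<in> ?C then bump r p x else 0) = bump r p x"
    "(if x \<in> S then bump r p x else 0) = bump r p x" for x
    using bump_eq_0[of x p r] assms by (auto simp: subset_eq)
  have U: "bump r p absolutely_integrable_on UNIV"
    using absolutely_integrable_restrict_UNIV[of ?C "bump r p"] abs by (simp only: eq)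
  then show "bump r p absolutely_integrable_on S"
    using absolutely_integrable_restrict_UNIV[of S "bump r p"] by (simp only: eq)
  show "integral S (bump r p) = integral UNIV (bump r p)"
    using integral_restrict_UNIV[of S "bump r p"] by (simp only: eq)
qed

lemma integral_bump_pos:
  fixes p :: "real^'m"
  assumes "r > 0"
  shows "integral UNIV (bump r p) > 0"
proof -
  define a where "a = p - (\<chi> i. r)"
  define b where "b = p + (\<chi> i. r)"
  have ab: "x \<in> box a b \<Longrightarrow> bump r p x > 0" for x
    by (auto simp: bump_def hat_def a_def b_def mem_box_cart abs_if intro!: prod_pos)
       (smt (verit))+
  have out: "bump r p x = 0" if x: "x \<notin> cbox a b" for x
  proof -
    obtain i where "\<not> (a $ i \<le> x $ i \<and> x $ i \<le> b $ i)"
      using x unfolding mem_box_cart by blast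
    then have "hat r (x $ i - p $ i) = 0" by (auto simp: hat_def a_def b_def)
    then show ?thesis by (auto simp: bump_def intro!: prod_zero)
  qed
  have "box a b \<noteq> {}"
    using assms by (auto simp: a_def b_def interval_ne_empty_cart)
  then have "integral (cbox a b) (\<lambda>x. 0) < integral (cbox a b) (bump r p)"
    by (intro integral_less continuous_on_bump ab) auto
  moreover have "integral (cbox a b) (bump r p) = integral UNIV (bump r p)"
  proof -
    have "(\<lambda>x. if x \<in> cbox a b then bump r p x else 0) = bump r p"
      using out by (intro ext) simp
    then show ?thesis
      using integral_restrict_UNIV[of "cbox a b" "bump r p"] by simp
  qed
  ultimately show ?thesis by simp
qed

definition bump_map :: "real \<Rightarrow> real^'m \<Rightarrow> real^'m \<Rightarrow> real^'m" where
  "bump_map r p y = (\<chi> i. hat_int r (y $ i - p $ i))"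

lemma C1_with_bump_map:
  fixes p :: "real^'m"
  assumes "r > 0"
  shows "C1_with (bump_map r p) (\<lambda>y v. \<chi> i. hat r (y $ i - p $ i) * v $ i)"
proof (rule C1_withI)
  show "(bump_map r p has_derivative (\<lambda>v. \<chi> i. hat r (y $ i - p $ i) * v $ i)) (at y)" for y
    unfolding has_derivative_componentwise_within[of "bump_map r p"]
  proof
    fix b :: "real^'m" assume "b \<in> Basis"
    then obtain i where b: "b = axis i 1" by (auto simp: Basis_vec_def)
    have "((\<lambda>y. y $ i - p $ i) has_derivative (\<lambda>v. v $ i)) (at y)"
      by (auto intro!: derivative_eq_intros bounded_linear_imp_has_derivative bounded_linear_vec_nth)
    from has_derivative_compose[OF this C1_withD(1)[OF C1_with_hat_int[OF assms]]]
    show "((\<lambda>x. bump_map r p x \<bullet> b) has_derivative (\<lambda>x. (\<chi> i. hat r (y $ i - p $ i) * x $ i) \<bullet> b)) (at y)"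
      by (simp add: bump_map_def b inner_axis)
  qed
  show "continuous_on UNIV (\<lambda>y. \<chi> i. hat r (y $ i - p $ i) * v $ i)" for v
    unfolding hat_def by (intro continuous_intros)
qed

text \<open>Each row is multiplied by its tent value. The weighted Jacobian of \<open>g\<close> thus
  becomes the Jacobian of a single map, to which \<open>integral_det_eq_off_compact\<close>
  applies.\<close>

lemma det_bump_map_compose:
  fixes A :: "real^'m \<Rightarrow> real^'m"
  shows "det (matrix (\<lambda>v. \<chi> i. hat r (y $ i - p $ i) * A v $ i)) = bump r p y * det (matrix A)"
proof -
  have "matrix (\<lambda>v. \<chi> i. hat r (y $ i - p $ i) * A v $ i) =
      (\<chi> i. hat r (y $ i - p $ i) *s (matrix A $ i))"
    by (simp add: matrix_def vec_eq_iff)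
  then show ?thesis
    using det_rows_mul[of "\<lambda>i. hat r (y $ i - p $ i)" "\<lambda>i. matrix A $ i"] by (simp add: bump_def)
qed

section \<open>Counting regular preimages by an integral\<close>

text \<open>The inverse function theorem is applied inside the open set where the determinant keeps
  its sign, so all points of \<open>W\<close> carry the sign of \<open>x\<close>.\<close>

lemma C1_with_locally_diffeo:
  fixes g :: "real^'m \<Rightarrow> real^'m"
  assumes g: "C1_with g g'" and det: "det (matrix (g' x)) \<noteq> 0" and U: "open U" "x \<in> U"
  obtains W where "open W" "x \<in> W" "W \<subseteq> U" "inj_on g W" "open (g ` W)"
    "\<And>y. y \<in> W \<Longrightarrow> det (matrix (g' y)) * det (matrix (g' x)) > 0"
proof -
  define V where "V = U \<inter> {y. 0 < det (matrix (g' y)) * det (matrix (g' x))}"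
  have "open V"
    unfolding V_def using U
    by (intro open_Int open_Collect_less continuous_intros C1_with_det_continuous[OF g])
  moreover have "x \<in> V"
    using det U by (simp add: V_def flip: power2_eq_square)
  ultimately have V: "open V" "x \<in> V" .
  obtain h where h: "linear h" "h \<circ> g' x = id" "g' x \<circ> h = id"
    using det_nz_iff_inj[OF C1_withD(3)[OF g]] det linear_injective_isomorphism[OF C1_withD(3)[OF g], of x]
    by (metis comp_apply eq_id_iff fun.map_id0 ext id_apply)
  have inv: "Blinfun h o\<^sub>L Blinfun (g' x) = id_blinfun"
    using h(1,2) by (intro blinfun_eqI)
      (simp add: C1_with_blinfun(2)[OF g] bounded_linear_Blinfun_apply linear_conv_bounded_linear pointfree_idE)
  show ?thesis
  proof (rule inverse_function_theorem[of V g "\<lambda>x. Blinfun (g' x)" x "Blinfun h"])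
    show "(g has_derivative blinfun_apply (Blinfun (g' y))) (at y)" for y
      by (simp add: C1_with_blinfun(2)[OF g] C1_withD(1)[OF g])
    show "continuous_on V (\<lambda>x. Blinfun (g' x))" by (rule C1_with_blinfun(1)[OF g])
    fix W Y f f' assume W: "open W" "W \<subseteq> V" "x \<in> W" "open Y" "homeomorphism W Y g f"
    show thesis
    proof (rule that[of W])
      show "inj_on g W" using W(5) by (metis homeomorphism_def inj_on_inverseI)
      show "open (g ` W)" using W(4,5) by (simp add: homeomorphism_def)
    qed (use W in \<open>auto simp: V_def\<close>)
  qed (use V inv in auto)
qed

text \<open>A singular matrix gets -1, as in \<open>has_brouwer_degree\<close>; no such matrix
  occurs over a regular value.\<close>

definition local_sign :: "real^'m^'m \<Rightarrow> real" where
  "local_sign A = (if det A > 0 then 1 else -1)"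

lemma compact_Int_vimage:
  fixes f :: "'a::t2_space \<Rightarrow> 'b::topological_space"
  assumes "compact S" "continuous_on S f" "closed T"
  shows "compact (S \<inter> f -` T)"
  using compact_Int_closed[OF assms(1) continuous_closed_preimage[OF assms(2) compact_imp_closed[OF assms(1)] assms(3)]]
  by simp

lemma has_integral_zero_off:
  fixes f :: "'a::euclidean_space \<Rightarrow> real"
  assumes "S \<subseteq> T" "\<And>x. x \<in> T - S \<Longrightarrow> f x = 0" "(f has_integral i) S"
  shows "(f has_integral i) T"
proof -
  have eq: "(\<lambda>x. if x \<in> T then f x else 0) = (\<lambda>x. if x \<in> S then f x else 0)"
    using assms(1,2) by (intro ext) auto
  have "((\<lambda>x. if x \<in> T then f x else 0) has_integral i) UNIV"
    unfolding eq using assms(3) by (simp only: has_integral_restrict_UNIV)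
  then show ?thesis by (simp only: has_integral_restrict_UNIV)
qed

text \<open>The fibre is compact, being closed in \<open>closure V\<close> and disjoint from the
  frontier, and discrete, because \<open>g\<close> is injective near each of its points.\<close>

lemma finite_regular_preimages:
  fixes g :: "real^'m \<Rightarrow> real^'m"
  assumes g: "C1_with g g'" and V: "open V" "bounded V" and p: "p \<notin> g ` frontier V"
    and reg: "\<And>x. x \<in> V \<Longrightarrow> g x = p \<Longrightarrow> det (matrix (g' x)) \<noteq> 0"
  shows "finite {x\<in>V. g x = p}"
proof -
  define Z where "Z = {x\<in>V. g x = p}"
  have "Z = {x \<in> closure V. g x = p}"
    using p V(1) by (auto simp: Z_def frontier_def interior_open closure_subset[THEN subsetD])
  also have "\<dots> = closure V \<inter> g -` {p}" by auto
  also have "compact \<dots>"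
    using V by (intro compact_Int_vimage C1_withD(4)[OF g]) auto
  finally have "compact Z" .
  have "\<exists>W. open W \<and> x \<in> W \<and> W \<inter> Z \<subseteq> {x}" if x: "x \<in> Z" for x
  proof -
    obtain W where "open W" "x \<in> W" "inj_on g W"
      by (rule C1_with_locally_diffeo[OF g, of x V]) (use x reg V in \<open>auto simp: Z_def\<close>)
    then show ?thesis using x by (intro exI[of _ W]) (auto simp: Z_def inj_on_def)
  qed
  then obtain W where W: "\<And>x. x \<in> Z \<Longrightarrow> open (W x) \<and> x \<in> W x \<and> W x \<inter> Z \<subseteq> {x}"
    by metis
  obtain F where F: "F \<subseteq> Z" "finite F" "Z \<subseteq> (\<Union>x\<in>F. W x)"
    by (rule compactE_image[OF \<open>compact Z\<close>, of Z W]) (use W in blast)+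
  then have "Z \<subseteq> F" using W by blast
  then show ?thesis using F finite_subset by (auto simp: Z_def)
qed

lemma has_integral_bump_diffeo:
  fixes g :: "real^'m::{finite,wellorder} \<Rightarrow> real^'m::_"
    and r :: real
  assumes g: "C1_with g g'" and W: "open W" "inj_on g W" "cball p (r * CARD('m)) \<subseteq> g ` W"
  shows "((\<lambda>x. bump r p (g x) * \<bar>det (matrix (g' x))\<bar>) has_integral integral UNIV (bump r p)) W"
proof -
  \<comment> \<open>The change of variables formula is applied to a vector-valued integrand, hence
    \<open>real^1\<close>.\<close>
  let ?f = "\<lambda>y. vec (bump r p y) :: real^1"
  note abs = absolutely_integrable_bump[OF W(3)]
  have "?f absolutely_integrable_on g ` W \<and> integral (g ` W) ?f = vec (integral UNIV (bump r p))"
    using abs by (simp add: absolutely_integrable_on_1_iff integral_on_1_eq)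
  moreover have "W \<in> sets lebesgue"
    using borel_open[OF W(1)] by (metis sets_completionI_sets sets_lborel)
  ultimately have "(\<lambda>x. \<bar>det (matrix (g' x))\<bar> *\<^sub>R ?f (g x)) absolutely_integrable_on W \<and>
     integral W (\<lambda>x. \<bar>det (matrix (g' x))\<bar> *\<^sub>R ?f (g x)) = vec (integral UNIV (bump r p))"
    using has_absolute_integral_change_of_variables[of W g g' ?f]
      W(2) has_derivative_at_withinI[OF C1_withD(1)[OF g]] by blast
  then have "(\<lambda>x. \<bar>det (matrix (g' x))\<bar> * bump r p (g x)) integrable_on W"
    "integral W (\<lambda>x. \<bar>det (matrix (g' x))\<bar> * bump r p (g x)) = integral UNIV (bump r p)"
    by (auto simp: absolutely_integrable_on_1_iff integral_on_1_eq vec_eq_iff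
        dest: set_lebesgue_integral_eq_integral(1))
  then show ?thesis
    by (simp add: mult.commute has_integral_iff)
qed

text \<open>For small \<open>r\<close> the part of \<open>V\<close> where the bump is seen lies in
  disjoint sheets, one around each preimage and each mapped injectively over the support. A sheet
  contributes its constant sign times the mass of the bump.\<close>

lemma has_integral_bump_count:
  fixes g :: "real^'m::{finite,wellorder} \<Rightarrow> real^'m::_"
  assumes g: "C1_with g g'" and V: "open V" "bounded V" and p: "p \<notin> g ` frontier V"
    and reg: "\<And>x. x \<in> V \<Longrightarrow> g x = p \<Longrightarrow> det (matrix (g' x)) \<noteq> 0"
  obtains e where "e > 0" "\<And>r. 0 < r \<Longrightarrow> r < e \<Longrightarrow>
    ((\<lambda>x. bump r p (g x) * det (matrix (g' x))) has_integral
      (\<Sum>x | x \<in> V \<and> g x = p. local_sign (matrix (g' x))) * integral UNIV (bump r p)) V"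
proof -
  define Z where "Z = {x\<in>V. g x = p}"
  have fin: "finite Z"
    using finite_regular_preimages[OF g V p reg] by (simp add: Z_def)
  obtain \<delta> where \<delta>: "\<And>x. \<delta> x > 0" "\<And>x y. y \<in> Z \<Longrightarrow> y \<noteq> x \<Longrightarrow> \<delta> x \<le> dist x y"
    using finite_set_avoid[OF fin] by metis
  \<comment> \<open>Half the separation radius makes the sheets disjoint.\<close>
  define Q where "Q x W \<longleftrightarrow> open W \<and> x \<in> W \<and> W \<subseteq> V \<inter> ball x (\<delta> x/2) \<and> inj_on g W \<and> open (g ` W) \<and>
      (\<forall>y\<in>W. det (matrix (g' y)) * det (matrix (g' x)) > 0)" for x W
  have "\<exists>W. Q x W" if x: "x \<in> Z" for x
    unfolding Q_def
    by (rule C1_with_locally_diffeo[OF g, of x "V \<inter> ball x (\<delta> x/2)"])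
      (use x reg V \<delta>(1)[of x] in \<open>auto simp: Z_def\<close>)
  then obtain W where W0: "\<And>x. x \<in> Z \<Longrightarrow> Q x (W x)" by metis
  have W: "open (W x)" "x \<in> W x" "W x \<subseteq> V \<inter> ball x (\<delta> x/2)" "inj_on g (W x)" "open (g ` W x)"
      "\<And>y. y \<in> W x \<Longrightarrow> det (matrix (g' y)) * det (matrix (g' x)) > 0" if "x \<in> Z" for x
    using W0[OF that] by (auto simp: Q_def)
  have disj: "W x \<inter> W y = {}" if "x \<in> Z" "y \<in> Z" "x \<noteq> y" for x y
  proof (rule ccontr)
    assume "W x \<inter> W y \<noteq> {}"
    then obtain z where "z \<in> W x" "z \<in> W y" by blast
    then have "dist x z < \<delta> x/2" "dist y z < \<delta> y/2"
      using W(3)[OF that(1)] W(3)[OF that(2)] by auto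
    then show False
      using \<delta>(2)[of y x] \<delta>(2)[of x y] that dist_triangle2[of x y z] by (simp add: dist_commute)
  qed
  have Wsub: "(\<Union>x\<in>Z. W x) \<subseteq> V" using W(3) by auto
  define C where "C = closure V - (\<Union>x\<in>Z. W x)"
  have "compact C"
    unfolding C_def using V W(1) by (intro compact_diff) auto
  have pC: "p \<notin> g ` C"
  proof
    assume "p \<in> g ` C"
    then obtain x where x: "x \<in> closure V" "g x = p" "x \<notin> (\<Union>x\<in>Z. W x)" by (auto simp: C_def)
    then have "x \<in> V" using p V(1) by (auto simp: frontier_def interior_open)
    then have "x \<in> Z" using x by (simp add: Z_def)
    then show False using x W(2) by blast
  qed
  \<comment> \<open>Points of \<open>Y\<close> are covered by every sheet and by nothing of
    \<open>closure V\<close> outside the sheets. For an empty fibre the intersection is the whole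
    space.\<close>
  define Y where "Y = - g ` C \<inter> (\<Inter>x\<in>Z. g ` W x)"
  have Y: "open Y" unfolding Y_def
    using \<open>compact C\<close> C1_withD(4)[OF g] W(5) fin
    by (intro open_Int open_Compl compact_imp_closed compact_continuous_image open_INT) auto
  have "p \<in> Y"
    using pC W(2) by (auto simp: Z_def Y_def image_iff)
  then obtain d where d: "d > 0" "cball p d \<subseteq> Y"
    using Y unfolding open_contains_cball by blast
  show ?thesis
  proof
    show "0 < d / CARD('m)" using d(1) by simp
    fix r assume r: "0 < r" "r < d / CARD('m)"
    have "r * CARD('m) \<le> d" using r by (simp add: field_simps)
    then have sub: "cball p (r * CARD('m)) \<subseteq> cball p d" by (simp add: subset_cball)
    have int: "((\<lambda>x. bump r p (g x) * det (matrix (g' x))) has_integral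
        local_sign (matrix (g' x)) * integral UNIV (bump r p)) (W x)" if x: "x \<in> Z" for x
    proof -
      have sgn: "local_sign (matrix (g' x)) * \<bar>det (matrix (g' y))\<bar> = det (matrix (g' y))" if "y \<in> W x" for y
        using W(6)[OF x that] by (auto simp: local_sign_def zero_less_mult_iff)
      have "((\<lambda>y. local_sign (matrix (g' x)) * (bump r p (g y) * \<bar>det (matrix (g' y))\<bar>)) has_integral
        local_sign (matrix (g' x)) * integral UNIV (bump r p)) (W x)"
        by (intro has_integral_mult_right has_integral_bump_diffeo[OF g])
          (use W x d(2) sub in \<open>auto simp: Y_def\<close>)
      then show ?thesis
        by (rule has_integral_eq[rotated]) (use sgn in \<open>metis mult.left_commute\<close>)
    qed
    have int_Z: "((\<lambda>x. bump r p (g x) * det (matrix (g' x))) has_integral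
       (\<Sum>x\<in>Z. local_sign (matrix (g' x)) * integral UNIV (bump r p))) (\<Union>x\<in>Z. W x)"
      by (rule has_integral_UN[OF fin int]) (auto simp: pairwise_def disj)
    have zero: "bump r p (g x) * det (matrix (g' x)) = 0" if "x \<in> V - (\<Union>x\<in>Z. W x)" for x
    proof -
      have "x \<in> C" using that closure_subset by (auto simp: C_def)
      then have "g x \<notin> cball p (r * CARD('m))" using d(2) sub unfolding Y_def by blast
      then show ?thesis by (simp add: bump_eq_0)
    qed
    have "((\<lambda>x. bump r p (g x) * det (matrix (g' x))) has_integral
       (\<Sum>x\<in>Z. local_sign (matrix (g' x)) * integral UNIV (bump r p))) V"
      by (rule has_integral_zero_off[OF Wsub zero int_Z])
    then show "((\<lambda>x. bump r p (g x) * det (matrix (g' x))) has_integral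
      (\<Sum>x | x \<in> V \<and> g x = p. local_sign (matrix (g' x))) * integral UNIV (bump r p)) V"
      by (simp add: Z_def sum_distrib_right)
  qed
qed

text \<open>The Jacobian of \<open>bump_map r p \<circ> g\<close> integrates to the signed count of the preimages times the
  mass of the bump, and depends only on the boundary behaviour of \<open>g\<close>.\<close>

lemma signed_count_eq_off_compact:
  fixes g h :: "real^'m::{finite,wellorder} \<Rightarrow> real^'m::_"
  assumes g: "C1_with g g'" and h: "C1_with h h'" and V: "open V" "bounded V"
    and p: "p \<notin> g ` frontier V"
    and C: "compact C" "C \<subseteq> V" "\<And>x. x \<notin> C \<Longrightarrow> h x = g x"
    and regg: "\<And>x. x \<in> V \<Longrightarrow> g x = p \<Longrightarrow> det (matrix (g' x)) \<noteq> 0"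
    and regh: "\<And>x. x \<in> V \<Longrightarrow> h x = p \<Longrightarrow> det (matrix (h' x)) \<noteq> 0"
  shows "(\<Sum>x | x \<in> V \<and> g x = p. local_sign (matrix (g' x))) =
    (\<Sum>x | x \<in> V \<and> h x = p. local_sign (matrix (h' x)))" (is "?c g g' = ?c h h'")
proof -
  have ph: "p \<notin> h ` frontier V"
    using p C(2,3) V(1) by (force simp: frontier_def interior_open)
  obtain e1 where e1: "e1 > 0" "\<And>r. 0 < r \<Longrightarrow> r < e1 \<Longrightarrow>
    ((\<lambda>x. bump r p (g x) * det (matrix (g' x))) has_integral ?c g g' * integral UNIV (bump r p)) V"
    using has_integral_bump_count[OF g V p regg] by blast
  obtain e2 where e2: "e2 > 0" "\<And>r. 0 < r \<Longrightarrow> r < e2 \<Longrightarrow>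
    ((\<lambda>x. bump r p (h x) * det (matrix (h' x))) has_integral ?c h h' * integral UNIV (bump r p)) V"
    using has_integral_bump_count[OF h V ph regh] by blast
  define r where "r = min e1 e2 / 2"
  have r: "0 < r" "r < e1" "r < e2" using e1(1) e2(1) by (auto simp: r_def)
  have "((\<lambda>x. bump r p (g x) * det (matrix (g' x)) - bump r p (h x) * det (matrix (h' x))) has_integral
      ?c g g' * integral UNIV (bump r p) - ?c h h' * integral UNIV (bump r p)) V"
    by (intro has_integral_diff e1 e2 r)
  \<comment> \<open>The compositions of \<open>g\<close> and \<open>h\<close> with
    \<open>bump_map r p\<close> agree off \<open>C\<close>.\<close>
  moreover have "((\<lambda>x. bump r p (g x) * det (matrix (g' x)) - bump r p (h x) * det (matrix (h' x))) has_integral 0) V"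
    using integral_det_eq_off_compact[OF C1_with_compose[OF g C1_with_bump_map[OF r(1)]]
      C1_with_compose[OF h C1_with_bump_map[OF r(1)]] C(1) _ C(2), of p p] C(3)
    by (simp add: det_bump_map_compose)
  ultimately have "?c g g' * integral UNIV (bump r p) - ?c h h' * integral UNIV (bump r p) = 0"
    by (rule has_integral_unique)
  then show ?thesis using integral_bump_pos[OF r(1), of p] by simp
qed

text \<open>The time of the homotopy is replaced by a cut-off: at \<open>x\<close> the map
  \<open>k\<close> is the homotopy at time \<open>\<rho> x\<close>. It can meet \<open>p\<close>
  only in \<open>K\<close>, the compact set of points where the homotopy meets \<open>p\<close> at
  some time. Near \<open>K\<close> it is \<open>h\<close>, so it has the count of \<open>h\<close>;
  off a compact subset of \<open>V\<close> it is \<open>g\<close>, so it has the count of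
  \<open>g\<close>.\<close>

theorem signed_count_homotopy:
  fixes g h :: "real^'m::{finite,wellorder} \<Rightarrow> real^'m::_"
  assumes g: "C1_with g g'" and h: "C1_with h h'" and V: "open V" "bounded V"
    and hom: "\<And>x t. x \<in> frontier V \<Longrightarrow> t \<in> {0..1} \<Longrightarrow> (1 - t) *\<^sub>R g x + t *\<^sub>R h x \<noteq> p"
    and regg: "\<And>x. x \<in> V \<Longrightarrow> g x = p \<Longrightarrow> det (matrix (g' x)) \<noteq> 0"
    and regh: "\<And>x. x \<in> V \<Longrightarrow> h x = p \<Longrightarrow> det (matrix (h' x)) \<noteq> 0"
  shows "(\<Sum>x | x \<in> V \<and> g x = p. local_sign (matrix (g' x))) =
    (\<Sum>x | x \<in> V \<and> h x = p. local_sign (matrix (h' x)))"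
proof -
  define H where "H z = (1 - fst z) *\<^sub>R g (snd z) + fst z *\<^sub>R h (snd z)" for z
  define K where "K = snd ` (({0..1} \<times> closure V) \<inter> H -` {p})"
  have "continuous_on ({0..1} \<times> closure V) H"
    unfolding H_def by (intro continuous_intros continuous_on_compose2[OF C1_withD(4)[OF g, of UNIV]]
        continuous_on_compose2[OF C1_withD(4)[OF h, of UNIV]]) auto
  then have "compact (({0..1} \<times> closure V) \<inter> H -` {p})"
    using V by (intro compact_Int_vimage compact_Times) auto
  then have K: "compact K"
    unfolding K_def by (intro compact_continuous_image continuous_intros)
  have Kmem: "x \<in> K \<longleftrightarrow> x \<in> closure V \<and> (\<exists>t\<in>{0..1}. (1 - t) *\<^sub>R g x + t *\<^sub>R h x = p)" for x
    by (force simp: K_def H_def image_iff)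
  have KV: "K \<subseteq> V"
    using hom V(1) by (fastforce simp: Kmem frontier_def interior_open)
  obtain \<rho> :: "real^'m::_ \<Rightarrow> real" and \<rho>' T C where \<rho>: "C1_with \<rho> \<rho>'" "open T" "K \<subseteq> T"
      "\<And>x. x \<in> T \<Longrightarrow> \<rho> x = 1" "compact C" "C \<subseteq> V" "\<And>x. x \<notin> C \<Longrightarrow> \<rho> x = 0" "\<And>x. \<rho> x \<in> {0..1}"
    by (rule C1_cutoff[OF K V(1) KV]) blast
  define k where "k x = g x + \<rho> x *\<^sub>R (h x - g x)" for x
  obtain k' where k: "C1_with k k'"
    using C1_with_add[OF g C1_with_scaleR[OF \<rho>(1) C1_with_diff[OF h g]]] unfolding k_def by blast
  have kT: "k x = h x" if "x \<in> T" for x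
    using \<rho>(4)[OF that] by (simp add: k_def)
  have k'K: "k' x = h' x" if "x \<in> K" for x
    by (rule C1_with_derivative_eq[OF k h \<rho>(2)]) (use that \<rho>(3) kT in auto)
  have khp: "x \<in> K" if "x \<in> V" "k x = p" for x
  proof -
    have "(1 - \<rho> x) *\<^sub>R g x + \<rho> x *\<^sub>R h x = p"
      using that by (simp add: k_def algebra_simps)
    then show ?thesis using that \<rho>(8)[of x] closure_subset[of V] by (auto simp: Kmem)
  qed
  have hp: "x \<in> K" if "x \<in> V" "h x = p" for x
    using that closure_subset[of V] by (auto simp: Kmem intro!: bexI[of _ 1])
  have Z: "{x. x \<in> V \<and> k x = p} = {x. x \<in> V \<and> h x = p}"
    using khp hp kT \<rho>(3) by (metis (no_types, lifting) in_mono)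
  have "p \<notin> g ` frontier V"
    using hom[of _ 0] by auto
  then have "(\<Sum>x | x \<in> V \<and> g x = p. local_sign (matrix (g' x))) =
      (\<Sum>x | x \<in> V \<and> k x = p. local_sign (matrix (k' x)))"
  proof (rule signed_count_eq_off_compact[OF g k V _ \<rho>(5,6) _ regg])
    fix x assume "x \<in> V" "k x = p"
    then have "x \<in> K" by (rule khp)
    then show "det (matrix (k' x)) \<noteq> 0"
      using regh[of x] k'K kT \<rho>(3) KV \<open>k x = p\<close> by (metis subsetD)
  qed (auto simp: k_def \<rho>(7))
  also have "\<dots> = (\<Sum>x | x \<in> V \<and> h x = p. local_sign (matrix (h' x)))"
    using k'K hp by (intro sum.cong Z) auto
  finally show ?thesis .
qed

section \<open>Signed counts in Euclidean spaces\<close>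

lemma C1_map_imp_C1_with:
  assumes "C1_map g"
  shows "C1_with g (\<lambda>x. frechet_derivative g (at x))"
proof -
  obtain g' where g': "continuous_on UNIV g'" "\<And>x. (g has_derivative blinfun_apply (g' x)) (at x)"
    using assms by (auto simp: C1_map_def)
  then have "frechet_derivative g (at x) = blinfun_apply (g' x)" for x
    using frechet_derivative_at by metis
  then show ?thesis
    using g' by (auto intro!: C1_withI continuous_intros)
qed

lemma C1_with_imp_C1_map:
  assumes "C1_with g g'"
  shows "C1_map g" "frechet_derivative g (at x) = g' x"
proof -
  show "C1_map g"
    unfolding C1_map_def
    by (intro exI[of _ "\<lambda>x. Blinfun (g' x)"])
      (simp add: C1_with_blinfun[OF assms] C1_withD(1)[OF assms])
  show "frechet_derivative g (at x) = g' x"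
    using frechet_derivative_at[OF C1_withD(1)[OF assms]] by simp
qed

definition signed_count :: "('a::euclidean_space \<Rightarrow> 'a) \<Rightarrow> 'a set \<Rightarrow> 'a \<Rightarrow> int" where
  "signed_count g V p =
     (\<Sum>x | x \<in> V \<and> g x = p. if endo_det (frechet_derivative g (at x)) > 0 then 1 else - 1)"

section \<open>Transport of determinants and counts to coordinates\<close>

context
  fixes \<beta> :: "'m::{finite,wellorder} \<Rightarrow> 'a::euclidean_space"
  assumes \<beta>: "bij_betw \<beta> UNIV Basis"
begin

definition coord :: "'a \<Rightarrow> real^'m::_" where
  "coord x = (\<chi> i. x \<bullet> \<beta> i)"

definition uncoord :: "real^'m::_ \<Rightarrow> 'a" where
  "uncoord v = (\<Sum>i\<in>UNIV. (v $ i) *\<^sub>R \<beta> i)"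

lemma linear_coord: "linear coord"
  by (rule linearI) (simp_all add: coord_def vec_eq_iff inner_add_left)

lemma linear_uncoord: "linear uncoord"
  by (rule linearI)
    (simp_all add: uncoord_def sum.distrib scaleR_sum_right scaleR_add_left)

lemma inner_\<beta>: "\<beta> i \<bullet> \<beta> j = (if i = j then 1 else 0)"
proof -
  have "\<beta> i \<in> Basis" "\<beta> j \<in> Basis" "\<beta> i = \<beta> j \<longleftrightarrow> i = j"
    using \<beta> by (auto simp: bij_betw_def inj_def)
  then show ?thesis by (simp add: inner_Basis)
qed

lemma coord_uncoord [simp]: "coord (uncoord v) = v"
  by (simp add: coord_def uncoord_def vec_eq_iff inner_sum_left inner_\<beta> if_distrib cong: if_cong)

lemma uncoord_coord [simp]: "uncoord (coord x) = x"
proof -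
  have "uncoord (coord x) = (\<Sum>b\<in>Basis. (x \<bullet> b) *\<^sub>R b)"
    unfolding uncoord_def coord_def using \<beta> by (simp add: sum.reindex_bij_betw[OF \<beta>, symmetric])
  then show ?thesis by (simp add: euclidean_representation)
qed

lemma uncoord_axis: "uncoord (axis j 1) = \<beta> j"
  by (simp add: uncoord_def axis_def if_distrib[of "\<lambda>c. c *\<^sub>R _"] cong: if_cong)

text \<open>Conjugation by \<open>\<beta>\<close> matches permutations of the indices with
  permutations of \<open>Basis\<close> and preserves signs. \<open>endo_det\<close> pairs column
  \<open>b\<close> with row \<open>\<pi> b\<close>, so the sum obtained is the determinant of the
  transpose.\<close>

lemma endo_det_eq_det: "endo_det A = det (matrix (\<lambda>v. coord (A (uncoord v))))"
proof -
  let ?M = "matrix (\<lambda>v. coord (A (uncoord v)))"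
  have M: "?M $ i $ j = A (\<beta> j) \<bullet> \<beta> i" for i j
    by (simp add: matrix_def coord_def uncoord_axis)
  define h where "h p = map_permutation UNIV \<beta> p" for p
  have img: "\<beta> ` UNIV = Basis" and inj: "inj \<beta>"
    using \<beta> by (auto simp: bij_betw_def)
  have bij: "bij_betw h {p. p permutes UNIV} {p. p permutes Basis}"
  proof -
    have "h = (\<lambda>\<pi> x. if x \<in> Basis then \<beta> (\<pi> (inv_into UNIV \<beta> x)) else x)"
      by (simp add: h_def map_permutation_def restrict_id_def img fun_eq_iff)
    then show ?thesis using bij_betw_permutations[OF \<beta>] by simp
  qed
  have "endo_det A = (\<Sum>p | p permutes (UNIV::'m set). of_int (sign (h p)) * (\<Prod>b\<in>Basis. A b \<bullet> h p b))"
    unfolding endo_det_def by (rule sum.reindex_bij_betw[OF bij, symmetric])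
  also have "\<dots> = (\<Sum>p | p permutes (UNIV::'m set). of_int (sign p) * (\<Prod>i\<in>UNIV. transpose ?M $ i $ p i))"
  proof (intro sum.cong refl)
    fix p :: "'m \<Rightarrow> 'm" assume p: "p \<in> {p. p permutes UNIV}"
    have "sign (h p) = sign p"
      unfolding h_def using p inj by (intro sign_map_permutation) auto
    moreover have "(\<Prod>b\<in>Basis. A b \<bullet> h p b) = (\<Prod>i\<in>UNIV. A (\<beta> i) \<bullet> h p (\<beta> i))"
      by (rule prod.reindex_bij_betw[OF \<beta>, symmetric])
    moreover have "h p (\<beta> i) = \<beta> (p i)" for i
      unfolding h_def using inj by (intro map_permutation_apply) auto
    ultimately show "of_int (sign (h p)) * (\<Prod>b\<in>Basis. A b \<bullet> h p b) =
        of_int (sign p) * (\<Prod>i\<in>UNIV. transpose ?M $ i $ p i)"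
      by (simp add: transpose_def M)
  qed
  also have "\<dots> = det (transpose ?M)"
    by (simp add: det_def)
  finally show ?thesis by simp
qed

lemma linear_conj: "linear (A :: 'a \<Rightarrow> 'a) \<Longrightarrow> linear (\<lambda>v. coord (A (uncoord v)))"
  using linear_compose[OF linear_compose[OF linear_uncoord] linear_coord] by (simp add: o_def)

lemma endo_det_compose:
  fixes A B :: "'a \<Rightarrow> 'a"
  assumes "linear A" "linear B"
  shows "endo_det (A \<circ> B) = endo_det A * endo_det B"
proof -
  have "(\<lambda>v. coord ((A \<circ> B) (uncoord v))) = (\<lambda>v. coord (A (uncoord v))) \<circ> (\<lambda>v. coord (B (uncoord v)))"
    by (simp add: o_def)
  then show ?thesis
    by (simp add: endo_det_eq_det matrix_compose linear_conj assms det_mul)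
qed

lemma endo_det_nonzero_iff:
  fixes A :: "'a \<Rightarrow> 'a"
  assumes A: "linear A"
  shows "endo_det A \<noteq> 0 \<longleftrightarrow> inj A"
proof -
  have "inj (\<lambda>v. coord (A (uncoord v))) \<longleftrightarrow> inj A"
    unfolding inj_def by (metis coord_uncoord uncoord_coord)
  then show ?thesis
    using det_nz_iff_inj[OF linear_conj[OF A]] by (simp add: endo_det_eq_det)
qed

lemma C1_conj:
  fixes g :: "'a \<Rightarrow> 'a"
  assumes "C1_map g"
  shows "C1_with (\<lambda>v. coord (g (uncoord v)))
    (\<lambda>v w. coord (frechet_derivative g (at (uncoord v)) (uncoord w)))"
  using C1_with_compose[OF C1_with_compose[OF C1_with_linear[OF linear_uncoord] C1_map_imp_C1_with[OF assms]]
      C1_with_linear[OF linear_coord]] .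

lemma coord_image_eq_vimage: "coord ` V = uncoord -` V"
  by (auto simp: image_iff) (metis coord_uncoord)

lemma coord_topology:
  "open (V :: 'a set) \<Longrightarrow> open (coord ` V)" "bounded V \<Longrightarrow> bounded (coord ` V)"
  "frontier (coord ` V) = coord ` frontier V"
proof -
  have bl: "bounded_linear coord" "bounded_linear uncoord"
    using linear_coord linear_uncoord linear_conv_bounded_linear by blast+
  then have c: "continuous_on S coord" "continuous_on T uncoord" for S T
    by (auto intro: linear_continuous_on)
  show "open V \<Longrightarrow> open (coord ` V)"
    unfolding coord_image_eq_vimage using c(2) open_vimage by blast
  show "bounded V \<Longrightarrow> bounded (coord ` V)"
    using bounded_linear_image bl by blast
  have inj: "inj coord" by (metis injI uncoord_coord)
  have surj: "surj coord" by (metis coord_uncoord surjI)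
  have 1: "closure (coord ` V) = coord ` closure V"
    using closure_injective_linear_image[OF linear_coord inj] by simp
  have 2: "interior (coord ` V) = coord ` interior V"
    using interior_bijective_linear_image[OF linear_coord] inj surj by (simp add: bij_def)
  show "frontier (coord ` V) = coord ` frontier V"
    unfolding frontier_def 1 2 using inj by (simp add: image_set_diff)
qed

lemma signed_count_coord:
  fixes g :: "'a \<Rightarrow> 'a"
  shows "real_of_int (signed_count g V p) =
    (\<Sum>v | v \<in> coord ` V \<and> coord (g (uncoord v)) = coord p.
      local_sign (matrix (\<lambda>w. coord (frechet_derivative g (at (uncoord v)) (uncoord w)))))"
proof -
  have "bij_betw coord {x. x \<in> V \<and> g x = p} {v. v \<in> coord ` V \<and> coord (g (uncoord v)) = coord p}"
    by (rule bij_betwI[where g = uncoord]) (auto, metis uncoord_coord)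
  then show ?thesis
    unfolding signed_count_def of_int_sum
    by (subst sum.reindex_bij_betw[symmetric]) (auto simp: local_sign_def endo_det_eq_det intro!: sum.cong)
qed

lemma regular_value_on_coord:
  fixes g :: "'a \<Rightarrow> 'a"
  assumes "regular_value_on g V p" "v \<in> coord ` V" "coord (g (uncoord v)) = coord p"
  shows "det (matrix (\<lambda>w. coord (frechet_derivative g (at (uncoord v)) (uncoord w)))) \<noteq> 0"
proof -
  have "g (uncoord v) = p" "uncoord v \<in> V"
    using assms(2,3) by (auto, metis uncoord_coord)
  then show ?thesis using assms(1) by (auto simp: regular_value_on_def endo_det_eq_det)
qed

theorem signed_count_homotopy_invariant:
  fixes g h :: "'a \<Rightarrow> 'a"
  assumes g: "C1_map g" "regular_value_on g V p" and h: "C1_map h" "regular_value_on h V p"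
    and V: "open V" "bounded V"
    and hom: "\<And>x t. x \<in> frontier V \<Longrightarrow> t \<in> {0..1} \<Longrightarrow> (1 - t) *\<^sub>R g x + t *\<^sub>R h x \<noteq> p"
  shows "signed_count g V p = signed_count h V p"
proof -
  have "real_of_int (signed_count g V p) = real_of_int (signed_count h V p)"
    unfolding signed_count_coord
  proof (rule signed_count_homotopy[OF C1_conj[OF g(1)] C1_conj[OF h(1)]])
    fix v t assume v: "v \<in> frontier (coord ` V)" and t: "t \<in> {0..1::real}"
    then have "(1 - t) *\<^sub>R g (uncoord v) + t *\<^sub>R h (uncoord v) \<noteq> p"
      by (intro hom) (auto simp: coord_topology)
    then have "coord ((1 - t) *\<^sub>R g (uncoord v) + t *\<^sub>R h (uncoord v)) \<noteq> coord p"
      by (metis uncoord_coord)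
    then show "(1 - t) *\<^sub>R coord (g (uncoord v)) + t *\<^sub>R coord (h (uncoord v)) \<noteq> coord p"
      by (simp add: linear_add[OF linear_coord] linear_scale[OF linear_coord])
  qed (use V coord_topology regular_value_on_coord g(2) h(2) in auto)
  then show ?thesis by simp
qed

lemma finite_preimages_regular_value:
  fixes g :: "'a \<Rightarrow> 'a"
  assumes g: "C1_map g" "regular_value_on g V p" and V: "open V" "bounded V"
    and p: "p \<notin> g ` frontier V"
  shows "finite {x \<in> V. g x = p}"
proof -
  have "finite {v \<in> coord ` V. coord (g (uncoord v)) = coord p}"
  proof (rule finite_regular_preimages[OF C1_conj[OF g(1)]])
    show "coord p \<notin> (\<lambda>v. coord (g (uncoord v))) ` frontier (coord ` V)"
    proof
      assume "coord p \<in> (\<lambda>v. coord (g (uncoord v))) ` frontier (coord ` V)"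
      then obtain x where "x \<in> frontier V" "coord p = coord (g x)"
        by (auto simp: coord_topology)
      then show False using p by (metis imageI uncoord_coord)
    qed
  qed (use V coord_topology regular_value_on_coord g(2) in auto)
  then have "finite (uncoord ` {v \<in> coord ` V. coord (g (uncoord v)) = coord p})"
    by (rule finite_imageI)
  then show ?thesis
    by (rule finite_subset[rotated]) (auto simp: image_iff, metis uncoord_coord)
qed

text \<open>Sard in equal dimensions: the critical values form a null set, which cannot contain the
  image of a ball.\<close>

lemma regular_values_dense:
  fixes g :: "'a \<Rightarrow> 'a"
  assumes g: "C1_map g" and e: "e > 0"
  obtains q where "dist q p < e" "regular_value_on g UNIV q"
proof -
  define G where "G v = coord (g (uncoord v))" for v
  define G' where "G' v w = coord (frechet_derivative g (at (uncoord v)) (uncoord w))" for v w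
  have G: "C1_with G G'"
    unfolding G_def G'_def by (rule C1_conj[OF g])
  define S where "S = {v. det (matrix (G' v)) = 0}"
  have "negligible (G ` S)"
  proof (rule baby_Sard)
    show "(G has_derivative G' v) (at v within S)" for v
      using C1_withD(1)[OF G] has_derivative_at_withinI by blast
    show "rank (matrix (G' v)) < CARD('m)" if "v \<in> S" for v
      using that by (simp add: S_def det_eq_0_rank)
  qed simp
  moreover have "open (coord ` ball p e)" "coord ` ball p e \<noteq> {}"
    using coord_topology(1) e by auto
  ultimately have "\<not> coord ` ball p e \<subseteq> G ` S"
    using open_not_negligible negligible_subset by blast
  then obtain q where q: "q \<in> ball p e" "coord q \<notin> G ` S" by blast
  have "regular_value_on g UNIV q"
    unfolding regular_value_on_def
  proof (intro ballI impI)
    fix x assume "g x = q"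
    then have "coord x \<notin> S" using q(2) imageI[of "coord x" S G] \<open>g x = q\<close> by (auto simp: G_def)
    then show "endo_det (frechet_derivative g (at x)) \<noteq> 0"
      by (simp add: S_def G'_def[abs_def] endo_det_eq_det)
  qed
  then show ?thesis using that[of q] q(1) by (simp add: dist_commute)
qed

end

section \<open>Approximation by maps with a prescribed regular value\<close>

lemma C1_with_real_polynomial_function:
  fixes p :: "'a::euclidean_space \<Rightarrow> real"
  assumes "real_polynomial_function p"
  shows "\<exists>p'. C1_with p p'"
  using assms
proof (induction rule: real_polynomial_function.induct)
  case (linear f)
  then show ?case using C1_with_linear linear_conv_bounded_linear by blast
next
  case (const c)
  then show ?case using C1_with_const by blast
next
  case (add f g)
  then show ?case using C1_with_add by blast
next
  case (mult f g)
  then show ?case using C1_with_scaleR[of f _ g] by (auto simp: real_scaleR_def)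
qed

lemma C1_map_polynomial_function:
  fixes g :: "'a::euclidean_space \<Rightarrow> 'a"
  assumes "polynomial_function g"
  shows "C1_map g"
proof -
  have "\<exists>p'. C1_with (\<lambda>x. g x \<bullet> b) p'" if "b \<in> Basis" for b
    using assms that by (intro C1_with_real_polynomial_function) (simp add: polynomial_function_iff_Basis_inner)
  then obtain p' where p': "\<And>b. b \<in> Basis \<Longrightarrow> C1_with (\<lambda>x. g x \<bullet> b) (p' b)" by metis
  have "C1_with (\<lambda>x. \<Sum>b\<in>Basis. (g x \<bullet> b) *\<^sub>R b) (\<lambda>x v. \<Sum>b\<in>Basis. (g x \<bullet> b) *\<^sub>R 0 + p' b x v *\<^sub>R b)"
    by (intro C1_with_sum C1_with_scaleR p' C1_with_const)
  then show ?thesis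
    using C1_with_imp_C1_map(1) by (simp add: euclidean_representation)
qed

text \<open>Half of \<open>e\<close> pays for a polynomial approximation, for which \<open>p\<close>
  may be critical; the other half pays for the translation by \<open>p - q\<close> that moves a
  nearby regular value \<open>q\<close> to \<open>p\<close>.\<close>

lemma C1_regular_approximation:
  fixes f :: "'a::euclidean_space \<Rightarrow> 'a" and \<beta> :: "'m::{finite,wellorder} \<Rightarrow> 'a"
  assumes \<beta>: "bij_betw \<beta> UNIV Basis" and S: "compact S" "continuous_on S f" and e: "e > 0"
  obtains h where "C1_map h" "regular_value_on h UNIV p" "\<And>x. x \<in> S \<Longrightarrow> dist (f x) (h x) < e"
proof -
  obtain g where g: "polynomial_function g" "\<And>x. x \<in> S \<Longrightarrow> norm (f x - g x) < e/2"
    using Stone_Weierstrass_polynomial_function[OF S, of "e/2"] e by auto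
  obtain q where q: "dist q p < e/2" "regular_value_on g UNIV q"
    using regular_values_dense[OF \<beta> C1_map_polynomial_function[OF g(1)], of "e/2"] e by auto
  have C: "C1_with (\<lambda>x. g x + (p - q)) (\<lambda>x v. frechet_derivative g (at x) v + 0)"
    by (intro C1_with_add C1_with_const C1_map_imp_C1_with C1_map_polynomial_function g)
  show ?thesis
  proof (rule that)
    show "C1_map (\<lambda>x. g x + (p - q))" using C1_with_imp_C1_map(1)[OF C] .
    have "g x + (p - q) = p \<longleftrightarrow> g x = q" for x
      by (auto simp: algebra_simps)
    then show "regular_value_on (\<lambda>x. g x + (p - q)) UNIV p"
      using q(2) by (auto simp: regular_value_on_def C1_with_imp_C1_map(2)[OF C])
    show "dist (f x) (g x + (p - q)) < e" if "x \<in> S" for x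
    proof -
      have "dist (f x) (g x + (p - q)) = norm ((f x - g x) + (q - p))"
        by (simp add: dist_norm algebra_simps)
      also have "\<dots> < e/2 + e/2"
        using g(2)[OF that] q(1) by (intro norm_add_less) (auto simp: dist_norm)
      finally show ?thesis by simp
    qed
  qed
qed

section \<open>Comparison of the Carnot--Caratheodory distance with a gauge\<close>

text \<open>Difference quotients are bounded by \<open>L\<close>, so dominated convergence applies.
  The integral of a quotient is a difference of averages of \<open>f\<close> over intervals of
  length \<open>h k\<close> at \<open>s\<close> and at 0. The bound on \<open>f'\<close> is
  inherited from the quotients.\<close>

lemma lipschitz_has_integral_derivative:
  fixes f f' :: "real \<Rightarrow> real"
  assumes lip: "L-lipschitz_on {0..1} f" and N: "negligible N"
    and deriv: "\<And>x. x \<in> {0..1} - N \<Longrightarrow> (f has_real_derivative f' x) (at x)"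
    and s: "s \<in> {0..1}"
  shows "(f' has_integral (f s - f 0)) {0..s}"
    and "x \<in> {0<..<s} - N \<Longrightarrow> \<bar>f' x\<bar> \<le> L"
proof -
  \<comment> \<open>Clamping the argument keeps the Lipschitz bound and defines the quotients up to
    the right end.\<close>
  define F where "F x = f (min 1 (max 0 x))" for x
  have F: "\<bar>F x - F y\<bar> \<le> L * \<bar>x - y\<bar>" for x y
  proof -
    have "\<bar>F x - F y\<bar> \<le> L * \<bar>min 1 (max 0 x) - min 1 (max 0 y)\<bar>"
      using lipschitz_onD[OF lip, of "min 1 (max 0 x)" "min 1 (max 0 y)"] by (simp add: F_def dist_real_def)
    also have "\<dots> \<le> L * \<bar>x - y\<bar>"
      using lipschitz_on_nonneg[OF lip] by (intro mult_left_mono) auto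
    finally show ?thesis .
  qed
  have contF: "continuous_on S F" for S
    by (rule lipschitz_on_continuous_on[of L])
      (use F lipschitz_on_nonneg[OF lip] in \<open>auto intro!: lipschitz_onI simp: dist_real_def\<close>)
  define h where "h k = 1 / (real k + 1)" for k :: nat
  have h: "h k > 0" "h \<longlonglongrightarrow> 0" for k
    using LIMSEQ_inverse_real_of_nat by (auto simp: h_def[abs_def] inverse_eq_divide add.commute)
  define q where "q k x = (F (x + h k) - F x) / h k" for k x
  define S where "S = {0<..<s} - N"
  have q_bound: "\<bar>q k x\<bar> \<le> L" for k x
    using F[of "x + h k" x] h(1)[of k] by (simp add: q_def field_simps)
  have q_lim: "(\<lambda>k. q k x) \<longlonglongrightarrow> f' x" if "x \<in> S" for x
  proof -
    have x: "0 < x" "x < 1" "x \<in> {0..1} - N" using that s by (auto simp: S_def)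
    have "(F has_real_derivative f' x) (at x)"
      by (rule has_field_derivative_transform_within_open[OF deriv[OF x(3)], of "{0<..<1}"])
        (use x in \<open>auto simp: F_def\<close>)
    then have "((\<lambda>y. (F (x + y) - F x) / y) \<longlongrightarrow> f' x) (at 0)"
      by (simp add: DERIV_def)
    moreover have "filterlim h (at 0) sequentially"
      unfolding filterlim_at using h(2) less_imp_neq[OF h(1)] by auto
    ultimately show ?thesis
      unfolding q_def by (rule filterlim_compose)
  qed
  show "\<bar>f' x\<bar> \<le> L" if "x \<in> {0<..<s} - N"
    by (rule LIMSEQ_le_const2[OF tendsto_rabs[OF q_lim]]) (use q_bound that in \<open>auto simp: S_def\<close>)
  have neg: "negligible (S - {0..s})" "negligible ({0..s} - S)"
  proof -
    have "negligible (N \<union> {0, s})" using N by simp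
    then show "negligible (S - {0..s})" "negligible ({0..s} - S)"
      by (rule negligible_subset, force simp: S_def)+
  qed
  have sym: "negligible (sym_diff S {0..s})" using neg by (simp add: negligible_Un)
  have q_int0: "q k integrable_on {0..s}" for k
    unfolding q_def by (intro integrable_continuous_interval continuous_intros continuous_on_compose2[OF contF[of UNIV]]) 
      (use h(1)[of k] in auto)
  then have q_int: "q k integrable_on S" for k
    using integrable_spike_set_eq[OF sym] by blast
  have conv: "f' integrable_on S" "(\<lambda>k. integral S (q k)) \<longlonglongrightarrow> integral S f'"
    using dominated_convergence[of q S "\<lambda>_. L" f'] q_int q_lim q_bound
      integrable_spike_set_eq[OF sym, of "\<lambda>_. L"] by auto
  have "(\<lambda>k. integral S (q k)) \<longlonglongrightarrow> F s - F 0"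
  proof -
    have bound: "\<bar>integral S (q k) - (F s - F 0)\<bar> \<le> 2 * L * h k" for k
    proof -
      have i: "F integrable_on {a..b}" for a b by (intro integrable_continuous_interval contF)
      have shift: "integral {0..s} (\<lambda>x. F (x + h k)) = integral {h k..s + h k} F"
        using integral_shift_real_ivl[of "h k" "h k" "s + h k" F] by simp
      have "integral {0..s + h k} F = integral {0..h k} F + integral {h k..s + h k} F"
        "integral {0..s + h k} F = integral {0..s} F + integral {s..s + h k} F"
        using Henstock_Kurzweil_Integration.integral_combine[of 0 "h k" "s + h k" F]
          Henstock_Kurzweil_Integration.integral_combine[of 0 s "s + h k" F] i s h(1)[of k] by auto
      then have eq: "integral {h k..s + h k} F - integral {0..s} F = integral {s..s + h k} F - integral {0..h k} F"
        by simp
      have "integral S (q k) = integral {0..s} (q k)"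
        by (rule integral_spike_set) (rule negligible_subset[OF neg(1)] negligible_subset[OF neg(2)], blast)+
      also have "\<dots> = (integral {0..s} (\<lambda>x. F (x + h k)) - integral {0..s} F) / h k"
        unfolding q_def using i
        by (subst integral_diff[symmetric]) (auto intro!: integrable_continuous_interval continuous_intros continuous_on_compose2[OF contF[of UNIV]])
      finally have qk: "integral S (q k) = (integral {s..s + h k} F - integral {0..h k} F) / h k"
        unfolding shift eq .
      \<comment> \<open>The average over an interval of length \<open>h k\<close> misses the value
        at the left end by at most \<open>L * h k\<close>; stated with the denominator
        cleared.\<close>
      have avg: "\<bar>integral {a..a + h k} F - h k * F a\<bar> \<le> L * h k * h k" for a
      proof -
        have "integral {a..a + h k} F - h k * F a = integral {a..a + h k} (\<lambda>x. F x - F a)"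
          using i h(1)[of k] by (subst integral_diff) auto
        also have "norm \<dots> \<le> L * h k * (a + h k - a)"
        proof (rule integral_bound)
          fix x assume "x \<in> {a..a + h k}"
          then show "norm (F x - F a) \<le> L * h k"
            using F[of x a] lipschitz_on_nonneg[OF lip] mult_left_mono[of "\<bar>x - a\<bar>" "h k" L] by auto
        qed (use h(1)[of k] contF in \<open>auto intro!: continuous_intros\<close>)
        finally show ?thesis by simp
      qed
      have "\<bar>integral S (q k) - (F s - F 0)\<bar> * h k =
          \<bar>(integral {s..s + h k} F - h k * F s) - (integral {0..0 + h k} F - h k * F 0)\<bar>"
        unfolding qk using h(1)[of k] by (simp add: abs_mult[symmetric] field_simps flip: abs_mult_pos)
      also have "\<dots> \<le> L * h k * h k + L * h k * h k"
        using avg[of s] avg[of 0] by linarith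
      finally have "\<bar>integral S (q k) - (F s - F 0)\<bar> * h k \<le> (2 * L * h k) * h k" by (simp add: algebra_simps)
      then show ?thesis using h(1)[of k] by (rule mult_right_le_imp_le)
    qed
    have "(\<lambda>k. 2 * L * h k) \<longlonglongrightarrow> 2 * L * 0"
      by (intro tendsto_intros h)
    then have lim: "(\<lambda>k. 2 * L * h k) \<longlonglongrightarrow> 0" by simp
    have "\<forall>\<^sub>F k in sequentially. norm (integral S (q k) - (F s - F 0)) \<le> 2 * L * h k"
      using bound by simp
    then have "(\<lambda>k. integral S (q k) - (F s - F 0)) \<longlonglongrightarrow> 0"
      using lim by (rule Lim_null_comparison)
    then show ?thesis by (simp add: LIM_zero_iff)
  qed
  then have "integral S f' = F s - F 0"
    using conv(2) LIMSEQ_unique by blast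
  then have "(f' has_integral (F s - F 0)) S"
    using conv(1) by (simp add: has_integral_iff)
  moreover have "(f' has_integral (F s - F 0)) S \<longleftrightarrow> (f' has_integral (F s - F 0)) {0..s}"
    by (rule has_integral_spike_set_eq)
      (rule negligible_subset[OF neg(2)] negligible_subset[OF neg(1)], blast)+
  ultimately show "(f' has_integral (f s - f 0)) {0..s}"
    using s by (simp add: F_def)
qed

section \<open>Horizontal vectors and lengths of curves\<close>

lemma horizontal_sum:
  "(\<Sum>i\<in>UNIV. a i *\<^sub>R heis_X i (x, y, t) + b i *\<^sub>R heis_Y i (x, y, t)) =
    ((\<chi> i. a i), (\<chi> i. b i), 2 * (y \<bullet> (\<chi> i. a i) - x \<bullet> (\<chi> i. b i)))"
proof -
  have e: "(\<Sum>i\<in>UNIV. c i *\<^sub>R axis i 1) = (\<chi> i. c i)" for c :: "'a \<Rightarrow> real"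
    by (simp add: vec_eq_iff axis_def if_distrib cong: if_cong)
  have "fst (\<Sum>i\<in>UNIV. a i *\<^sub>R heis_X i (x, y, t) + b i *\<^sub>R heis_Y i (x, y, t)) = (\<chi> i. a i)"
    "fst (snd (\<Sum>i\<in>UNIV. a i *\<^sub>R heis_X i (x, y, t) + b i *\<^sub>R heis_Y i (x, y, t))) = (\<chi> i. b i)"
    "snd (snd (\<Sum>i\<in>UNIV. a i *\<^sub>R heis_X i (x, y, t) + b i *\<^sub>R heis_Y i (x, y, t))) =
      2 * (y \<bullet> (\<chi> i. a i) - x \<bullet> (\<chi> i. b i))"
    by (simp_all add: fst_sum snd_sum e inner_vec_def sum_distrib_left sum_subtractf[symmetric] algebra_simps)
  then show ?thesis by (simp add: prod_eq_iff)
qed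

text \<open>The equation says that the contact form \<open>dt - 2 (y dx - x dy)\<close> vanishes. It
  annihilates the spanning fields; conversely the horizontal coordinates of \<open>v\<close> are the
  coefficients of the required combination.\<close>

lemma horizontal_plane_iff:
  "v \<in> horizontal_plane (x, y, t) \<longleftrightarrow> snd (snd v) = 2 * (y \<bullet> fst v - x \<bullet> fst (snd v))"
proof
  let ?S = "{v. snd (snd v) = 2 * (y \<bullet> fst v - x \<bullet> fst (snd v))}"
  assume "v \<in> horizontal_plane (x, y, t)"
  moreover have "subspace ?S"
  proof (rule subspaceI)
    show "c *\<^sub>R u \<in> ?S" if "u \<in> ?S" for c u
      using that by (simp add: right_diff_distrib mult.left_commute)
  qed (simp_all add: inner_add_right algebra_simps)
  moreover have "range (\<lambda>i. heis_X i (x, y, t)) \<union> range (\<lambda>i. heis_Y i (x, y, t)) \<subseteq> ?S"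
    by (auto simp: inner_axis)
  ultimately show "snd (snd v) = 2 * (y \<bullet> fst v - x \<bullet> fst (snd v))"
    unfolding horizontal_plane_def using span_minimal by blast
next
  assume v: "snd (snd v) = 2 * (y \<bullet> fst v - x \<bullet> fst (snd v))"
  have "v = (\<Sum>i\<in>UNIV. (fst v $ i) *\<^sub>R heis_X i (x, y, t) + (fst (snd v) $ i) *\<^sub>R heis_Y i (x, y, t))"
    using v by (simp add: horizontal_sum prod_eq_iff del: heis_X.simps heis_Y.simps)
  also have "\<dots> \<in> horizontal_plane (x, y, t)"
    unfolding horizontal_plane_def
    by (intro span_sum span_add span_scale span_base) auto
  finally show "v \<in> horizontal_plane (x, y, t)" .
qed

lemma horizontal_norm_eq:
  assumes "v \<in> horizontal_plane p"
  shows "horizontal_norm p v = norm (fst v, fst (snd v))"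
proof -
  obtain x y t where p: "p = (x, y, t)" by (cases p)
  have v: "snd (snd v) = 2 * (y \<bullet> fst v - x \<bullet> fst (snd v))"
    using assms by (simp add: p horizontal_plane_iff)
  have n: "sqrt (\<Sum>i\<in>UNIV. (a i)\<^sup>2 + (b i)\<^sup>2) = norm ((\<chi> i. a i) :: real^'a, (\<chi> i. b i) :: real^'a)" for a b
    by (simp add: norm_Pair norm_vec_def L2_set_def sum.distrib sum_nonneg)
  show ?thesis
    unfolding horizontal_norm_def
  proof (rule the_equality)
    show "\<exists>a b. v = (\<Sum>i\<in>UNIV. a i *\<^sub>R heis_X i p + b i *\<^sub>R heis_Y i p) \<and>
        norm (fst v, fst (snd v)) = sqrt (\<Sum>i\<in>UNIV. (a i)\<^sup>2 + (b i)\<^sup>2)"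
      by (rule exI[of _ "\<lambda>i. fst v $ i"], rule exI[of _ "\<lambda>i. fst (snd v) $ i"])
        (use v in \<open>simp add: p horizontal_sum n prod_eq_iff del: heis_X.simps heis_Y.simps\<close>)
    show "r = norm (fst v, fst (snd v))"
      if "\<exists>a b. v = (\<Sum>i\<in>UNIV. a i *\<^sub>R heis_X i p + b i *\<^sub>R heis_Y i p) \<and>
        r = sqrt (\<Sum>i\<in>UNIV. (a i)\<^sup>2 + (b i)\<^sup>2)" for r
      using that by (auto simp: p horizontal_sum n simp del: heis_X.simps heis_Y.simps)
  qed
qed

lemma horizontal_curveE:
  assumes "horizontal_curve \<gamma>"
  obtains L N where "L-lipschitz_on {0..1} \<gamma>" "negligible N"
    "\<And>\<tau>. \<tau> \<in> {0..1} - N \<Longrightarrow> (\<gamma> has_vector_derivative vector_derivative \<gamma> (at \<tau>)) (at \<tau>)"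
    "\<And>\<tau>. \<tau> \<in> {0..1} - N \<Longrightarrow> vector_derivative \<gamma> (at \<tau>) \<in> horizontal_plane (\<gamma> \<tau>)"
proof -
  obtain L where L: "L-lipschitz_on {0..1} \<gamma>"
    using assms by (auto simp: horizontal_curve_def)
  have "AE \<tau> in lebesgue. \<tau> \<in> {0..1} \<longrightarrow>
        \<gamma> differentiable (at \<tau>) \<and> vector_derivative \<gamma> (at \<tau>) \<in> horizontal_plane (\<gamma> \<tau>)"
    using assms by (simp add: horizontal_curve_def AE_restrict_space_iff imp_conjR)
  then obtain N where N: "N \<in> null_sets lebesgue"
    "{\<tau> \<in> space lebesgue. \<not> (\<tau> \<in> {0..1} \<longrightarrow>
        \<gamma> differentiable (at \<tau>) \<and> vector_derivative \<gamma> (at \<tau>) \<in> horizontal_plane (\<gamma> \<tau>))} \<subseteq> N"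
    by (auto elim!: AE_E2 simp: eventually_ae_filter)
  show ?thesis
  proof (rule that[OF L])
    show "negligible N" using N(1) by (simp add: negligible_iff_null_sets)
    show "(\<gamma> has_vector_derivative vector_derivative \<gamma> (at \<tau>)) (at \<tau>)" if "\<tau> \<in> {0..1} - N" for \<tau>
      using N(2) that by (auto simp flip: vector_derivative_works)
    show "vector_derivative \<gamma> (at \<tau>) \<in> horizontal_plane (\<gamma> \<tau>)" if "\<tau> \<in> {0..1} - N" for \<tau>
      using N(2) that by auto
  qed
qed

text \<open>Reduces curves to scalar functions: a linear functional of the curve is Lipschitz, so
  its derivative is bounded almost everywhere and hence absolutely integrable.\<close>

lemma lipschitz_linear_functional_derivative:
  fixes \<gamma> :: "real \<Rightarrow> 'a::euclidean_space" and \<phi> :: "'a \<Rightarrow> real"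
  assumes \<phi>: "bounded_linear \<phi>" and lip: "L-lipschitz_on {0..1} \<gamma>" and N: "negligible N"
    and deriv: "\<And>\<tau>. \<tau> \<in> {0..1} - N \<Longrightarrow> (\<gamma> has_vector_derivative w \<tau>) (at \<tau>)"
    and s: "s \<in> {0..1}"
  shows "((\<lambda>\<tau>. \<phi> (w \<tau>)) has_integral (\<phi> (\<gamma> s) - \<phi> (\<gamma> 0))) {0..s}"
    "(\<lambda>\<tau>. \<phi> (w \<tau>)) absolutely_integrable_on {0..1}"
proof -
  obtain B where B: "B \<ge> 0" "\<And>x. norm (\<phi> x) \<le> norm x * B"
    using bounded_linear.nonneg_bounded[OF \<phi>] by blast
  have lip': "(B * L)-lipschitz_on {0..1} (\<lambda>\<tau>. \<phi> (\<gamma> \<tau>))"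
  proof (rule lipschitz_onI)
    fix a b :: real assume ab: "a \<in> {0..1}" "b \<in> {0..1}"
    have "dist (\<phi> (\<gamma> a)) (\<phi> (\<gamma> b)) = norm (\<phi> (\<gamma> a - \<gamma> b))"
      by (simp add: dist_norm linear_diff[OF bounded_linear.linear[OF \<phi>]])
    also have "\<dots> \<le> dist (\<gamma> a) (\<gamma> b) * B" using B(2) by (simp add: dist_norm)
    also have "\<dots> \<le> L * dist a b * B"
      using lipschitz_onD[OF lip ab] B(1) by (rule mult_right_mono)
    finally show "dist (\<phi> (\<gamma> a)) (\<phi> (\<gamma> b)) \<le> B * L * dist a b" by (simp add: mult_ac)
  qed (use B lipschitz_on_nonneg[OF lip] in auto)
  have d: "((\<lambda>\<tau>. \<phi> (\<gamma> \<tau>)) has_real_derivative \<phi> (w \<tau>)) (at \<tau>)" if "\<tau> \<in> {0..1} - N" for \<tau>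
    using bounded_linear.has_vector_derivative[OF \<phi> deriv[OF that]]
    by (simp add: has_real_derivative_iff_has_vector_derivative)
  note F = lipschitz_has_integral_derivative[OF lip' N d]
  show "((\<lambda>\<tau>. \<phi> (w \<tau>)) has_integral (\<phi> (\<gamma> s) - \<phi> (\<gamma> 0))) {0..s}"
    using F(1)[OF _ s] by simp
  have "(\<lambda>\<tau>. \<phi> (w \<tau>)) integrable_on {0..1}"
    using F(1)[of 1] by auto
  then have "(\<lambda>\<tau>. \<phi> (w \<tau>)) integrable_on {0<..<1} - N"
    by (rule integrable_spike_set) (rule negligible_subset[of "N \<union> {0,1}"], use N in auto)+
  then have "(\<lambda>\<tau>. \<phi> (w \<tau>)) absolutely_integrable_on {0<..<1} - N"
  proof (rule absolutely_integrable_integrable_bound[rotated -2])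
    show "(\<lambda>_. B * L) integrable_on {0<..<1} - N"
      by (rule integrable_spike_set[of _ "{0..1}"], rule integrable_const_ivl) 
        (rule negligible_subset[of "N \<union> {0,1}"], use N in auto)+
    show "norm (\<phi> (w \<tau>)) \<le> B * L" if "\<tau> \<in> {0<..<1} - N" for \<tau>
      using F(2)[of 1 \<tau>] that by simp
  qed
  then show "(\<lambda>\<tau>. \<phi> (w \<tau>)) absolutely_integrable_on {0..1}"
    by (rule absolutely_integrable_spike_set) (rule negligible_subset[of "N \<union> {0,1}"], use N in auto)+
qed

text \<open>\<open>horizontal_norm\<close> is a definite description, meaningful for horizontal
  vectors only. This closed formula makes sense everywhere and agrees with it almost everywhere
  along a horizontal curve.\<close>

definition speed :: "(real \<Rightarrow> 'n::finite heis) \<Rightarrow> real \<Rightarrow> real" where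
  "speed \<gamma> \<tau> = norm (fst (vector_derivative \<gamma> (at \<tau>)), fst (snd (vector_derivative \<gamma> (at \<tau>))))"

text \<open>Integrability ensures that \<open>horizontal_length\<close> is a genuine integral and
  not the default value.\<close>

lemma horizontal_length_eq:
  assumes "horizontal_curve \<gamma>"
  shows "speed \<gamma> integrable_on {0..1}" "horizontal_length \<gamma> = integral {0..1} (speed \<gamma>)"
proof -
  obtain L N where LN: "L-lipschitz_on {0..1} \<gamma>" "negligible N"
    "\<And>\<tau>. \<tau> \<in> {0..1} - N \<Longrightarrow> (\<gamma> has_vector_derivative vector_derivative \<gamma> (at \<tau>)) (at \<tau>)"
    "\<And>\<tau>. \<tau> \<in> {0..1} - N \<Longrightarrow> vector_derivative \<gamma> (at \<tau>) \<in> horizontal_plane (\<gamma> \<tau>)"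
    using horizontal_curveE[OF assms] by blast
  let ?w = "\<lambda>\<tau>. (fst (vector_derivative \<gamma> (at \<tau>)), fst (snd (vector_derivative \<gamma> (at \<tau>))))"
  have "?w absolutely_integrable_on {0..1}"
  proof (subst absolutely_integrable_componentwise_iff, rule ballI)
    fix b :: "(real^'a) \<times> (real^'a)"
    have "bounded_linear (\<lambda>v :: 'a heis. (fst v, fst (snd v)) \<bullet> b)"
      by (intro bounded_linear_intros)
    from lipschitz_linear_functional_derivative(2)[OF this LN(1,2,3), of 0]
    show "(\<lambda>\<tau>. ?w \<tau> \<bullet> b) absolutely_integrable_on {0..1}" by simp
  qed
  then have abs: "speed \<gamma> absolutely_integrable_on {0..1}"
    using absolutely_integrable_norm by (force simp: speed_def[abs_def] o_def)
  then show "speed \<gamma> integrable_on {0..1}"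
    using set_lebesgue_integral_eq_integral(1) by blast
  let ?\<nu> = "\<lambda>\<tau>. horizontal_norm (\<gamma> \<tau>) (vector_derivative \<gamma> (at \<tau>))"
  have eq: "?\<nu> \<tau> = speed \<gamma> \<tau>" if "\<tau> \<in> {0..1} - N" for \<tau>
    using horizontal_norm_eq[OF LN(4)[OF that]] by (simp add: speed_def)
  have "?\<nu> absolutely_integrable_on {0..1}"
    by (rule absolutely_integrable_spike[OF abs LN(2) eq])
  then have "integrable (lebesgue_on {0..1}) ?\<nu>"
    by (simp add: integrable_restrict_space set_integrable_def)
  then have "horizontal_length \<gamma> = integral {0..1} ?\<nu>"
    unfolding horizontal_length_def by (intro lebesgue_integral_eq_integral) auto
  also have "\<dots> = integral {0..1} (speed \<gamma>)"
    by (rule integral_spike[OF LN(2)]) (simp add: eq)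
  finally show "horizontal_length \<gamma> = integral {0..1} (speed \<gamma>)" .
qed

section \<open>Two-sided gauge bounds for the length\<close>

fun heis_inv :: "'n::finite heis \<Rightarrow> 'n heis" where
  "heis_inv (x, y, t) = (- x, - y, - t)"

text \<open>Homogeneous of degree one under dilations: the height scales quadratically and therefore
  stands under a root. It replaces \<open>d_cc\<close> up to constant factors.\<close>

fun heis_gauge :: "'n::finite heis \<Rightarrow> real" where
  "heis_gauge (x, y, t) = norm x + norm y + sqrt \<bar>t\<bar>"

text \<open>The horizontal displacement never exceeds the length \<open>l\<close>. Seen from the
  starting point, the height changes at a rate of at most \<open>2 * l\<close> times the speed,
  hence by at most \<open>2 * l * l\<close> in total. The factor 4 comes from
  \<open>l + l + 2 * l\<close>.\<close>

lemma gauge_le_horizontal_length: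
  assumes "horizontal_curve \<gamma>"
  shows "heis_gauge (heis_mult (heis_inv (\<gamma> 0)) (\<gamma> 1)) \<le> 4 * horizontal_length \<gamma>"
proof -
  obtain L N where LN: "L-lipschitz_on {0..1} \<gamma>" "negligible N"
    "\<And>\<tau>. \<tau> \<in> {0..1} - N \<Longrightarrow> (\<gamma> has_vector_derivative vector_derivative \<gamma> (at \<tau>)) (at \<tau>)"
    "\<And>\<tau>. \<tau> \<in> {0..1} - N \<Longrightarrow> vector_derivative \<gamma> (at \<tau>) \<in> horizontal_plane (\<gamma> \<tau>)"
    using horizontal_curveE[OF assms] by blast
  define w where "w \<tau> = vector_derivative \<gamma> (at \<tau>)" for \<tau>
  define l where "l = horizontal_length \<gamma>"
  note len = horizontal_length_eq[OF assms, folded l_def]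
  have l0: "0 \<le> l"
    unfolding len(2) by (intro integral_nonneg len) (simp add: speed_def)
  have bound: "\<bar>\<phi> (\<gamma> s) - \<phi> (\<gamma> 0)\<bar> \<le> c * l"
    if \<phi>: "bounded_linear \<phi>" and s: "s \<in> {0..1}" and c: "c \<ge> 0"
      and le: "\<And>\<tau>. \<tau> \<in> {0..1} - N \<Longrightarrow> \<bar>\<phi> (w \<tau>)\<bar> \<le> c * speed \<gamma> \<tau>" for \<phi> :: "'a heis \<Rightarrow> real" and s c
  proof -
    note I = lipschitz_linear_functional_derivative(1)[OF \<phi> LN(1,2,3) s, folded w_def]
    \<comment> \<open>Altering the majorant on the null set makes the bound hold at every point
      without changing the integral.\<close>
    define v where "v \<tau> = (if \<tau> \<in> N then \<bar>\<phi> (w \<tau>)\<bar> else c * speed \<gamma> \<tau>)" for \<tau>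
    have v: "(v has_integral c * l) {0..1}"
    proof (rule has_integral_spike[OF LN(2)])
      show "((\<lambda>\<tau>. c * speed \<gamma> \<tau>) has_integral c * l) {0..1}"
        using len by (intro has_integral_mult_right) (simp add: has_integral_iff)
    qed (simp add: v_def)
    have v0: "v integrable_on {0..s}"
      using v s integrable_subinterval_real[of v 0 1 0 s] by auto
    have "norm (integral {0..s} (\<lambda>\<tau>. \<phi> (w \<tau>))) \<le> integral {0..s} v"
      by (rule integral_norm_bound_integral) (use I v0 le s in \<open>auto simp: v_def\<close>)
    also have "\<dots> \<le> integral {0..1} v"
      by (rule integral_subset_le) (use s v v0 c in \<open>auto simp: v_def speed_def\<close>)
    finally show ?thesis using I v by (simp add: integral_unique)
  qed
  obtain x0 y0 t0 where g0: "\<gamma> 0 = (x0, y0, t0)" by (cases "\<gamma> 0")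
  have xy: "norm (fst (\<gamma> s) - x0, fst (snd (\<gamma> s)) - y0) \<le> l" if s: "s \<in> {0..1}" for s
  proof -
    define d where "d = (fst (\<gamma> s) - x0, fst (snd (\<gamma> s)) - y0)"
    \<comment> \<open>Pairing the curve with its own displacement gives
      \<open>norm d * norm d \<le> norm d * l\<close>.\<close>
    define \<phi> where "\<phi> v = (fst v, fst (snd v)) \<bullet> d" for v :: "'a heis"
    have "bounded_linear \<phi>" unfolding \<phi>_def by (intro bounded_linear_intros)
    then have "\<bar>\<phi> (\<gamma> s) - \<phi> (\<gamma> 0)\<bar> \<le> norm d * l"
    proof (rule bound[OF _ s])
      show "\<bar>\<phi> (w \<tau>)\<bar> \<le> norm d * speed \<gamma> \<tau>" for \<tau>
        using Cauchy_Schwarz_ineq2[of "(fst (w \<tau>), fst (snd (w \<tau>)))" d]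
        by (simp add: \<phi>_def speed_def w_def mult.commute)
    qed simp
    moreover have "\<phi> (\<gamma> s) - \<phi> (\<gamma> 0) = norm d * norm d"
      by (simp add: \<phi>_def g0 d_def inner_diff_left[symmetric] power2_norm_eq_inner[symmetric] power2_eq_square[symmetric] del: inner_Pair)
    ultimately have "norm d * norm d \<le> norm d * l" by simp
    then show ?thesis
      using l0 by (cases "d = 0") (auto simp: d_def)
  qed
  obtain x1 y1 t1 where g1: "\<gamma> 1 = (x1, y1, t1)" by (cases "\<gamma> 1")
  \<comment> \<open>Up to the constant \<open>t0\<close> this is the height of \<open>v\<close>
    left-translated by the inverse of \<open>\<gamma> 0\<close>. Along the curve its derivative is
    twice the symplectic pairing of displacement and velocity.\<close>
  define \<phi> where "\<phi> v = snd (snd v) + 2 * (x0 \<bullet> fst (snd v) - y0 \<bullet> fst v)" for v :: "'a heis"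
  have "bounded_linear \<phi>" unfolding \<phi>_def by (intro bounded_linear_intros)
  then have "\<bar>\<phi> (\<gamma> 1) - \<phi> (\<gamma> 0)\<bar> \<le> (2 * l) * l"
  proof (rule bound)
    fix \<tau> assume \<tau>: "\<tau> \<in> {0..1} - N"
    obtain x y t where g: "\<gamma> \<tau> = (x, y, t)" by (cases "\<gamma> \<tau>")
    have "\<phi> (w \<tau>) = 2 * ((y - y0, - (x - x0)) \<bullet> (fst (w \<tau>), fst (snd (w \<tau>))))"
      using LN(4)[OF \<tau>] by (simp add: \<phi>_def g horizontal_plane_iff w_def inner_diff_left algebra_simps)
    also have "\<bar>\<dots>\<bar> \<le> 2 * (norm (y - y0, - (x - x0)) * speed \<gamma> \<tau>)"
      using Cauchy_Schwarz_ineq2[of "(y - y0, - (x - x0))" "(fst (w \<tau>), fst (snd (w \<tau>)))"]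
      by (simp add: speed_def w_def abs_mult)
    also have "norm (y - y0, - (x - x0)) = norm (x - x0, y - y0)"
      by (simp add: norm_Pair norm_minus_commute add.commute)
    also have "2 * (norm (x - x0, y - y0) * speed \<gamma> \<tau>) \<le> 2 * (l * speed \<gamma> \<tau>)"
      using xy[of \<tau>] \<tau> g by (intro mult_left_mono mult_right_mono) (auto simp: speed_def)
    finally show "\<bar>\<phi> (w \<tau>)\<bar> \<le> 2 * l * speed \<gamma> \<tau>" by simp
  qed (use l0 in auto)
  then have t: "\<bar>t1 - t0 + 2 * (x0 \<bullet> y1 - y0 \<bullet> x1)\<bar> \<le> 2 * l * l"
    by (simp add: \<phi>_def g0 g1 inner_commute)
  have "sqrt \<bar>t1 - t0 + 2 * (x0 \<bullet> y1 - y0 \<bullet> x1)\<bar> \<le> 2 * l"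
    by (rule real_le_lsqrt)
      (use t l0 mult_nonneg_nonneg[OF l0 l0] in \<open>auto simp: power2_eq_square simp del: mult_nonneg_nonneg\<close>)
  moreover have "norm (x1 - x0) \<le> l" "norm (y1 - y0) \<le> l"
    using xy[of 1] norm_fst_le[of "x1 - x0" "y1 - y0"] norm_snd_le[of "y1 - y0" "x1 - x0"] g1 by auto
  ultimately show ?thesis
    by (simp add: g0 g1 l_def algebra_simps)
qed

lemma C1_horizontal_curve:
  fixes \<gamma> :: "real \<Rightarrow> 'n::finite heis"
  assumes deriv: "\<And>\<tau>. (\<gamma> has_vector_derivative w \<tau>) (at \<tau>)" and cont: "continuous_on {0..1} w"
    and hor: "\<And>\<tau>. w \<tau> \<in> horizontal_plane (\<gamma> \<tau>)"
    and M: "\<And>\<tau>. \<tau> \<in> {0..1} \<Longrightarrow> norm (fst (w \<tau>), fst (snd (w \<tau>))) \<le> M"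
  shows "horizontal_curve \<gamma>" "horizontal_length \<gamma> \<le> M"
proof -
  have vd: "vector_derivative \<gamma> (at \<tau>) = w \<tau>" for \<tau>
    using vector_derivative_at[OF deriv] .
  have "compact (w ` {0..1})"
    using cont by (intro compact_continuous_image) auto
  then obtain B where B: "\<And>\<tau>. \<tau> \<in> {0..1} \<Longrightarrow> norm (w \<tau>) \<le> B"
    by (force dest!: compact_imp_bounded simp: bounded_iff)
  have "B-lipschitz_on {0..1} \<gamma>"
  proof (rule bounded_derivative_imp_lipschitz)
    show "(\<gamma> has_derivative (\<lambda>h. h *\<^sub>R w \<tau>)) (at \<tau> within {0..1})" for \<tau>
      using deriv[of \<tau>] by (auto simp: has_vector_derivative_def intro: has_derivative_at_withinI)
    show "onorm (\<lambda>h. h *\<^sub>R w \<tau>) \<le> B" if "\<tau> \<in> {0..1}" for \<tau>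
      by (rule onorm_le) (use mult_right_mono[OF B[OF that] abs_ge_zero] in \<open>simp add: mult.commute\<close>)
    show "0 \<le> B" using order_trans[OF norm_ge_zero B[of 0]] by simp
  qed simp
  moreover have "\<gamma> differentiable (at \<tau>)" for \<tau>
    using deriv differentiableI_vector by blast
  ultimately show hc: "horizontal_curve \<gamma>"
    unfolding horizontal_curve_def using hor by (auto simp: vd)
  have "integral {0..1} (speed \<gamma>) \<le> integral {0..1::real} (\<lambda>_. M)"
    by (rule integral_le) (use horizontal_length_eq(1)[OF hc] M in \<open>auto simp: speed_def vd\<close>)
  then show "horizontal_length \<gamma> \<le> M"
    using horizontal_length_eq(2)[OF hc] by simp
qed

text \<open>A closed polynomial loop \<open>(p1, p2)\<close> of mean zero. Because of the vanishing mean, adding it to a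
  segment changes the height of the lifted curve only by a multiple of the area enclosed by the loop,
  which is encoded in \<open>K 1 = 1 / 35\<close>.\<close>

lemma exists_short_horizontal_curve:
  fixes p q :: "'n::finite heis"
  obtains \<gamma> where "horizontal_curve \<gamma>" "\<gamma> 0 = p" "\<gamma> 1 = q"
    "horizontal_length \<gamma> \<le> 400 * heis_gauge (heis_mult (heis_inv p) q)"
proof -
  obtain x0 y0 t0 where p: "p = (x0, y0, t0)" by (cases p)
  obtain x1 y1 t1 where q: "q = (x1, y1, t1)" by (cases q)
  define a where "a = x1 - x0"
  define b where "b = y1 - y0"
  define c where "c = t1 - t0 + 2 * (x0 \<bullet> y1 - y0 \<bullet> x1)"
  have gauge_eq: "heis_gauge (heis_mult (heis_inv p) q) = norm a + norm b + sqrt \<bar>c\<bar>"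
    by (simp add: p q a_def b_def c_def algebra_simps)
  define p1 where "p1 s = s - 3 * s^2 + 2 * s^3" for s :: real
  define p2 where "p2 s = s - 6 * s^2 + 10 * s^3 - 5 * s^4" for s :: real
  define p1' where "p1' s = 1 - 6 * s + 6 * s^2" for s :: real
  define p2' where "p2' s = 1 - 12 * s + 30 * s^2 - 20 * s^3" for s :: real
  \<comment> \<open>Primitives of \<open>p1\<close> and \<open>p2\<close>; the vanishing means are
    \<open>P1 1 = 0\<close> and \<open>P2 1 = 0\<close>. \<open>K\<close> is the primitive of
    \<open>p2 s * p1' s - p1 s * p2' s\<close>.\<close>
  define P1 where "P1 s = s^2 / 2 - s^3 + s^4 / 2" for s :: real
  define P2 where "P2 s = s^2 / 2 - 2 * s^3 + 5 / 2 * s^4 - s^5" for s :: real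
  define K where "K s = s^3 - 4 * s^4 + 33 / 5 * s^5 - 5 * s^6 + 10 / 7 * s^7" for s :: real
  have d [derivative_intros]:
    "(p1 has_real_derivative p1' s) (at s)" "(p2 has_real_derivative p2' s) (at s)"
    "(P1 has_real_derivative p1 s) (at s)" "(P2 has_real_derivative p2 s) (at s)" for s
    unfolding p1_def p2_def p1'_def p2'_def P1_def P2_def
    by (auto intro!: derivative_eq_intros simp: algebra_simps)
  have dK: "(K has_real_derivative p2 s * p1' s - p1 s * p2' s) (at s)" for s
    unfolding K_def p1_def p2_def p1'_def p2'_def
    by (auto intro!: derivative_eq_intros simp: algebra_simps eval_nat_numeral)
  \<comment> \<open>The scaled loop contributes \<open>2 * r^2 * g * K 1\<close> to the height. With
    \<open>g\<close> the sign of \<open>c\<close>, which reverses the loop if necessary, the factor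
    \<open>35 / 2\<close> makes this equal to \<open>c\<close>.\<close>
  define r where "r = sqrt (35 * \<bar>c\<bar> / 2)"
  define g where "g = sgn c"
  define e where "e = (axis undefined 1 :: real^'n)"
  have ee: "e \<bullet> e = 1" "norm e = 1" by (simp_all add: e_def inner_axis_axis)
  define \<xi> where "\<xi> s = s *\<^sub>R a + (r * p1 s) *\<^sub>R e" for s
  define \<eta> where "\<eta> s = s *\<^sub>R b + (r * g * p2 s) *\<^sub>R e" for s
  define \<xi>' where "\<xi>' s = a + (r * p1' s) *\<^sub>R e" for s
  define \<eta>' where "\<eta>' s = b + (r * g * p2' s) *\<^sub>R e" for s
  define \<theta> where "\<theta> s = 2 * (r * (b \<bullet> e) * (s * p1 s - 2 * P1 s)
      - r * g * (a \<bullet> e) * (s * p2 s - 2 * P2 s) + r\<^sup>2 * g * K s)" for s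
  have d\<xi>: "(\<xi> has_vector_derivative \<xi>' s) (at s)" for s
    unfolding \<xi>_def \<xi>'_def by (auto intro!: derivative_eq_intros d[unfolded has_real_derivative_iff_has_vector_derivative])
  have d\<eta>: "(\<eta> has_vector_derivative \<eta>' s) (at s)" for s
    unfolding \<eta>_def \<eta>'_def by (auto intro!: derivative_eq_intros)
  have \<eta>\<xi>: "\<eta> s \<bullet> \<xi>' s - \<xi> s \<bullet> \<eta>' s =
      r * (b \<bullet> e) * (p1 s + s * p1' s - 2 * p1 s) - r * g * (a \<bullet> e) * (p2 s + s * p2' s - 2 * p2 s)
      + r\<^sup>2 * g * (p2 s * p1' s - p1 s * p2' s)" for s
    unfolding \<xi>_def \<eta>_def \<xi>'_def \<eta>'_def
    by (simp only: inner_add_left inner_add_right inner_scaleR_left inner_scaleR_right ee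
        inner_commute[of e a] inner_commute[of e b] inner_commute[of b a]) algebra
  have d\<theta>: "(\<theta> has_real_derivative 2 * (\<eta> s \<bullet> \<xi>' s - \<xi> s \<bullet> \<eta>' s)) (at s)" for s
  proof -
    have i: "((\<lambda>s. s * p s - 2 * P s) has_real_derivative p s + s * p' s - 2 * p s) (at s)"
      if "(p has_real_derivative p' s) (at s)" "(P has_real_derivative p s) (at s)" for p p' P
      using DERIV_diff[OF DERIV_mult[OF DERIV_ident that(1)] DERIV_cmult[OF that(2), of 2]]
      by (simp add: algebra_simps)
    show ?thesis
      unfolding \<theta>_def \<eta>\<xi> by (intro DERIV_cmult DERIV_add DERIV_diff i d dK)
  qed
  \<comment> \<open>The left translate by \<open>p\<close> of the horizontal lift
    \<open>(\<xi> s, \<eta> s, \<theta> s)\<close> that starts at the origin.\<close>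
  define \<gamma> where "\<gamma> s = (x0 + \<xi> s, y0 + \<eta> s, t0 + \<theta> s + 2 * (y0 \<bullet> \<xi> s - x0 \<bullet> \<eta> s))" for s
  define w where "w s = (\<xi>' s, \<eta>' s, 2 * (\<eta> s \<bullet> \<xi>' s - \<xi> s \<bullet> \<eta>' s) + 2 * (y0 \<bullet> \<xi>' s - x0 \<bullet> \<eta>' s))" for s
  have r0: "0 \<le> r" by (simp add: r_def)
  have g1: "\<bar>g\<bar> \<le> 1" by (simp add: g_def sgn_if)
  have "horizontal_curve \<gamma>" "horizontal_length \<gamma> \<le> norm a + norm b + 76 * r"
  proof (atomize (full), intro conjI)
    have deriv: "(\<gamma> has_vector_derivative w s) (at s)" for s
      unfolding \<gamma>_def w_def
      using d\<xi>[of s] d\<eta>[of s] d\<theta>[of s, unfolded has_real_derivative_iff_has_vector_derivative]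
      by (auto intro!: derivative_eq_intros
          bounded_linear.has_vector_derivative[OF bounded_linear_inner_right])
    have cont: "continuous_on {0..1} w"
      unfolding w_def \<xi>_def \<eta>_def \<xi>'_def \<eta>'_def p1_def p2_def p1'_def p2'_def
      by (intro continuous_intros)
    have hor: "w s \<in> horizontal_plane (\<gamma> s)" for s
      by (simp add: \<gamma>_def w_def horizontal_plane_iff inner_add_left algebra_simps)
    have M: "norm (fst (w s), fst (snd (w s))) \<le> norm a + norm b + 76 * r" if s: "s \<in> {0..1}" for s
    proof -
      have pw: "0 \<le> s^n" "s^n \<le> 1" for n using s by (auto intro: power_le_one)
      \<comment> \<open>Sums of absolute coefficients, \<open>1 + 6 + 6\<close> and
        \<open>1 + 12 + 30 + 20\<close>; together they give the 76.\<close>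
      have "\<bar>p1' s\<bar> \<le> 13" "\<bar>p2' s\<bar> \<le> 63"
        using s pw(1)[of 2] pw(1)[of 3] pw(2)[of 2] pw(2)[of 3]
        unfolding p1'_def p2'_def abs_le_iff atLeastAtMost_iff by (intro conjI; linarith)+
      then have "r * \<bar>p1' s\<bar> \<le> r * 13" "r * \<bar>g\<bar> * \<bar>p2' s\<bar> \<le> r * 1 * 63"
        using r0 mult_left_mono[OF g1 r0] by (auto intro!: mult_mono)
      moreover have "norm (\<xi>' s) \<le> norm a + r * \<bar>p1' s\<bar>"
        using norm_triangle_ineq[of a "(r * p1' s) *\<^sub>R e"] r0 by (simp add: \<xi>'_def ee abs_mult)
      moreover have "norm (\<eta>' s) \<le> norm b + r * \<bar>g\<bar> * \<bar>p2' s\<bar>"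
        using norm_triangle_ineq[of b "(r * g * p2' s) *\<^sub>R e"] r0 by (simp add: \<eta>'_def ee abs_mult)
      moreover have "norm (\<xi>' s, \<eta>' s) \<le> norm (\<xi>' s) + norm (\<eta>' s)"
        by (rule norm_Pair_le)
      ultimately show ?thesis by (simp add: w_def)
    qed
    show "horizontal_curve \<gamma>" "horizontal_length \<gamma> \<le> norm a + norm b + 76 * r"
      by (rule C1_horizontal_curve[OF deriv cont hor M]; assumption)+
  qed
  moreover have "\<gamma> 0 = p"
    by (simp add: \<gamma>_def \<xi>_def \<eta>_def \<theta>_def p p1_def p2_def P1_def P2_def K_def)
  moreover have "\<gamma> 1 = q"
  proof -
    have "r\<^sup>2 * g = 35 * c / 2"
      by (simp add: r_def g_def sgn_if)
    then have "\<theta> 1 = c"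
      by (simp add: \<theta>_def p1_def p2_def P1_def P2_def K_def)
    then show ?thesis
      by (simp add: \<gamma>_def \<xi>_def \<eta>_def p1_def p2_def q a_def b_def c_def inner_diff_right inner_commute algebra_simps)
  qed
  \<comment> \<open>Because \<open>35 / 2 \<le> 25\<close>; the vertical cost is then
    \<open>76 * 5 = 380\<close> times the root, within 400.\<close>
  moreover have "r \<le> 5 * sqrt \<bar>c\<bar>"
  proof -
    have "r \<le> sqrt (5\<^sup>2 * \<bar>c\<bar>)" unfolding r_def by (intro real_sqrt_le_mono) simp
    then show ?thesis by (simp add: real_sqrt_mult)
  qed
  ultimately show ?thesis
    using that[of \<gamma>] gauge_eq norm_ge_zero[of a] norm_ge_zero[of b] real_sqrt_ge_zero[of "\<bar>c\<bar>"] by fastforce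
qed

lemma d_cc_gauge:
  "heis_gauge (heis_mult (heis_inv p) q) \<le> 4 * d_cc p q"
  "d_cc p q \<le> 400 * heis_gauge (heis_mult (heis_inv p) q)"
proof -
  define A where "A = {horizontal_length \<gamma> | \<gamma>. horizontal_curve \<gamma> \<and> \<gamma> 0 = p \<and> \<gamma> 1 = q}"
  obtain \<gamma> where \<gamma>: "horizontal_curve \<gamma>" "\<gamma> 0 = p" "\<gamma> 1 = q"
    "horizontal_length \<gamma> \<le> 400 * heis_gauge (heis_mult (heis_inv p) q)"
    by (rule exists_short_horizontal_curve)
  have in_A: "horizontal_length \<gamma> \<in> A" using \<gamma> by (auto simp: A_def)
  have lower: "heis_gauge (heis_mult (heis_inv p) q) / 4 \<le> l" if "l \<in> A" for l
    using that gauge_le_horizontal_length by (force simp: A_def)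
  have "heis_gauge (heis_mult (heis_inv p) q) / 4 \<le> Inf A"
    using in_A lower by (intro cInf_greatest) auto
  then show "heis_gauge (heis_mult (heis_inv p) q) \<le> 4 * d_cc p q"
    by (simp add: d_cc_def A_def)
  have "Inf A \<le> horizontal_length \<gamma>"
    by (rule cInf_lower[OF in_A bdd_belowI[OF lower]])
  then show "d_cc p q \<le> 400 * heis_gauge (heis_mult (heis_inv p) q)"
    using \<gamma>(4) by (simp add: d_cc_def A_def)
qed

text \<open>The metric hypothesis enters the rest of the proof in this explicit form;
  \<open>1600 = 4 * 400\<close>.\<close>

lemma cc_lipschitz_gauge:
  assumes "cc_lipschitz f"
  obtains C where "C \<ge> 0"
    "\<And>p q. heis_gauge (heis_mult (heis_inv (f p)) (f q)) \<le> C * heis_gauge (heis_mult (heis_inv p) q)"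
proof -
  obtain L where L: "L \<ge> 0" "\<And>p q. d_cc (f p) (f q) \<le> L * d_cc p q"
    using assms by (auto simp: cc_lipschitz_def)
  show ?thesis
  proof
    show "0 \<le> 1600 * L" using L by simp
    fix p q
    have "heis_gauge (heis_mult (heis_inv (f p)) (f q)) \<le> 4 * d_cc (f p) (f q)" by (rule d_cc_gauge)
    also have "\<dots> \<le> 4 * (L * d_cc p q)" using L by simp
    also have "\<dots> \<le> 4 * (L * (400 * heis_gauge (heis_mult (heis_inv p) q)))"
      using L d_cc_gauge(2)[of p q] by (intro mult_left_mono) auto
    finally show "heis_gauge (heis_mult (heis_inv (f p)) (f q)) \<le> 1600 * L * heis_gauge (heis_mult (heis_inv p) q)"
      by (simp add: mult_ac)
  qed
qed

section \<open>Homogeneous homomorphisms of the Heisenberg group\<close>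

lemma heis_mult_heis_group [simp]: "p \<otimes>\<^bsub>heis_group\<^esub> q = heis_mult p q"
  by (simp add: heis_group_def)

lemma carrier_heis_group [simp]: "carrier heis_group = UNIV"
  by (simp add: heis_group_def)

lemma heis_inv_heis_group [simp]: "inv\<^bsub>heis_group\<^esub> p = heis_inv p"
proof (rule group.inv_equality[OF group_heis_group])
  show "heis_inv p \<otimes>\<^bsub>heis_group\<^esub> p = \<one>\<^bsub>heis_group\<^esub>"
    by (cases p) (simp add: heis_group_def inner_commute zero_prod_def)
qed (simp_all add: heis_group_def)

text \<open>The standard symplectic form, signed so that the group law adds
  \<open>2 * symp z z'\<close> to the heights.\<close>

definition symp :: "(real^'n) \<times> (real^'n) \<Rightarrow> (real^'n) \<times> (real^'n) \<Rightarrow> real" where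
  "symp u v = snd u \<bullet> fst v - fst u \<bullet> snd v"

lemma symp_linear:
  "symp (u + u') v = symp u v + symp u' v" "symp u (v + v') = symp u v + symp u v'"
  "symp (u - u') v = symp u v - symp u' v" "symp u (v - v') = symp u v - symp u v'"
  "symp (c *\<^sub>R u) v = c * symp u v" "symp u (c *\<^sub>R v) = c * symp u v"
  "symp 0 v = 0" "symp u 0 = 0"
  by (simp_all add: symp_def inner_add_left inner_add_right inner_diff_left inner_diff_right algebra_simps)

lemma symp_swap: "symp v u = - symp u v"
  by (simp add: symp_def inner_commute)

lemma symp_self [simp]: "symp u u = 0"
  by (simp add: symp_def inner_commute)

definition hpart :: "'n::finite heis \<Rightarrow> (real^'n) \<times> (real^'n)" where
  "hpart p = (fst p, fst (snd p))"

definition height :: "'n::finite heis \<Rightarrow> real" where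
  "height p = snd (snd p)"

definition hmk :: "(real^'n) \<times> (real^'n) \<Rightarrow> real \<Rightarrow> 'n::finite heis" where
  "hmk z t = (fst z, snd z, t)"

lemma hmk_simps [simp]: "hpart (hmk z t) = z" "height (hmk z t) = t" "hmk (hpart p) (height p) = p"
  by (simp_all add: hpart_def height_def hmk_def)

lemma hmk_eq_iff [simp]: "hmk z t = hmk z' t' \<longleftrightarrow> z = z' \<and> t = t'"
  by (auto simp: hmk_def prod_eq_iff)

lemma hmk_0 [simp]: "hmk 0 0 = 0"
  by (simp add: hmk_def zero_prod_def)

lemma hmk_add: "hmk z t + hmk z' t' = hmk (z + z') (t + t')"
  and hmk_scaleR: "c *\<^sub>R hmk z t = hmk (c *\<^sub>R z) (c * t)"
  by (simp_all add: hmk_def)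

lemma heis_mult_hmk: "heis_mult (hmk z t) (hmk z' t') = hmk (z + z') (t + t' + 2 * symp z z')"
  by (simp add: hmk_def symp_def)

lemma heis_dilation_hmk: "heis_dilation s (hmk z t) = hmk (s *\<^sub>R z) (s\<^sup>2 * t)"
  by (simp add: hmk_def)

definition hmap :: "((real^'n) \<times> (real^'n) \<Rightarrow> (real^'n) \<times> (real^'n)) \<Rightarrow> real \<Rightarrow> 'n::finite heis \<Rightarrow> 'n heis" where
  "hmap M c p = hmk (M (hpart p)) (c * height p)"

lemma hmap_hmk [simp]: "hmap M c (hmk z t) = hmk (M z) (c * t)"
  by (simp add: hmap_def)

lemma linear_hpart: "linear hpart" and linear_height: "linear height"
  by (auto intro!: linearI simp: hpart_def height_def)

lemma linear_hmap: "linear M \<Longrightarrow> linear (hmap M c)"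
  by (rule linearI) (simp_all add: hmap_def linear_add[OF linear_hpart] linear_add[OF linear_height]
      linear_scale[OF linear_hpart] linear_scale[OF linear_height] linear_add linear_scale hmk_add hmk_scaleR
      algebra_simps)

lemma hmap_compose: "hmap M c \<circ> hmap M' c' = hmap (M \<circ> M') (c * c')"
  by (auto simp: hmap_def)

text \<open>Mixed terms vanish because additivity and homogeneity prescribe different growth for
  them. Dilations also supply real scaling, so linearity follows without an appeal to continuity.
  The relation for \<open>symp\<close> is multiplicativity read off in the height of a product of
  horizontal elements.\<close>

lemma homogeneous_hom_eq_hmap:
  assumes hom: "A \<in> hom heis_group heis_group"
    and dil: "\<And>s p. s > 0 \<Longrightarrow> A (heis_dilation s p) = heis_dilation s (A p)"
  obtains M c where "linear M" "A = hmap M c" "\<And>u v. symp (M u) (M v) = c * symp u v"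
proof -
  have mult: "A (heis_mult p q) = heis_mult (A p) (A q)" for p q
    using hom_mult[OF hom, of p q] by simp
  define a where "a z t = hpart (A (hmk z t))" for z t
  define b where "b z t = height (A (hmk z t))" for z t
  have A: "A (hmk z t) = hmk (a z t) (b z t)" for z t by (simp add: a_def b_def)
  have add: "a (z + z') (t + t' + 2 * symp z z') = a z t + a z' t'"
    "b (z + z') (t + t' + 2 * symp z z') = b z t + b z' t' + 2 * symp (a z t) (a z' t')" for z z' t t'
    using mult[of "hmk z t" "hmk z' t'"] by (simp_all add: heis_mult_hmk A)
  have sc: "a (s *\<^sub>R z) (s\<^sup>2 * t) = s *\<^sub>R a z t" "b (s *\<^sub>R z) (s\<^sup>2 * t) = s\<^sup>2 * b z t" if "s > 0" for s z t
    using dil[OF that, of "hmk z t"] by (simp_all add: heis_dilation_hmk A)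
  have a0_add: "a 0 (t + t') = a 0 t + a 0 t'" for t t'
    using add(1)[of 0 0 t t'] by (simp add: symp_linear)
  \<comment> \<open>Additivity along the vertical axis gives a factor 4, dilation by 2 a factor
    2.\<close>
  have a0: "a 0 t = 0" for t
  proof -
    have "a 0 (4 * t) = 4 *\<^sub>R a 0 t"
      using a0_add[of "2 * t" "2 * t"] a0_add[of t t] by (simp add: scaleR_2[symmetric])
    moreover have "a 0 (4 * t) = 2 *\<^sub>R a 0 t"
      using sc(1)[of 2 0 t] by simp
    ultimately show ?thesis by simp
  qed
  define M where "M z = a z 0" for z
  have aM: "a z t = M z" for z t
    using add(1)[of z 0 0 t] a0 by (simp add: symp_linear M_def)
  have M_add: "M (z + z') = M z + M z'" for z z'
    using add(1)[of z z' 0 0] by (simp add: aM)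
  have M_scale: "M (s *\<^sub>R z) = s *\<^sub>R M z" for s z
  proof (cases s "0 :: real" rule: linorder_cases)
    case greater
    then show ?thesis using sc(1)[of s z 0] by (simp add: aM)
  next
    case equal
    then show ?thesis using M_add[of 0 0] by simp
  next
    case less
    have "M (s *\<^sub>R z) + M ((- s) *\<^sub>R z) = 0"
      using M_add[of "s *\<^sub>R z" "(- s) *\<^sub>R z"] M_add[of 0 0] by (simp flip: scaleR_left_distrib)
    moreover have "M ((- s) *\<^sub>R z) = (- s) *\<^sub>R M z"
      using sc(1)[of "- s" z 0] less by (simp add: aM)
    ultimately show ?thesis by simp
  qed
  have lin: "linear M" by (rule linearI) (simp_all add: M_add M_scale)
  define c where "c = b 0 1"
  have b0_add: "b 0 (t + t') = b 0 t + b 0 t'" for t t'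
    using add(2)[of 0 0 t t'] a0 by (simp add: symp_linear)
  have b0: "b 0 t = c * t" for t
  proof (cases t "0 :: real" rule: linorder_cases)
    case greater
    then show ?thesis using sc(2)[of "sqrt t" 0 1] by (simp add: c_def)
  next
    case equal
    then show ?thesis using b0_add[of 0 0] by simp
  next
    case less
    then have "b 0 (- t) = - t * c" using sc(2)[of "sqrt (- t)" 0 1] by (simp add: c_def)
    moreover have "b 0 t + b 0 (- t) = 0" using b0_add[of t "- t"] b0_add[of 0 0] by simp
    ultimately show ?thesis by (simp add: mult.commute)
  qed
  \<comment> \<open>Here additivity gives a factor 2 and dilation a factor 4.\<close>
  have bz: "b z 0 = 0" for z
  proof -
    have "b (2 *\<^sub>R z) 0 = 2 * b z 0"
      using add(2)[of z z 0 0] by (simp add: scaleR_2)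
    moreover have "b (2 *\<^sub>R z) 0 = 4 * b z 0"
      using sc(2)[of 2 z 0] by simp
    ultimately show ?thesis by simp
  qed
  have b: "b z t = c * t" for z t
    using add(2)[of z 0 0 t] by (simp add: symp_linear bz b0 a0)
  show ?thesis
  proof (rule that[OF lin])
    show "A = hmap M c"
      by (rule ext) (metis A aM b hmap_hmk hmk_simps(3))
    show "symp (M u) (M v) = c * symp u v" for u v
      using add(2)[of u v 0 0] by (simp add: b aM)
  qed
qed

section \<open>Determinants on the Heisenberg group\<close>

text \<open>\<open>'n bit1\<close> is a well-ordered finite type with
  \<open>2 * CARD('n) + 1\<close> elements, the dimension of \<open>'n heis\<close>.\<close>

lemma heis_basis_bij:
  obtains \<beta> :: "'n::finite bit1 \<Rightarrow> 'n heis" where "bij_betw \<beta> UNIV Basis"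
proof -
  have "card (UNIV :: 'n bit1 set) = card (Basis :: 'n heis set)"
    by simp
  then show ?thesis
    using that finite_same_card_bij[of "UNIV :: 'n bit1 set" "Basis :: 'n heis set"] by auto
qed

lemma heis_det_compose:
  fixes A B :: "'n::finite heis \<Rightarrow> 'n heis"
  assumes "linear A" "linear B"
  shows "endo_det (A \<circ> B) = endo_det A * endo_det B"
  by (rule heis_basis_bij) (rule endo_det_compose[OF _ assms])

lemma heis_det_nonzero_iff:
  fixes A :: "'n::finite heis \<Rightarrow> 'n heis"
  assumes "linear A"
  shows "endo_det A \<noteq> 0 \<longleftrightarrow> inj A"
  by (rule heis_basis_bij) (rule endo_det_nonzero_iff[OF _ assms])

lemma endo_det_diagonal:
  fixes A :: "'n::finite heis \<Rightarrow> 'n heis"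
  assumes "\<And>b c. b \<in> Basis \<Longrightarrow> c \<in> Basis \<Longrightarrow> b \<noteq> c \<Longrightarrow> A b \<bullet> c = 0"
  shows "endo_det A = (\<Prod>b\<in>Basis. A b \<bullet> b)"
proof -
  obtain \<beta> :: "'n bit1 \<Rightarrow> 'n heis" where \<beta>: "bij_betw \<beta> UNIV Basis" by (rule heis_basis_bij)
  let ?M = "matrix (\<lambda>v. coord \<beta> (A (uncoord \<beta> v)))"
  have M: "?M $ i $ j = A (\<beta> j) \<bullet> \<beta> i" for i j
    using uncoord_axis[OF \<beta>] by (simp add: matrix_def coord_def[OF \<beta>])
  have "endo_det A = det ?M" by (rule endo_det_eq_det[OF \<beta>])
  also have "\<dots> = (\<Prod>i\<in>UNIV. ?M $ i $ i)"
    using \<beta> by (intro det_diagonal) (auto simp: M bij_betw_def inj_def intro!: assms)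
  also have "\<dots> = (\<Prod>b\<in>Basis. A b \<bullet> b)"
    using prod.reindex_bij_betw[OF \<beta>, of "\<lambda>b. A b \<bullet> b"] by (simp add: M)
  finally show ?thesis .
qed

lemma prod_Basis_prod:
  "(\<Prod>b\<in>(Basis :: ('a::euclidean_space \<times> 'b::euclidean_space) set). f b) =
    (\<Prod>u\<in>Basis. f (u, 0)) * (\<Prod>v\<in>Basis. f (0, v))"
  unfolding Basis_prod_def
  by (subst prod.union_disjoint) (auto simp: prod.reindex inj_on_def)

lemma endo_det_id_heis: "endo_det (id :: 'n::finite heis \<Rightarrow> 'n heis) = 1"
  by (subst endo_det_diagonal) (auto simp: inner_not_same_Basis)

text \<open>An antisymplectic involution: it reverses the sign of \<open>symp\<close>, so with
  height factor \<open>- 1\<close> it extends to a group automorphism.\<close>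

definition yflip :: "(real^'n) \<times> (real^'n) \<Rightarrow> (real^'n) \<times> (real^'n)" where
  "yflip u = (fst u, - snd u)"

lemma linear_yflip: "linear yflip"
  by (rule linearI) (simp_all add: yflip_def)

text \<open>One sign for each coordinate of \<open>y\<close> and one for the height; the result is 1
  exactly if \<open>CARD('n)\<close> is odd.\<close>

lemma endo_det_yflip:
  "endo_det (hmap yflip (- 1) :: 'n::finite heis \<Rightarrow> 'n heis) = (- 1) ^ (CARD('n) + 1)"
proof -
  have e: "hmap yflip (- 1) (x, y, t) = (x, - y, - t)" for x y :: "real^'n" and t
    by (simp add: hmap_def yflip_def hmk_def hpart_def height_def)
  have e0: "hmap yflip (- 1) (x, 0) = (x, 0)" for x :: "real^'n"
    by (simp add: e zero_prod_def)
  have "endo_det (hmap yflip (- 1) :: 'n heis \<Rightarrow> 'n heis) =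
      (\<Prod>b\<in>(Basis :: 'n heis set). hmap yflip (- 1) b \<bullet> b)"
  proof (rule endo_det_diagonal)
    fix b c :: "'n heis" assume "b \<in> Basis" "c \<in> Basis" "b \<noteq> c"
    then show "hmap yflip (- 1) b \<bullet> c = 0"
      by (auto simp: Basis_prod_def e e0) (metis inner_not_same_Basis)+
  qed
  then show ?thesis
    by (simp add: prod_Basis_prod e e0 flip: zero_prod_def)
qed

lemma endo_det_square_pos:
  fixes B :: "'n::finite heis \<Rightarrow> 'n heis"
  assumes "linear B" "inj B"
  shows "endo_det (B \<circ> B) > 0"
  using heis_det_compose[OF assms(1,1)] heis_det_nonzero_iff[OF assms(1)] assms(2)
  by (simp flip: power2_eq_square)

section \<open>Transvections and symplectic maps\<close>

definition transvection ::
    "real \<Rightarrow> (real^'n) \<times> (real^'n) \<Rightarrow> (real^'n) \<times> (real^'n) \<Rightarrow> (real^'n) \<times> (real^'n)" where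
  "transvection c u z = z + (c * symp u z) *\<^sub>R u"

lemma linear_transvection: "linear (transvection c u)"
  by (rule linearI) (simp_all add: transvection_def symp_linear algebra_simps)

lemma transvection_compose: "transvection c u \<circ> transvection d u = transvection (c + d) u"
  by (rule ext) (simp add: transvection_def symp_linear algebra_simps)

lemma symp_transvection: "symp (transvection c u v) (transvection c u w) = symp v w"
  using symp_swap[of u v] by (simp add: transvection_def symp_linear algebra_simps)

lemma linear_hmap_transvection: "linear (hmap (transvection c u) 1)"
  by (intro linear_hmap linear_transvection)

text \<open>A transvection is the square of another one.\<close>

lemma endo_det_transvection: "endo_det (hmap (transvection c u) 1) > 0"
proof -
  have "hmap (transvection (- (c/2)) u) 1 \<circ> hmap (transvection (c/2) u) 1 = id"
    by (auto simp: hmap_compose transvection_compose transvection_def hmap_def)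
  then have "inj (hmap (transvection (c/2) u) 1)"
    by (metis inj_on_id inj_on_imageI2)
  then have "endo_det (hmap (transvection (c/2) u) 1 \<circ> hmap (transvection (c/2) u) 1) > 0"
    by (intro endo_det_square_pos linear_hmap_transvection)
  then show ?thesis
    by (simp add: hmap_compose transvection_compose)
qed

text \<open>Positivity is carried along as part of the property so that it passes through
  compositions of transvections.\<close>

definition symp_pos :: "((real^'n::finite) \<times> (real^'n) \<Rightarrow> (real^'n) \<times> (real^'n)) \<Rightarrow> bool" where
  "symp_pos T \<longleftrightarrow> linear T \<and> (\<forall>u v. symp (T u) (T v) = symp u v) \<and> endo_det (hmap T 1) > 0"

lemma symp_posD:
  assumes "symp_pos T"
  shows "linear T" "symp (T u) (T v) = symp u v" "endo_det (hmap T 1) > 0"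
  using assms unfolding symp_pos_def by blast+

lemma symp_pos_compose:
  assumes "symp_pos S" "symp_pos T"
  shows "symp_pos (S \<circ> T)"
proof -
  have "endo_det (hmap (S \<circ> T) 1) = endo_det (hmap S 1) * endo_det (hmap T 1)"
    using heis_det_compose[of "hmap S 1" "hmap T 1"] symp_posD(1)[OF assms(1)] symp_posD(1)[OF assms(2)]
    by (simp add: hmap_compose linear_hmap)
  then show ?thesis
    using assms by (simp add: symp_pos_def linear_compose del: split_paired_All)
qed

text \<open>The transvection in direction \<open>w - u\<close> works because
  \<open>symp (w - u) u = symp w u\<close>; it fixes whatever is orthogonal to its
  direction.\<close>

lemma symp_pos_move:
  assumes "symp w u \<noteq> 0"
  obtains T where "symp_pos T" "T u = w" "\<And>f. symp (w - u) f = 0 \<Longrightarrow> T f = f"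
proof
  let ?T = "transvection (1 / symp w u) (w - u)"
  show "symp_pos ?T"
    by (simp add: symp_pos_def linear_transvection symp_transvection endo_det_transvection)
  show "?T u = w"
    using assms by (simp add: transvection_def symp_linear)
  show "?T f = f" if "symp (w - u) f = 0" for f
    using that by (simp add: transvection_def)
qed

text \<open>If \<open>symp w u = 0\<close>, one transvection is not enough; the way goes through a
  vector \<open>z\<close> that pairs nontrivially with both. All vectors involved are orthogonal to
  \<open>F\<close>, so \<open>F\<close> stays fixed.\<close>

lemma symp_pos_move_orthogonal:
  assumes u: "\<And>f. f \<in> F \<Longrightarrow> symp u f = 0" and w: "\<And>f. f \<in> F \<Longrightarrow> symp w f = 0"
    and a: "symp w a \<noteq> 0" "\<And>f. f \<in> F \<Longrightarrow> symp a f = 0"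
    and b: "symp b u \<noteq> 0" "\<And>f. f \<in> F \<Longrightarrow> symp b f = 0"
  obtains T where "symp_pos T" "T u = w" "\<And>f. f \<in> F \<Longrightarrow> T f = f"
proof -
  have "\<exists>z. symp z u \<noteq> 0 \<and> symp w z \<noteq> 0 \<and> (\<forall>f\<in>F. symp z f = 0)"
  proof -
    consider "symp a u \<noteq> 0" | "symp w b \<noteq> 0" | "symp a u = 0" "symp w b = 0" by blast
    then show ?thesis
    proof cases
      \<comment> \<open>Now \<open>a + b\<close> pairs with \<open>u\<close> as \<open>b\<close>
        does and with \<open>w\<close> as \<open>a\<close> does.\<close>
      case 3
      then show ?thesis using a b by (intro exI[of _ "a + b"]) (auto simp: symp_linear)
    qed (use a b in blast)+
  qed
  then obtain z where z: "symp z u \<noteq> 0" "symp w z \<noteq> 0" "\<And>f. f \<in> F \<Longrightarrow> symp z f = 0" by blast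
  obtain T1 where T1: "symp_pos T1" "T1 u = z" "\<And>f. symp (z - u) f = 0 \<Longrightarrow> T1 f = f"
    using symp_pos_move[OF z(1)] by blast
  obtain T2 where T2: "symp_pos T2" "T2 z = w" "\<And>f. symp (w - z) f = 0 \<Longrightarrow> T2 f = f"
    using symp_pos_move[OF z(2)] by blast
  show ?thesis
  proof (rule that[of "T2 \<circ> T1"])
    show "symp_pos (T2 \<circ> T1)" by (intro symp_pos_compose T1 T2)
    show "(T2 \<circ> T1) u = w" by (simp add: T1 T2)
    show "(T2 \<circ> T1) f = f" if "f \<in> F" for f
      using T1(3)[of f] T2(3)[of f] u w z(3) that by (simp add: symp_linear)
  qed
qed

definition sympE :: "'n \<Rightarrow> (real^'n) \<times> (real^'n)" where "sympE i = (axis i 1, 0)"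
definition sympF :: "'n \<Rightarrow> (real^'n) \<times> (real^'n)" where "sympF i = (0, axis i 1)"

lemma symp_EF:
  "symp (sympE i) (sympE j) = 0" "symp (sympF i) (sympF j) = 0"
  "symp (sympF i) (sympE j) = (if i = j then 1 else 0)"
  "symp (sympE i) (sympF j) = (if i = j then - 1 else 0)"
  by (auto simp: symp_def sympE_def sympF_def inner_axis_axis)

lemma linear_eq_id_on_sympEF:
  assumes "linear M" "\<And>i. M (sympE i) = sympE i" "\<And>i. M (sympF i) = sympF i"
  shows "M = id"
proof (rule linear_eq_stdbasis[OF assms(1) linear_id])
  fix b :: "(real^'a) \<times> (real^'a)" assume "b \<in> Basis"
  then obtain i where "b = sympE i \<or> b = sympF i"
    by (auto simp: Basis_prod_def Basis_vec_def sympE_def sympF_def)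
  then show "M b = id b" using assms by auto
qed

text \<open>Composing with transvections makes a symplectic map fix one more hyperbolic pair
  at a time, until it is the identity.\<close>

lemma symplectic_endo_det_pos:
  fixes M :: "(real^'n::finite) \<times> (real^'n) \<Rightarrow> (real^'n) \<times> (real^'n)"
  assumes "linear M" "\<And>u v. symp (M u) (M v) = symp u v"
    and "\<And>i. i \<in> S \<Longrightarrow> M (sympE i) = sympE i \<and> M (sympF i) = sympF i"
  shows "endo_det (hmap M 1) > 0"
  using assms
proof (induction "card (- S)" arbitrary: S M)
  case 0
  then have "S = UNIV" by auto
  then have "M = id" using linear_eq_id_on_sympEF 0 by blast
  then have "hmap M 1 = id" by (auto simp: hmap_def)
  then show ?case by (simp only: endo_det_id_heis zero_less_one)
next
  case (Suc k)
  then obtain i where i: "i \<notin> S" by (metis Compl_iff card.empty ex_in_conv nat.distinct(1))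
  let ?F = "sympE ` S \<union> sympF ` S"
  have MF: "M f = f" if "f \<in> ?F" for f using Suc.prems(3) that by auto
  have orth: "symp (sympE i) f = 0" "symp (sympF i) f = 0" if "f \<in> ?F" for f
    using that i by (auto simp: symp_EF)
  have Morth: "symp (M v) f = symp v f" if "f \<in> ?F" for f v
    using Suc.prems(2)[of v f] MF[OF that] by simp
  \<comment> \<open>The partners of the hyperbolic pairs serve as witnesses: \<open>sympF i\<close>
    for the target and \<open>M (sympF i)\<close> for the source.\<close>
  obtain T1 where T1: "symp_pos T1" "T1 (M (sympE i)) = sympE i" "\<And>f. f \<in> ?F \<Longrightarrow> T1 f = f"
  proof (rule symp_pos_move_orthogonal[of ?F "M (sympE i)" "sympE i" "sympF i" "M (sympF i)"])
    show "symp (M (sympF i)) (M (sympE i)) \<noteq> 0" by (simp add: Suc.prems(2) symp_EF)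
  qed (use orth Morth in \<open>simp_all add: symp_EF(4)\<close>)
  define u where "u = T1 (M (sympF i))"
  have T1s: "symp (T1 v) (T1 w) = symp v w" for v w by (rule symp_posD(2)[OF T1(1)])
  have uE: "symp u (sympE i) = 1"
    using T1s[of "M (sympF i)" "M (sympE i)"] T1(2) by (simp add: u_def Suc.prems(2) symp_EF)
  have uf: "symp u f = 0" if "f \<in> ?F" for f
    using T1s[of "M (sympF i)" f] T1(3)[OF that] Morth[OF that] orth[OF that] by (simp add: u_def)
  \<comment> \<open>\<open>u\<close> and \<open>sympF i\<close> pair with \<open>sympE i\<close> in
    the same way, so their difference is orthogonal to \<open>sympE i\<close> and moving one to the
    other keeps it fixed. If they are orthogonal to each other, \<open>u + sympE i\<close> is an
    intermediate point with the same property.\<close>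
  obtain T2 where T2: "symp_pos T2" "T2 u = sympF i" "T2 (sympE i) = sympE i" "\<And>f. f \<in> ?F \<Longrightarrow> T2 f = f"
  proof (cases "symp (sympF i) u = 0")
    case False
    then obtain T where T: "symp_pos T" "T u = sympF i" "\<And>f. symp (sympF i - u) f = 0 \<Longrightarrow> T f = f"
      using symp_pos_move by blast
    show ?thesis
      by (rule that[OF T(1,2)]) (use T(3) uE uf orth in \<open>auto simp: symp_linear symp_EF\<close>)
  next
    case True
    let ?z = "u + sympE i"
    have 1: "symp ?z u \<noteq> 0" using uE symp_swap[of "sympE i" u] by (simp add: symp_linear)
    obtain T where T: "symp_pos T" "T u = ?z" "\<And>f. symp (?z - u) f = 0 \<Longrightarrow> T f = f"
      using symp_pos_move[OF 1] by blast
    have 2: "symp (sympF i) ?z \<noteq> 0" using True by (simp add: symp_linear symp_EF)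
    obtain T' where T': "symp_pos T'" "T' ?z = sympF i" "\<And>f. symp (sympF i - ?z) f = 0 \<Longrightarrow> T' f = f"
      using symp_pos_move[OF 2] by blast
    show ?thesis
    proof (rule that[of "T' \<circ> T"])
      show "symp_pos (T' \<circ> T)" by (intro symp_pos_compose T T')
      show "(T' \<circ> T) u = sympF i" by (simp add: T T')
      show "(T' \<circ> T) (sympE i) = sympE i"
        using T(3)[of "sympE i"] T'(3)[of "sympE i"] uE by (simp add: symp_linear symp_EF)
      show "(T' \<circ> T) f = f" if "f \<in> ?F" for f
        using T(3)[of f] T'(3)[of f] uf[OF that] orth[OF that] by (simp add: symp_linear)
    qed
  qed
  define N where "N = T2 \<circ> T1"
  have N: "symp_pos N" unfolding N_def by (intro symp_pos_compose T1 T2)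
  have "endo_det (hmap (N \<circ> M) 1) > 0"
  proof (rule Suc.hyps(1)[of "insert i S"])
    have "- S = insert i (- insert i S)" using i by auto
    then show "k = card (- insert i S)" using Suc.hyps(2) by (metis ComplI Compl_insert Diff_iff card_insert_disjoint finite insertI1 nat.inject)
    show "linear (N \<circ> M)" by (intro linear_compose Suc.prems(1) symp_posD(1)[OF N])
    show "symp ((N \<circ> M) u) ((N \<circ> M) v) = symp u v" for u v
      by (simp add: symp_posD(2)[OF N] Suc.prems(2))
    show "(N \<circ> M) (sympE j) = sympE j \<and> (N \<circ> M) (sympF j) = sympF j" if "j \<in> insert i S" for j
    proof (cases "j = i")
      case True
      then show ?thesis using T1 T2 by (simp add: N_def u_def)
    next
      case False
      then have "sympE j \<in> ?F" "sympF j \<in> ?F" using that by auto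
      then show ?thesis using MF T1(3) T2(4) by (simp add: N_def)
    qed
  qed
  moreover have "endo_det (hmap (N \<circ> M) 1) = endo_det (hmap N 1) * endo_det (hmap M 1)"
    using heis_det_compose[of "hmap N 1" "hmap M 1"] symp_posD(1)[OF N] Suc.prems(1)
    by (simp add: hmap_compose linear_hmap)
  ultimately have "0 < endo_det (hmap N 1) * endo_det (hmap M 1)" by simp
  then show ?case using symp_posD(3)[OF N] by (rule zero_less_mult_pos)
qed

text \<open>Division by \<open>sqrt c\<close> makes \<open>M\<close> symplectic. What remains is the
  dilation by \<open>sqrt c\<close>, the square of the dilation \<open>D\<close> by the fourth root
  of \<open>c\<close>.\<close>

lemma endo_det_hmap_pos_factor:
  fixes M :: "(real^'n::finite) \<times> (real^'n) \<Rightarrow> (real^'n) \<times> (real^'n)"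
  assumes M: "linear M" "\<And>u v. symp (M u) (M v) = c * symp u v" and c: "c > 0"
  shows "endo_det (hmap M c) > 0"
proof -
  define N where "N z = (1 / sqrt c) *\<^sub>R M z" for z
  define D :: "'n heis \<Rightarrow> 'n heis" where "D = hmap (\<lambda>z. sqrt (sqrt c) *\<^sub>R z) (sqrt c)"
  have N: "linear N" unfolding N_def by (intro linear_compose_scale_right M)
  have "symp (N u) (N v) = symp u v" for u v
    using c by (simp add: N_def symp_linear M)
  then have posN: "endo_det (hmap N 1) > 0"
    using symplectic_endo_det_pos[OF N, of "{}"] by simp
  have linD: "linear D" unfolding D_def by (intro linear_hmap linear_compose_scale_right linear_id[unfolded id_def])
  have "inj D"
  proof (rule injI)
    fix x y assume "D x = D y"
    then have "hpart x = hpart y" "height x = height y"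
      using c by (simp_all add: D_def hmap_def)
    then show "x = y" by (metis hmk_simps(3))
  qed
  then have "endo_det (D \<circ> D) > 0" by (rule endo_det_square_pos[OF linD])
  moreover have "hmap M c = (D \<circ> D) \<circ> hmap N 1"
    using c by (auto simp: D_def hmap_def N_def)
  ultimately show ?thesis
    using posN heis_det_compose[of "D \<circ> D" "hmap N 1"] linear_compose[OF linD linD] linear_hmap[OF N] by simp
qed

text \<open>Injectivity on the vertical axis excludes \<open>c = 0\<close>. For
  \<open>c < 0\<close>, composing with \<open>yflip\<close> makes the factor positive, and the
  parity of \<open>CARD('n)\<close> makes that reflection preserve orientation.\<close>

theorem endo_det_homogeneous_hom_pos:
  fixes A :: "'n::finite heis \<Rightarrow> 'n heis"
  assumes odd: "odd CARD('n)" and hom: "A \<in> hom heis_group heis_group"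
    and dil: "\<And>s p. s > 0 \<Longrightarrow> A (heis_dilation s p) = heis_dilation s (A p)" and inj: "inj A"
  shows "linear A" "endo_det A > 0"
proof -
  obtain M c where M: "linear M" "A = hmap M c" "\<And>u v. symp (M u) (M v) = c * symp u v"
    using homogeneous_hom_eq_hmap[OF hom dil] by blast
  show "linear A" unfolding M(2) by (intro linear_hmap M)
  have "c \<noteq> 0"
  proof
    assume "c = 0"
    then have "A (hmk 0 1) = A (hmk 0 0)" by (simp add: M(2) del: hmk_0)
    then show False using inj by (metis hmk_eq_iff injD zero_neq_one)
  qed
  show "endo_det A > 0"
  proof (cases "c > 0")
    case True
    then show ?thesis using endo_det_hmap_pos_factor M by blast
  next
    case False
    have lin: "linear (yflip \<circ> M)" by (intro linear_compose M linear_yflip)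
    have "symp ((yflip \<circ> M) u) ((yflip \<circ> M) v) = (- c) * symp u v" for u v
      using M(3)[of u v] by (simp add: symp_def yflip_def)
    then have "endo_det (hmap (yflip \<circ> M) (- c)) > 0"
      using endo_det_hmap_pos_factor[OF lin] False \<open>c \<noteq> 0\<close> by simp
    moreover have "A = hmap yflip (- 1) \<circ> hmap (yflip \<circ> M) (- c)"
      by (auto simp: M(2) hmap_def yflip_def)
    ultimately show ?thesis
      using odd heis_det_compose[of "hmap yflip (- 1)" "hmap (yflip \<circ> M) (- c)"]
      by (simp add: linear_hmap linear_yflip lin endo_det_yflip)
  qed
qed

section \<open>Blow-up at a nondegenerate point\<close>

lemma heis_inv_eq: "heis_inv p = - p"
  by (cases p) simp

lemma heis_mult_assoc: "heis_mult (heis_mult p q) r = heis_mult p (heis_mult q r)"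
  using group.is_monoid[OF group_heis_group] monoid.m_assoc[of heis_group p q r] by simp

lemma heis_mult_inv:
  "heis_mult p 0 = p" "heis_mult 0 p = p" "heis_mult (heis_inv p) p = 0" "heis_mult p (heis_inv p) = 0"
  "heis_mult (heis_inv p) (heis_mult p q) = q" "heis_mult p (heis_mult (heis_inv p) q) = q"
proof -
  show 0: "heis_mult p 0 = p" "heis_mult 0 p = p" for p :: "'a heis"
    by (cases p; simp add: zero_prod_def)+
  show i: "heis_mult (heis_inv p) p = 0" "heis_mult p (heis_inv p) = 0"
    by (cases p; simp add: zero_prod_def inner_commute)+
  show "heis_mult (heis_inv p) (heis_mult p q) = q" "heis_mult p (heis_mult (heis_inv p) q) = q"
    unfolding heis_mult_assoc[symmetric] i 0 by simp_all
qed

lemma heis_inv_mult: "heis_inv (heis_mult p q) = heis_mult (heis_inv q) (heis_inv p)"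
  by (cases p; cases q) (simp add: inner_commute algebra_simps)

lemma heis_mult_left_cancel: "heis_mult p q = heis_mult p r \<longleftrightarrow> q = r"
  by (metis heis_mult_inv(5))

lemma heis_dilation_mult: "heis_dilation s (heis_mult p q) = heis_mult (heis_dilation s p) (heis_dilation s q)"
  by (cases p; cases q) (simp add: scaleR_add_right power2_eq_square algebra_simps)

lemma heis_dilation_inv: "heis_dilation s (heis_inv p) = heis_inv (heis_dilation s p)"
  by (cases p) simp

lemma heis_dilation_dilation: "heis_dilation s (heis_dilation r p) = heis_dilation (s * r) p"
  by (cases p) (simp add: power_mult_distrib)

lemma heis_dilation_1 [simp]: "heis_dilation 1 p = p"
  by (cases p) simp

lemma heis_dilation_inverse:
  "s > 0 \<Longrightarrow> heis_dilation s (heis_dilation (1 / s) p) = p"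
  "s > 0 \<Longrightarrow> heis_dilation (1 / s) (heis_dilation s p) = p"
  by (simp_all add: heis_dilation_dilation)

lemma heis_gauge_dilation: "s > 0 \<Longrightarrow> heis_gauge (heis_dilation s p) = s * heis_gauge p"
  by (cases p) (simp add: abs_mult real_sqrt_mult algebra_simps)

lemma heis_gauge_nonneg: "0 \<le> heis_gauge p"
  by (cases p) simp

lemma linear_heis_dilation: "linear (heis_dilation s)"
  by (rule linearI) (auto simp: algebra_simps)

text \<open>The linear part of left translation by \<open>p\<close>, which is an affine map.\<close>

definition ltrans :: "'n::finite heis \<Rightarrow> 'n heis \<Rightarrow> 'n heis" where
  "ltrans p q = hmk (hpart q) (height q + 2 * symp (hpart p) (hpart q))"

lemma heis_mult_ltrans: "heis_mult p q = p + ltrans p q"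
  by (cases p; cases q) (simp add: ltrans_def hmk_def hpart_def height_def symp_def)

lemma linear_ltrans: "linear (ltrans p)"
  by (rule linearI)
    (simp_all add: ltrans_def linear_add[OF linear_hpart] linear_add[OF linear_height]
      linear_scale[OF linear_hpart] linear_scale[OF linear_height] symp_linear hmk_add hmk_scaleR algebra_simps)

lemma ltrans_compose: "ltrans p \<circ> ltrans q = ltrans (p + q)"
  by (rule ext) (simp add: ltrans_def linear_add[OF linear_hpart] symp_linear algebra_simps)

lemma inj_ltrans: "inj (ltrans p)"
proof (rule injI)
  fix u v assume "ltrans p u = ltrans p v"
  then have "hpart u = hpart v" "height u = height v" by (auto simp: ltrans_def)
  then show "u = v" by (metis hmk_simps(3))
qed

text \<open>Composition of these maps adds their parameters, so each is the square of the one at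
  half the parameter.\<close>

lemma endo_det_ltrans: "endo_det (ltrans p) > 0"
proof -
  have "ltrans p = ltrans ((1/2) *\<^sub>R p) \<circ> ltrans ((1/2) *\<^sub>R p)"
    by (simp add: ltrans_compose flip: scaleR_left_distrib)
  then show ?thesis
    using endo_det_square_pos[OF linear_ltrans inj_ltrans] by metis
qed

text \<open>Allows a Euclidean segment to be rewritten in blown-up coordinates.\<close>

lemma heis_mult_convex_combination:
  "heis_mult p ((1 - t) *\<^sub>R u + t *\<^sub>R v) = (1 - t) *\<^sub>R heis_mult p u + t *\<^sub>R heis_mult p v"
proof -
  have "ltrans p ((1 - t) *\<^sub>R u + t *\<^sub>R v) = (1 - t) *\<^sub>R ltrans p u + t *\<^sub>R ltrans p v"
    by (simp only: linear_add[OF linear_ltrans] linear_scale[OF linear_ltrans])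
  then show ?thesis by (simp add: heis_mult_ltrans algebra_simps)
qed

lemma tendsto_heis_mult:
  fixes a b :: "'i \<Rightarrow> 'n::finite heis"
  assumes "(a \<longlongrightarrow> p) F" "(b \<longlongrightarrow> q) F"
  shows "((\<lambda>i. heis_mult (a i) (b i)) \<longlongrightarrow> heis_mult p q) F"
proof -
  have e: "heis_mult u v = (fst u + fst v, fst (snd u) + fst (snd v),
      snd (snd u) + snd (snd v) + 2 * (fst (snd u) \<bullet> fst v - fst u \<bullet> fst (snd v)))" for u v :: "'n heis"
    by (cases u; cases v) simp
  show ?thesis unfolding e by (intro tendsto_intros assms)
qed

lemma tendsto_heis_gauge:
  fixes a :: "'i \<Rightarrow> 'n::finite heis"
  assumes "(a \<longlongrightarrow> p) F"
  shows "((\<lambda>i. heis_gauge (a i)) \<longlongrightarrow> heis_gauge p) F"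
proof -
  have e: "heis_gauge u = norm (fst u) + norm (fst (snd u)) + sqrt \<bar>snd (snd u)\<bar>" for u :: "'n heis"
    by (cases u) simp
  show ?thesis unfolding e by (intro tendsto_intros assms)
qed

text \<open>The gauge bounds the horizontal coordinates, and its square bounds the height.\<close>

lemma tendsto_0_heis_gauge:
  fixes a :: "'i \<Rightarrow> 'n::finite heis"
  assumes "((\<lambda>i. heis_gauge (a i)) \<longlongrightarrow> 0) F"
  shows "(a \<longlongrightarrow> 0) F"
proof -
  have le: "norm (fst u) \<le> heis_gauge u" "norm (fst (snd u)) \<le> heis_gauge u"
    "\<bar>snd (snd u)\<bar> \<le> (heis_gauge u)\<^sup>2" for u :: "'n heis"
  proof -
    obtain x y t where u: "u = (x, y, t)" by (cases u)
    show "norm (fst u) \<le> heis_gauge u" "norm (fst (snd u)) \<le> heis_gauge u" by (simp_all add: u)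
    have "(sqrt \<bar>t\<bar>)\<^sup>2 \<le> (heis_gauge u)\<^sup>2" by (intro power_mono) (simp_all add: u)
    then show "\<bar>snd (snd u)\<bar> \<le> (heis_gauge u)\<^sup>2" by (simp add: u)
  qed
  have sq: "((\<lambda>i. (heis_gauge (a i))\<^sup>2) \<longlongrightarrow> 0) F"
    using tendsto_power[OF assms, of 2] by simp
  have "((\<lambda>i. fst (a i)) \<longlongrightarrow> 0) F" "((\<lambda>i. fst (snd (a i))) \<longlongrightarrow> 0) F"
    by (rule Lim_null_comparison[OF always_eventually assms]; use le in blast)+
  moreover have "((\<lambda>i. snd (snd (a i))) \<longlongrightarrow> 0) F"
    by (rule Lim_null_comparison[OF always_eventually sq]) (use le in auto)
  ultimately have "((\<lambda>i. (fst (a i), fst (snd (a i)), snd (snd (a i)))) \<longlongrightarrow> (0, 0, 0)) F"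
    by (intro tendsto_Pair)
  then show ?thesis by (simp add: zero_prod_def)
qed

lemma heis_gauge_0 [simp]: "heis_gauge 0 = 0"
  by (simp add: zero_prod_def)

lemma tendsto_heis_gauge_dist:
  fixes a b :: "'i \<Rightarrow> 'n::finite heis"
  assumes d: "((\<lambda>i. heis_gauge (heis_mult (heis_inv (a i)) (b i))) \<longlongrightarrow> 0) F" and a: "(a \<longlongrightarrow> p) F"
  shows "(b \<longlongrightarrow> p) F"
proof -
  have "((\<lambda>i. heis_mult (a i) (heis_mult (heis_inv (a i)) (b i))) \<longlongrightarrow> heis_mult p 0) F"
    by (intro tendsto_heis_mult a tendsto_0_heis_gauge d)
  then show ?thesis by (simp add: heis_mult_inv)
qed

lemma gauge_lipschitz_continuous:
  fixes f :: "'n::finite heis \<Rightarrow> 'n heis"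
  assumes lip: "\<And>p q. heis_gauge (heis_mult (heis_inv (f p)) (f q)) \<le> C * heis_gauge (heis_mult (heis_inv p) q)"
  shows "continuous_on S f"
proof (intro continuous_at_imp_continuous_on ballI)
  fix p :: "'n heis"
  have "((\<lambda>q. C * heis_gauge (heis_mult (heis_inv p) q)) \<longlongrightarrow> C * heis_gauge (heis_mult (heis_inv p) p)) (at p)"
    by (intro tendsto_intros tendsto_heis_gauge tendsto_heis_mult)
  then have lim: "((\<lambda>q. C * heis_gauge (heis_mult (heis_inv p) q)) \<longlongrightarrow> 0) (at p)"
    by (simp add: heis_mult_inv)
  have "((\<lambda>q. heis_gauge (heis_mult (heis_inv (f p)) (f q))) \<longlongrightarrow> 0) (at p)"
    by (rule Lim_null_comparison[OF always_eventually lim])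
      (rule allI, simp add: heis_gauge_nonneg lip)
  then have "(f \<longlongrightarrow> f p) (at p)"
    by (rule tendsto_heis_gauge_dist) simp
  then show "isCont f p" by (simp add: isCont_def)
qed

section \<open>Koranyi spheres\<close>

text \<open>The fourth power of the Koranyi gauge, homogeneous of degree 4 under dilations; its
  level sets are the spheres on which maps are compared.\<close>

definition koranyi :: "'n::finite heis \<Rightarrow> real" where
  "koranyi p = norm (hpart p) ^ 4 + (height p)\<^sup>2"

lemma koranyi_nonneg: "0 \<le> koranyi p" and koranyi_eq_0: "koranyi p = 0 \<longleftrightarrow> p = 0"
proof -
  show "0 \<le> koranyi p" by (simp add: koranyi_def)
  have "koranyi p = 0 \<longleftrightarrow> hpart p = 0 \<and> height p = 0"
    by (simp add: koranyi_def add_nonneg_eq_0_iff)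
  then show "koranyi p = 0 \<longleftrightarrow> p = 0"
    by (metis hmk_0 hmk_simps)
qed

lemma koranyi_dilation: "koranyi (heis_dilation s p) = s ^ 4 * koranyi p"
proof -
  have "heis_dilation s p = hmk (s *\<^sub>R hpart p) (s\<^sup>2 * height p)"
    using heis_dilation_hmk[of s "hpart p" "height p"] by simp
  then show ?thesis
    by (simp add: koranyi_def power_mult_distrib distrib_left flip: power_mult)
qed

lemma continuous_on_koranyi: "continuous_on S koranyi"
  unfolding koranyi_def hpart_def height_def by (intro continuous_intros)

lemma koranyi_small:
  fixes v :: "'n::finite heis"
  assumes "koranyi v \<le> min (e ^ 4) (e\<^sup>2)" "e > 0"
  shows "norm v \<le> 3 * e"
proof -
  have "norm (hpart v) ^ 4 \<le> koranyi v" "(height v)\<^sup>2 \<le> koranyi v" by (simp_all add: koranyi_def)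
  moreover have "koranyi v \<le> e ^ 4" "koranyi v \<le> e\<^sup>2" using assms(1) by simp_all
  ultimately have "norm (hpart v) ^ 4 \<le> e ^ 4" "(height v)\<^sup>2 \<le> e\<^sup>2"
    by (blast intro: order_trans)+
  then have 1: "norm (hpart v) \<le> e" and 2: "\<bar>height v\<bar> \<le> e"
    using assms(2) abs_le_square_iff[of "height v" e] by simp_all
  have "norm (fst v) \<le> e" "norm (fst (snd v)) \<le> e"
    using 1 norm_fst_le[of "fst v" "fst (snd v)"] norm_snd_le[of "fst (snd v)" "fst v"] by (auto simp: hpart_def)
  moreover have "norm v \<le> norm (fst v) + (norm (fst (snd v)) + norm (snd (snd v)))"
    using norm_Pair_le[of "fst v" "snd v"] norm_Pair_le[of "fst (snd v)" "snd (snd v)"] by simp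
  ultimately show ?thesis using 2 by (simp add: height_def)
qed

lemma bounded_koranyi: "bounded {v. koranyi v \<le> r}"
proof -
  define e where "e = max 1 r"
  have e: "e > 0" "e \<ge> 1" "r \<le> e" by (auto simp: e_def)
  have "e \<le> e ^ 4" "e \<le> e\<^sup>2"
    using power_increasing[of 1 4 e] power_increasing[of 1 2 e] e by auto
  then have "r \<le> e ^ 4" "r \<le> e\<^sup>2" using e(3) by auto
  then have "norm v \<le> 3 * e" if "koranyi v \<le> r" for v :: "'a heis"
    using that e by (intro koranyi_small) auto
  then show ?thesis by (auto simp: bounded_iff)
qed

lemma compact_koranyi_sphere: "compact {v :: 'n::finite heis. koranyi v = r}"
proof -
  have "closed {v :: 'n heis. koranyi v = r}"
    by (intro closed_Collect_eq continuous_on_koranyi continuous_intros)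
  moreover have "bounded {v :: 'n heis. koranyi v = r}"
    using bounded_koranyi[of r] by (rule bounded_subset) auto
  ultimately show ?thesis by (simp add: compact_eq_bounded_closed)
qed

section \<open>Blow-ups and the tangent map\<close>

locale nondegenerate_point =
  fixes f :: "'n::finite heis \<Rightarrow> 'n heis" and x0 :: "'n heis" and A :: "'n heis \<Rightarrow> 'n heis" and C :: real
  assumes lip: "heis_gauge (heis_mult (heis_inv (f p)) (f q)) \<le> C * heis_gauge (heis_mult (heis_inv p) q)"
    and diff: "has_P_differential f x0 A"
    and inj: "inj A"
begin

definition blowup :: "real \<Rightarrow> 'n heis \<Rightarrow> 'n heis" where
  "blowup s q = heis_dilation (1 / s) (heis_mult (heis_inv (f x0)) (f (heis_mult x0 (heis_dilation s q))))"

lemma hom: "A \<in> hom heis_group heis_group"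
  and blowup_tendsto: "((\<lambda>s. blowup s q) \<longlongrightarrow> A q) (at_right 0)"
  using diff unfolding has_P_differential_def blowup_def heis_inv_heis_group heis_mult_heis_group by blast+

lemma f_eq_blowup:
  assumes "s > 0"
  shows "f (heis_mult x0 (heis_dilation s q)) = heis_mult (f x0) (heis_dilation s (blowup s q))"
  using assms by (simp add: blowup_def heis_dilation_inverse heis_mult_inv)

text \<open>Left translations preserve gauge distances and dilations scale them, so all blow-ups
  share the constant \<open>C\<close>. This equicontinuity turns pointwise into uniform convergence
  on spheres.\<close>

lemma blowup_lipschitz:
  assumes "s > 0"
  shows "heis_gauge (heis_mult (heis_inv (blowup s p)) (blowup s q)) \<le> C * heis_gauge (heis_mult (heis_inv p) q)"
proof -
  let ?P = "heis_mult x0 (heis_dilation s p)" and ?Q = "heis_mult x0 (heis_dilation s q)"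
  have "heis_mult (heis_inv (blowup s p)) (blowup s q) =
      heis_dilation (1 / s) (heis_mult (heis_inv (f ?P)) (f ?Q))"
    by (simp add: blowup_def heis_inv_mult heis_mult_assoc heis_mult_inv
        flip: heis_dilation_inv heis_dilation_mult)
  then have "heis_gauge (heis_mult (heis_inv (blowup s p)) (blowup s q)) =
      (1 / s) * heis_gauge (heis_mult (heis_inv (f ?P)) (f ?Q))"
    using assms by (simp add: heis_gauge_dilation)
  also have "\<dots> \<le> (1 / s) * (C * heis_gauge (heis_mult (heis_inv ?P) ?Q))"
    using assms lip by (intro mult_left_mono) auto
  also have "heis_mult (heis_inv ?P) ?Q = heis_dilation s (heis_mult (heis_inv p) q)"
    by (simp add: heis_inv_mult heis_mult_assoc heis_mult_inv heis_dilation_inv heis_dilation_mult)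
  also have "(1 / s) * (C * heis_gauge \<dots>) = C * heis_gauge (heis_mult (heis_inv p) q)"
    using assms by (simp add: heis_gauge_dilation)
  finally show ?thesis .
qed

text \<open>Uniqueness of the limit: the blow-up at \<open>heis_dilation r q\<close> with parameter
  \<open>s\<close> is the dilate of the blow-up at \<open>q\<close> with parameter
  \<open>s * r\<close>.\<close>

lemma A_dilation:
  assumes r: "r > 0"
  shows "A (heis_dilation r q) = heis_dilation r (A q)"
proof (rule tendsto_unique[OF _ blowup_tendsto])
  have "blowup s (heis_dilation r q) = heis_dilation r (blowup (s * r) q)" for s
    using r by (simp add: blowup_def heis_dilation_dilation)
  moreover have "((\<lambda>s. heis_dilation r (blowup (s * r) q)) \<longlongrightarrow> heis_dilation r (A q)) (at_right 0)"
  proof -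
    have "filterlim (\<lambda>s. s * r) (at_right 0) (at_right 0)"
      using r by (auto simp: filterlim_at eventually_at_right_less intro!: tendsto_eq_intros
          eventually_mono[OF eventually_at_right_less[of 0]])
    then have "((\<lambda>s. blowup (s * r) q) \<longlongrightarrow> A q) (at_right 0)"
      by (rule filterlim_compose[OF blowup_tendsto])
    moreover have "isCont (heis_dilation r) (A q)"
      using linear_heis_dilation linear_continuous_at linear_conv_bounded_linear by blast
    ultimately show ?thesis by (rule isCont_tendsto_compose[rotated])
  qed
  ultimately show "((\<lambda>s. blowup s (heis_dilation r q)) \<longlongrightarrow> heis_dilation r (A q)) (at_right 0)"
    by simp
qed simp

context
  assumes odd: "odd CARD('n)"
begin

lemma linear_A: "linear A" and endo_det_A: "endo_det A > 0"
  using endo_det_homogeneous_hom_pos[OF odd hom A_dilation inj] by auto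

lemma A_eq_0_iff: "A q = 0 \<longleftrightarrow> q = 0"
  using inj linear_injective_0[OF linear_A] linear_0[OF linear_A] by metis

text \<open>Failing parameters tend to 0, and the corresponding points subconverge to some
  \<open>l\<close> on the compact sphere. If the segment from a blow-up to \<open>A q\<close>
  contains 0, then \<open>norm (A q)\<close> is at most the distance between the two; in the limit
  \<open>A l = 0\<close>, against injectivity.\<close>

lemma blowup_homotopy_nonzero:
  obtains s0 where "s0 > 0"
    "\<And>s q t. 0 < s \<Longrightarrow> s < s0 \<Longrightarrow> koranyi q = 1 \<Longrightarrow> t \<in> {0..1} \<Longrightarrow> (1 - t) *\<^sub>R blowup s q + t *\<^sub>R A q \<noteq> 0"
proof (rule ccontr)
  assume neg: "\<not> thesis"
  have "\<exists>s q t. 0 < s \<and> s < inverse (real (Suc n)) \<and> koranyi q = 1 \<and> t \<in> {0..1} \<and>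
      (1 - t) *\<^sub>R blowup s q + t *\<^sub>R A q = 0" for n
    using neg that[of "inverse (real (Suc n))"] by force
  then obtain s q t where sqt: "\<And>n. 0 < s n" "\<And>n. s n < inverse (real (Suc n))"
      "\<And>n. koranyi (q n) = 1" "\<And>n. t n \<in> {0..1::real}"
      "\<And>n. (1 - t n) *\<^sub>R blowup (s n) (q n) + t n *\<^sub>R A (q n) = 0"
    by metis
  obtain l \<sigma> where l: "koranyi l = 1" "strict_mono \<sigma>" "(q \<circ> \<sigma>) \<longlonglongrightarrow> l"
    using compact_koranyi_sphere[of 1] sqt(3) unfolding compact_def by (metis (mono_tags) mem_Collect_eq)
  have "s \<longlonglongrightarrow> 0"
    by (rule Lim_null_comparison[OF always_eventually LIMSEQ_inverse_real_of_nat])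
      (use sqt(1,2) in \<open>auto simp: less_imp_le\<close>)
  moreover have "s n \<noteq> 0" for n using sqt(1)[of n] by simp
  ultimately have "filterlim s (at_right 0) sequentially"
    using sqt(1) by (auto simp: filterlim_at)
  then have s\<sigma>: "filterlim (s \<circ> \<sigma>) (at_right 0) sequentially"
    unfolding o_def by (rule filterlim_compose[OF _ filterlim_subseq[OF l(2)]])
  have lim1: "(\<lambda>n. blowup (s (\<sigma> n)) l) \<longlonglongrightarrow> A l"
    using filterlim_compose[OF blowup_tendsto s\<sigma>] by (simp add: o_def)
  have "(\<lambda>n. C * heis_gauge (heis_mult (heis_inv l) (q (\<sigma> n)))) \<longlonglongrightarrow> C * heis_gauge (heis_mult (heis_inv l) l)"
    using l(3) by (intro tendsto_intros tendsto_heis_gauge tendsto_heis_mult) (auto simp: o_def)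
  then have g0: "(\<lambda>n. C * heis_gauge (heis_mult (heis_inv l) (q (\<sigma> n)))) \<longlonglongrightarrow> 0"
    by (simp add: heis_mult_inv)
  \<comment> \<open>Convergence is known only at the fixed point \<open>l\<close>; replacing
    \<open>l\<close> by \<open>q (\<sigma> n)\<close> costs \<open>C\<close> times a vanishing
    gauge, uniformly in the parameter.\<close>
  have "(\<lambda>n. heis_gauge (heis_mult (heis_inv (blowup (s (\<sigma> n)) l)) (blowup (s (\<sigma> n)) (q (\<sigma> n))))) \<longlonglongrightarrow> 0"
    by (rule Lim_null_comparison[OF always_eventually g0])
      (rule allI, simp add: heis_gauge_nonneg blowup_lipschitz sqt)
  then have lim2: "(\<lambda>n. blowup (s (\<sigma> n)) (q (\<sigma> n))) \<longlonglongrightarrow> A l"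
    by (rule tendsto_heis_gauge_dist[OF _ lim1])
  have lim3: "(\<lambda>n. A (q (\<sigma> n))) \<longlonglongrightarrow> A l"
    using isCont_tendsto_compose[of l A "q \<circ> \<sigma>"] l(3) linear_continuous_at linear_A linear_conv_bounded_linear
    by (auto simp: o_def)
  have "(\<lambda>n. norm (blowup (s (\<sigma> n)) (q (\<sigma> n)) - A (q (\<sigma> n)))) \<longlonglongrightarrow> norm (A l - A l)"
    by (intro tendsto_intros lim2 lim3)
  then have d0: "(\<lambda>n. norm (blowup (s (\<sigma> n)) (q (\<sigma> n)) - A (q (\<sigma> n)))) \<longlonglongrightarrow> 0" by simp
  have "norm (A (q (\<sigma> n))) \<le> norm (blowup (s (\<sigma> n)) (q (\<sigma> n)) - A (q (\<sigma> n)))" for n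
  proof -
    let ?b = "blowup (s (\<sigma> n)) (q (\<sigma> n))" and ?a = "A (q (\<sigma> n))" and ?t = "t (\<sigma> n)"
    have "?a = - ((1 - ?t) *\<^sub>R (?b - ?a))"
      using sqt(5)[of "\<sigma> n"] by (simp add: algebra_simps add_eq_0_iff)
    then have "norm ?a = \<bar>1 - ?t\<bar> * norm (?b - ?a)"
      by (metis norm_minus_cancel norm_scaleR)
    also have "\<dots> \<le> 1 * norm (?b - ?a)"
      using sqt(4)[of "\<sigma> n"] by (intro mult_right_mono) auto
    finally show ?thesis by simp
  qed
  then have "(\<lambda>n. A (q (\<sigma> n))) \<longlonglongrightarrow> 0"
    by (intro Lim_null_comparison[OF always_eventually d0]) auto
  then have "A l = 0" using lim3 LIMSEQ_unique by blast
  then have "l = 0" by (simp add: A_eq_0_iff)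
  then show False using l(1) koranyi_eq_0[of l] by simp
qed

definition tangent :: "'n heis \<Rightarrow> 'n heis" where
  "tangent y = heis_mult (f x0) (A (heis_mult (heis_inv x0) y))"

text \<open>With \<open>s\<close> the fourth root of the Koranyi value, a point near
  \<open>x0\<close> is the translate of a dilated unit vector \<open>q\<close>. The homotopy there
  is the dilated and translated homotopy at \<open>q\<close>, and only the value 0 is carried to
  \<open>f x0\<close>.\<close>

lemma homotopy_to_tangent:
  obtains e where "e > 0"
    "\<And>y t. 0 < koranyi (heis_mult (heis_inv x0) y) \<Longrightarrow> koranyi (heis_mult (heis_inv x0) y) < e \<Longrightarrow> t \<in> {0..1} \<Longrightarrow>
      (1 - t) *\<^sub>R f y + t *\<^sub>R tangent y \<noteq> f x0"
proof -
  obtain s0 where s0: "s0 > 0"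
    "\<And>s q t. 0 < s \<Longrightarrow> s < s0 \<Longrightarrow> koranyi q = 1 \<Longrightarrow> t \<in> {0..1} \<Longrightarrow> (1 - t) *\<^sub>R blowup s q + t *\<^sub>R A q \<noteq> 0"
    using blowup_homotopy_nonzero by blast
  show ?thesis
  proof (rule that[of "s0 ^ 4"])
    show "s0 ^ 4 > 0" using s0 by simp
    fix y and t :: real
    define v where "v = heis_mult (heis_inv x0) y"
    assume "0 < koranyi (heis_mult (heis_inv x0) y)" "koranyi (heis_mult (heis_inv x0) y) < s0 ^ 4"
      and t: "t \<in> {0..1}"
    then have v: "0 < koranyi v" "koranyi v < s0 ^ 4" by (simp_all add: v_def)
    define s where "s = root 4 (koranyi v)"
    have s: "0 < s" "s ^ 4 = koranyi v" using v by (simp_all add: s_def)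
    have "s < s0"
      using v(2) s s0(1) power_less_imp_less_base[of s 4 s0] by simp
    define q where "q = heis_dilation (1 / s) v"
    have q: "koranyi q = 1" using s v by (simp add: q_def koranyi_dilation power_divide)
    have vq: "v = heis_dilation s q" using s by (simp add: q_def heis_dilation_inverse)
    have y: "y = heis_mult x0 (heis_dilation s q)" by (simp add: v_def heis_mult_inv flip: vq)
    let ?c = "(1 - t) *\<^sub>R blowup s q + t *\<^sub>R A q"
    have "(1 - t) *\<^sub>R f y + t *\<^sub>R tangent y = heis_mult (f x0) (heis_dilation s ?c)"
      unfolding y f_eq_blowup[OF s(1)] tangent_def
      by (simp add: heis_mult_inv A_dilation s heis_mult_convex_combination
          linear_add[OF linear_heis_dilation] linear_scale[OF linear_heis_dilation])
    moreover have "heis_dilation s ?c \<noteq> 0"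
    proof
      assume "heis_dilation s ?c = 0"
      then have "heis_dilation (1 / s) (heis_dilation s ?c) = heis_dilation (1 / s) 0" by simp
      then have "?c = 0"
        using s(1) linear_0[OF linear_heis_dilation] by (simp add: heis_dilation_inverse)
      then show False using s0(2)[OF s(1) \<open>s < s0\<close> q t] by simp
    qed
    ultimately show "(1 - t) *\<^sub>R f y + t *\<^sub>R tangent y \<noteq> f x0"
      using heis_mult_left_cancel[of "f x0" "heis_dilation s ?c" 0] by (simp add: heis_mult_inv)
  qed
qed

lemma tangent_eq_iff: "tangent y = f x0 \<longleftrightarrow> y = x0"
proof -
  have "tangent y = f x0 \<longleftrightarrow> heis_mult (f x0) (A (heis_mult (heis_inv x0) y)) = heis_mult (f x0) 0"
    by (simp add: tangent_def heis_mult_inv)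
  also have "\<dots> \<longleftrightarrow> A (heis_mult (heis_inv x0) y) = 0"
    by (rule heis_mult_left_cancel)
  also have "\<dots> \<longleftrightarrow> heis_mult (heis_inv x0) y = heis_mult (heis_inv x0) x0"
    by (simp only: A_eq_0_iff heis_mult_inv)
  also have "\<dots> \<longleftrightarrow> y = x0" by (rule heis_mult_left_cancel)
  finally show ?thesis .
qed

text \<open>The map is affine; its linear part is composed of \<open>A\<close> and two maps
  \<open>ltrans\<close>, each of positive determinant.\<close>

lemma C1_tangent: "C1_map tangent"
  and det_tangent: "endo_det (frechet_derivative tangent (at y)) > 0"
proof -
  let ?D = "ltrans (f x0) \<circ> (A \<circ> ltrans (heis_inv x0))"
  have lin: "linear (A \<circ> ltrans (heis_inv x0))" "linear ?D"
    by (intro linear_compose linear_ltrans linear_A)+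
  have eq: "tangent = (\<lambda>y. f x0 + ltrans (f x0) (A (heis_inv x0)) + ?D y)"
    by (simp add: fun_eq_iff tangent_def heis_mult_ltrans linear_add[OF linear_A] linear_add[OF linear_ltrans] add.assoc)
  have C: "C1_with tangent (\<lambda>y v. 0 + ?D v)"
    unfolding eq by (intro C1_with_add C1_with_const C1_with_linear lin)
  show "C1_map tangent" by (rule C1_with_imp_C1_map(1)[OF C])
  have "endo_det ?D > 0"
    unfolding heis_det_compose[OF linear_ltrans lin(1)] heis_det_compose[OF linear_A linear_ltrans]
    by (intro mult_pos_pos endo_det_ltrans endo_det_A)
  then show "endo_det (frechet_derivative tangent (at y)) > 0"
    by (simp add: C1_with_imp_C1_map(2)[OF C] o_def)
qed

lemma regular_tangent: "regular_value_on tangent V (f x0)"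
  using det_tangent unfolding regular_value_on_def by (metis less_irrefl)

lemma signed_count_tangent: "x0 \<in> V \<Longrightarrow> signed_count tangent V (f x0) = 1"
proof -
  assume "x0 \<in> V"
  then have "{x. x \<in> V \<and> tangent x = f x0} = {x0}" by (auto simp: tangent_eq_iff)
  then show ?thesis by (simp add: signed_count_def det_tangent)
qed

end

end

text \<open>The values of the differential are limits, hence unique, so the definite description
  denotes it.\<close>

lemma has_P_differential_P_differential:
  assumes "P_differentiable f p"
  shows "has_P_differential f p (P_differential f p)"
proof -
  have "A = B" if "has_P_differential f p A" "has_P_differential f p B" for A B
    using that tendsto_unique[OF trivial_limit_at_right_real] unfolding has_P_differential_def
    by (intro ext) blast
  then show ?thesis
    unfolding P_differential_def using assms by (metis P_differentiable_def theI)
qed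

section \<open>The degree of a map with nondegenerate fibre\<close>

lemma convex_combination_neq:
  fixes a b c p :: "'a::real_normed_vector"
  assumes "dist c a < d" "dist c b < d" "d \<le> dist c p" "t \<in> {0..1}"
  shows "(1 - t) *\<^sub>R a + t *\<^sub>R b \<noteq> p"
proof -
  have "(1 - t) *\<^sub>R a + t *\<^sub>R b \<in> ball c d"
    using assms by (intro convexD_alt convex_ball) auto
  then show ?thesis using assms(3) by auto
qed

lemma compact_dist_pos:
  fixes H :: "'a::metric_space \<Rightarrow> 'b::metric_space"
  assumes "compact S" "continuous_on S H" "\<And>z. z \<in> S \<Longrightarrow> H z \<noteq> p"
  obtains d where "d > 0" "\<And>z. z \<in> S \<Longrightarrow> d \<le> dist (H z) p"
proof (cases "S = {}")
  case False
  obtain z where z: "z \<in> S" "\<And>y. y \<in> S \<Longrightarrow> dist (H z) p \<le> dist (H y) p"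
    using continuous_attains_inf[OF assms(1) False continuous_on_dist[OF assms(2) continuous_on_const]] by blast
  show ?thesis by (rule that[of "dist (H z) p"]) (use z assms(3) in auto)
qed (use that[of 1] in simp)

section \<open>Koranyi balls and additivity of counts\<close>

definition kball :: "'n::finite heis \<Rightarrow> real \<Rightarrow> 'n heis set" where
  "kball x r = {y. koranyi (heis_mult (heis_inv x) y) < r}"

lemma continuous_on_koranyi_translate: "continuous_on S (\<lambda>y. koranyi (heis_mult (heis_inv x) y))"
proof -
  have "continuous_on S (\<lambda>y. heis_mult (heis_inv x) y)"
    unfolding continuous_on_def by (intro ballI tendsto_heis_mult tendsto_intros)
  then show ?thesis
    by (rule continuous_on_compose2[OF continuous_on_koranyi[of UNIV]]) simp
qed

lemma open_kball: "open (kball x r)"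
  unfolding kball_def
  by (intro open_Collect_less continuous_on_koranyi_translate continuous_intros)

lemma closed_kball: "closed {y. koranyi (heis_mult (heis_inv x) y) \<le> r}"
  by (intro closed_Collect_le continuous_on_koranyi_translate continuous_intros)

lemma frontier_kball:
  assumes "y \<in> frontier (kball x r)"
  shows "koranyi (heis_mult (heis_inv x) y) = r"
proof -
  have "closure (kball x r) \<subseteq> {y. koranyi (heis_mult (heis_inv x) y) \<le> r}"
    by (intro closure_minimal closed_kball) (auto simp: kball_def)
  then have "koranyi (heis_mult (heis_inv x) y) \<le> r" "y \<notin> kball x r"
    using assms open_kball[of x r] by (auto simp: frontier_def interior_open)
  then show ?thesis by (auto simp: kball_def)
qed

lemma center_in_kball:
  assumes "r > 0"
  shows "x \<in> kball x r"
proof -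
  have "koranyi (heis_mult (heis_inv x) x) = 0" by (simp add: heis_mult_inv koranyi_eq_0)
  then show ?thesis using assms by (simp add: kball_def)
qed

text \<open>The closed sublevel set is placed in \<open>S\<close>, so that the frontier of the ball
  lies in \<open>S\<close> as well.\<close>

lemma kball_neighbourhood_basis:
  assumes O: "open S" "x \<in> S"
  obtains r where "r > 0" "{y. koranyi (heis_mult (heis_inv x) y) \<le> r} \<subseteq> S"
proof -
  have "continuous_on UNIV (\<lambda>v. heis_mult x v)"
    unfolding continuous_on_def by (intro ballI tendsto_heis_mult tendsto_intros)
  then have "open ((\<lambda>v. heis_mult x v) -` S)" using O(1) open_vimage by blast
  moreover have "0 \<in> (\<lambda>v. heis_mult x v) -` S" using O(2) by (simp add: heis_mult_inv)
  ultimately obtain e where e: "e > 0" "cball 0 e \<subseteq> (\<lambda>v. heis_mult x v) -` S"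
    using open_contains_cball by blast
  show ?thesis
  proof (rule that[of "min ((e/3) ^ 4) ((e/3)\<^sup>2)"])
    show "0 < min ((e/3) ^ 4) ((e/3)\<^sup>2)" using e by simp
    show "{y. koranyi (heis_mult (heis_inv x) y) \<le> min ((e/3) ^ 4) ((e/3)\<^sup>2)} \<subseteq> S"
    proof
      fix y assume "y \<in> {y. koranyi (heis_mult (heis_inv x) y) \<le> min ((e/3) ^ 4) ((e/3)\<^sup>2)}"
      then have "norm (heis_mult (heis_inv x) y) \<le> 3 * (e / 3)"
        using e(1) by (intro koranyi_small) auto
      then have "heis_mult (heis_inv x) y \<in> (\<lambda>v. heis_mult x v) -` S"
        using e(2) by auto
      then show "y \<in> S" by (simp add: heis_mult_inv)
    qed
  qed
qed

lemma signed_count_UN: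
  assumes "finite K" "\<And>x. x \<in> K \<Longrightarrow> finite {y \<in> B x. h y = p}"
    and "\<And>x y. x \<in> K \<Longrightarrow> y \<in> K \<Longrightarrow> x \<noteq> y \<Longrightarrow> B x \<inter> B y = {}"
    and "{y \<in> V. h y = p} = (\<Union>x\<in>K. {y \<in> B x. h y = p})"
  shows "signed_count h V p = (\<Sum>x\<in>K. signed_count h (B x) p)"
  unfolding signed_count_def assms(4)
  by (rule sum.UNION_disjoint) (use assms in auto)

section \<open>Computation of the degree\<close>

locale regular_fibre =
  fixes f :: "'n::finite heis \<Rightarrow> 'n heis" and U :: "'n heis set" and p :: "'n heis" and C :: real
  assumes odd: "odd CARD('n)"
    and lip: "\<And>x y. heis_gauge (heis_mult (heis_inv (f x)) (f y)) \<le> C * heis_gauge (heis_mult (heis_inv x) y)"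
    and U: "open U" and p: "p \<notin> f ` frontier U"
    and reg: "\<And>x. f x = p \<Longrightarrow> \<exists>A. has_P_differential f x A \<and> inj A"
    and bdd: "bounded {x \<in> U. f x = p}"
begin

definition K :: "'n heis set" where "K = {x \<in> U. f x = p}"

lemma continuous_f: "continuous_on S f"
  by (rule gauge_lipschitz_continuous[OF lip])

lemma closure_U: "x \<in> closure U \<Longrightarrow> f x = p \<Longrightarrow> x \<in> K"
  using p U by (auto simp: K_def frontier_def interior_open)

lemma compact_K: "compact K"
proof -
  have "K = closure U \<inter> f -` {p}"
    using closure_U closure_subset[of U] by (auto simp: K_def)
  then have "closed K"
    using continuous_closed_preimage[OF continuous_f, of "closure U" "{p}"] by simp
  then show ?thesis using bdd by (simp add: compact_eq_bounded_closed K_def)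
qed

text \<open>Collects what the tangent map at \<open>x\<close> provides, so that comparison maps can
  be chosen for all points of the fibre at once, outside the locale of a single point.\<close>

definition model :: "'n heis \<Rightarrow> ('n heis \<Rightarrow> 'n heis) \<Rightarrow> real \<Rightarrow> bool" where
  "model x h e \<longleftrightarrow> e > 0 \<and> C1_map h \<and> (\<forall>V. regular_value_on h V p) \<and>
     (\<forall>V. x \<in> V \<longrightarrow> signed_count h V p = 1) \<and>
     (\<forall>y t. 0 < koranyi (heis_mult (heis_inv x) y) \<longrightarrow> koranyi (heis_mult (heis_inv x) y) < e \<longrightarrow> t \<in> {0..1} \<longrightarrow>
      (1 - t) *\<^sub>R f y + t *\<^sub>R h y \<noteq> p)"

lemma model_exists:
  assumes "x \<in> K"
  obtains h e where "model x h e"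
proof -
  have fx: "f x = p" using assms by (simp add: K_def)
  obtain A where "has_P_differential f x A" "inj A" using reg[OF fx] by blast
  then interpret nondegenerate_point f x A C
    using lip by unfold_locales auto
  obtain e where e: "e > 0"
    "\<And>y t. 0 < koranyi (heis_mult (heis_inv x) y) \<Longrightarrow> koranyi (heis_mult (heis_inv x) y) < e \<Longrightarrow> t \<in> {0..1} \<Longrightarrow>
      (1 - t) *\<^sub>R f y + t *\<^sub>R tangent y \<noteq> f x"
    using homotopy_to_tangent[OF odd] by blast
  have "model x tangent e"
    unfolding model_def
    using e C1_tangent[OF odd] regular_tangent[OF odd] signed_count_tangent[OF odd] unfolding fx by blast
  then show ?thesis by (rule that)
qed

lemma modelD:
  assumes "model x h e"
  shows "e > 0" "C1_map h" "regular_value_on h V p" "x \<in> V \<Longrightarrow> signed_count h V p = 1"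
    "0 < koranyi (heis_mult (heis_inv x) y) \<Longrightarrow> koranyi (heis_mult (heis_inv x) y) < e \<Longrightarrow> t \<in> {0..1} \<Longrightarrow>
      (1 - t) *\<^sub>R f y + t *\<^sub>R h y \<noteq> p"
  using assms unfolding model_def by blast+

text \<open>At time 0 the homotopy condition says that \<open>f\<close> misses \<open>p\<close> on a
  punctured ball, so the compact fibre is discrete.\<close>

lemma finite_K: "finite K"
proof -
  have "\<exists>W. open W \<and> x \<in> W \<and> W \<inter> K \<subseteq> {x}" if x: "x \<in> K" for x
  proof -
    obtain h e where m: "model x h e" using model_exists[OF x] .
    have "y = x" if y: "y \<in> kball x e" "f y = p" for y
    proof (rule ccontr)
      assume "y \<noteq> x"
      then have "heis_mult (heis_inv x) y \<noteq> heis_mult (heis_inv x) x" by (simp only: heis_mult_left_cancel not_False_eq_True)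
      then have "koranyi (heis_mult (heis_inv x) y) \<noteq> 0"
        by (simp add: heis_mult_inv koranyi_eq_0)
      then have "0 < koranyi (heis_mult (heis_inv x) y)"
        using koranyi_nonneg[of "heis_mult (heis_inv x) y"] by simp
      then show False using modelD(5)[OF m, of y 0] y by (simp add: kball_def)
    qed
    then have "kball x e \<inter> K \<subseteq> {x}" unfolding K_def by blast
    then show ?thesis
      using center_in_kball[OF modelD(1)[OF m]] open_kball by blast
  qed
  then obtain W where W: "\<And>x. x \<in> K \<Longrightarrow> open (W x) \<and> x \<in> W x \<and> W x \<inter> K \<subseteq> {x}"
    by metis
  obtain F where F: "F \<subseteq> K" "finite F" "K \<subseteq> (\<Union>x\<in>F. W x)"
    by (rule compactE_image[OF compact_K, of K W]) (use W in blast)+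
  then have "K \<subseteq> F" using W by blast
  then show ?thesis using F finite_subset by auto
qed

text \<open>A regular map \<open>k\<close> very close to \<open>f\<close> mediates between
  \<open>g\<close> and the local models: its count on \<open>V\<close> is that of \<open>g\<close>,
  and its count on a small ball around a fibre point is that of the model there, which is 1.\<close>

lemma degree_eq_card:
  assumes V: "open V" "bounded V" "V \<subseteq> U" "K \<subseteq> V" and deg: "has_brouwer_degree f V p d"
  shows "d = int (card K)"
proof -
  obtain g where g: "C1_map g" "regular_value_on g V p"
      "\<And>x. x \<in> closure V \<Longrightarrow> dist (f x) (g x) < infdist p (f ` frontier V)"
      "d = signed_count g V p"
    using deg unfolding has_brouwer_degree_def signed_count_def by blast
  obtain \<beta> :: "'n bit1 \<Rightarrow> 'n heis" where \<beta>: "bij_betw \<beta> UNIV Basis" by (rule heis_basis_bij)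
  have fV: "y \<in> K" if "y \<in> closure V" "f y = p" for y
    using closure_U closure_mono[OF V(3)] that by blast
  have "\<exists>h e. model x h e" if "x \<in> K" for x
    using model_exists[OF that] by blast
  then obtain h e where m: "\<And>x. x \<in> K \<Longrightarrow> model x (h x) (e x)" by metis
  obtain \<delta> where \<delta>: "\<And>x. \<delta> x > 0" "\<And>x y. y \<in> K \<Longrightarrow> y \<noteq> x \<Longrightarrow> \<delta> x \<le> dist x y"
    using finite_set_avoid[OF finite_K] by metis
  have "\<exists>r>0. {y. koranyi (heis_mult (heis_inv x) y) \<le> r} \<subseteq> V \<inter> ball x (\<delta> x / 2) \<inter> kball x (e x)" if x: "x \<in> K" for x
  proof -
    have "open (V \<inter> ball x (\<delta> x / 2) \<inter> kball x (e x))" by (intro open_Int V(1) open_ball open_kball)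
    moreover have "x \<in> V \<inter> ball x (\<delta> x / 2) \<inter> kball x (e x)"
      using x V(4) \<delta>(1)[of x] center_in_kball[OF modelD(1)[OF m[OF x]], of x] by auto
    ultimately show ?thesis using kball_neighbourhood_basis by metis
  qed
  then obtain r where r: "\<And>x. x \<in> K \<Longrightarrow> r x > 0"
      "\<And>x. x \<in> K \<Longrightarrow> {y. koranyi (heis_mult (heis_inv x) y) \<le> r x} \<subseteq> V \<inter> ball x (\<delta> x / 2) \<inter> kball x (e x)"
    by metis
  define B where "B x = kball x (r x)" for x
  have Bsub: "B x \<subseteq> V" "B x \<subseteq> ball x (\<delta> x / 2)" if "x \<in> K" for x
    using r(2)[OF that] by (auto simp: B_def kball_def)
  have Bopen: "open (B x)" for x by (simp add: B_def open_kball)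
  have Bbdd: "bounded (B x)" if "x \<in> K" for x using Bsub(1)[OF that] V(2) bounded_subset by blast
  have Bdisj: "B x \<inter> B y = {}" if "x \<in> K" "y \<in> K" "x \<noteq> y" for x y
  proof (rule ccontr)
    assume "B x \<inter> B y \<noteq> {}"
    then obtain z where "z \<in> B x" "z \<in> B y" by blast
    then have "dist x z < \<delta> x/2" "dist y z < \<delta> y/2"
      using Bsub(2)[OF that(1)] Bsub(2)[OF that(2)] by auto
    then show False
      using \<delta>(2)[of y x] \<delta>(2)[of x y] that dist_triangle2[of x y z] by (simp add: dist_commute)
  qed
  have xB: "x \<in> B x" if "x \<in> K" for x using center_in_kball r(1)[OF that] by (simp add: B_def)
  define W where "W = (\<Union>x\<in>K. B x)"
  have W: "open W" "W \<subseteq> V" "K \<subseteq> W"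
    unfolding W_def using Bopen by (rule open_UN[rule_format]) (use Bsub(1) xB in blast)+
  \<comment> \<open>Off the small balls \<open>f\<close> keeps a positive distance from
    \<open>p\<close>, so a map close to \<open>f\<close> has no preimage of \<open>p\<close>
    there.\<close>
  obtain d0 where d0: "d0 > 0" "\<And>y. y \<in> closure V - W \<Longrightarrow> d0 \<le> dist (f y) p"
  proof (rule compact_dist_pos[of "closure V - W" f p])
    show "compact (closure V - W)" using V(2) W(1) by (intro compact_diff) auto
    show "f z \<noteq> p" if "z \<in> closure V - W" for z using fV[of z] W(3) that by blast
  qed (use continuous_f in auto)
  define H where "H x z = (1 - fst z) *\<^sub>R f (snd z) + fst z *\<^sub>R h x (snd z)" for x and z :: "real \<times> 'n heis"
  have "\<exists>c>0. \<forall>z\<in>{0..1} \<times> frontier (B x). c \<le> dist (H x z) p" if x: "x \<in> K" for x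
  proof -
    have "continuous_on UNIV (h x)"
      using C1_withD(4)[OF C1_map_imp_C1_with[OF modelD(2)[OF m[OF x]]]] .
    then have "continuous_on S (\<lambda>z. h x (snd z))" "continuous_on S (\<lambda>z. f (snd z))"
      for S :: "(real \<times> 'n heis) set"
      using continuous_on_compose2[OF _ continuous_on_snd[OF continuous_on_id[of S]], of UNIV]
        continuous_f[of UNIV] by blast+
    then have cont: "continuous_on S (H x)" for S
      unfolding H_def by (intro continuous_intros)
    have ne: "H x z \<noteq> p" if "z \<in> {0..1} \<times> frontier (B x)" for z
    proof -
      have z: "fst z \<in> {0..1}" "snd z \<in> frontier (kball x (r x))"
        using that by (simp_all add: mem_Times_iff B_def)
      note k = frontier_kball[OF z(2)]
      then have "snd z \<in> {y. koranyi (heis_mult (heis_inv x) y) \<le> r x}" by simp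
      then have "snd z \<in> kball x (e x)" using r(2)[OF x] by blast
      then show ?thesis
        unfolding H_def using modelD(5)[OF m[OF x], of "snd z" "fst z"] k r(1)[OF x] z(1)
        by (simp add: kball_def)
    qed
    have "compact ({0..1::real} \<times> frontier (B x))"
      using Bbdd[OF x] by (intro compact_Times compact_frontier_bounded) auto
    from compact_dist_pos[OF this cont ne] show ?thesis by metis
  qed
  then obtain c where c: "\<And>x. x \<in> K \<Longrightarrow> c x > 0" "\<And>x z. x \<in> K \<Longrightarrow> z \<in> {0..1} \<times> frontier (B x) \<Longrightarrow> c x \<le> dist (H x z) p"
    by metis
  \<comment> \<open>Inserting \<open>d0\<close> also keeps the set nonempty when \<open>K\<close> is
    empty.\<close>
  define \<epsilon> where "\<epsilon> = Min (insert d0 (c ` K))"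
  have \<epsilon>: "\<epsilon> > 0" "\<epsilon> \<le> d0" "\<And>x. x \<in> K \<Longrightarrow> \<epsilon> \<le> c x"
    using finite_K d0(1) c(1) by (auto simp: \<epsilon>_def)
  have "compact (closure V)" using V(2) by simp
  then obtain k where k: "C1_map k" "regular_value_on k UNIV p" "\<And>x. x \<in> closure V \<Longrightarrow> dist (f x) (k x) < \<epsilon>"
    using C1_regular_approximation[OF \<beta> _ continuous_f \<epsilon>(1)] by metis
  have kreg: "regular_value_on k S p" for S
    using k(2) by (auto simp: regular_value_on_def)
  have frV: "frontier V \<subseteq> closure V - W"
    using W(2) V(1) by (auto simp: frontier_def interior_open)
  have "signed_count g V p = signed_count k V p"
  proof (rule signed_count_homotopy_invariant[OF \<beta> g(1,2) k(1) kreg V(1,2)])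
    fix x t assume x: "x \<in> frontier V" and t: "t \<in> {0..1::real}"
    have xc: "x \<in> closure V" using x by (simp add: frontier_def)
    \<comment> \<open>Both \<open>g x\<close> and \<open>k x\<close> lie in the open ball around
      \<open>f x\<close> of radius \<open>dist (f x) p\<close>; it is convex and does not contain
      \<open>p\<close>.\<close>
    have "infdist p (f ` frontier V) \<le> dist p (f x)" using x by (intro infdist_le) auto
    then have "dist (f x) (g x) < dist (f x) p" using g(3)[OF xc] by (simp add: dist_commute)
    moreover have "dist (f x) (k x) < dist (f x) p"
      using k(3)[OF xc] \<epsilon>(2) d0(2)[of x] x frV by force
    ultimately show "(1 - t) *\<^sub>R g x + t *\<^sub>R k x \<noteq> p"
      using convex_combination_neq[of "f x" "g x" "dist (f x) p" "k x" p t] t by simp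
  qed
  also have "\<dots> = (\<Sum>x\<in>K. signed_count k (B x) p)"
  proof (rule signed_count_UN[OF finite_K _ Bdisj])
    have kp: "y \<in> W" if "y \<in> closure V" "k y = p" for y
    proof (rule ccontr)
      assume "y \<notin> W"
      then have "d0 \<le> dist (f y) p" using d0(2) that by simp
      then show False using k(3)[OF that(1)] \<epsilon>(2) that(2) by simp
    qed
    then show eq: "{y \<in> V. k y = p} = (\<Union>x\<in>K. {y \<in> B x. k y = p})"
      using closure_subset[of V] W(2) unfolding W_def by blast
    have "p \<notin> k ` frontier V"
      using kp frV by blast
    then have "finite {y \<in> V. k y = p}"
      by (rule finite_preimages_regular_value[OF \<beta> k(1) kreg V(1,2)])
    then show "finite {y \<in> B x. k y = p}" if "x \<in> K" for x
      using Bsub(1)[OF that] by (auto elim!: finite_subset[rotated])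
  qed
  also have "\<dots> = (\<Sum>x\<in>K. 1)"
  proof (rule sum.cong[OF refl])
    fix x assume x: "x \<in> K"
    have "signed_count (h x) (B x) p = signed_count k (B x) p"
    proof (rule signed_count_homotopy_invariant[OF \<beta> modelD(2,3)[OF m[OF x]] k(1) kreg Bopen Bbdd[OF x]])
      fix y t assume y: "y \<in> frontier (B x)" and t: "t \<in> {0..1::real}"
      have "y \<in> closure V" using y closure_mono[OF Bsub(1)[OF x]] by (auto simp: frontier_def)
      then have d: "dist (f y) (k y) < \<epsilon>" by (rule k(3))
      \<comment> \<open>\<open>H\<close> runs from \<open>f\<close> to the model, the required
        homotopy from the model to \<open>k\<close>. After reversing time they differ by
        \<open>t\<close> times \<open>f y - k y\<close>, which is shorter than the distance of
        \<open>H\<close> from \<open>p\<close>.\<close>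
      let ?a = "H x (1 - t, y)"
      have "c x \<le> dist ?a p" using c(2)[OF x, of "(1 - t, y)"] y t by (simp add: mem_Times_iff)
      then have "\<epsilon> \<le> dist ?a p" using \<epsilon>(3)[OF x] by simp
      moreover have "dist ?a ((1 - t) *\<^sub>R h x y + t *\<^sub>R k y) \<le> dist (f y) (k y)"
      proof -
        have "?a - ((1 - t) *\<^sub>R h x y + t *\<^sub>R k y) = t *\<^sub>R (f y - k y)"
          by (simp add: H_def algebra_simps)
        then show ?thesis using t by (simp add: dist_norm mult_left_le_one_le)
      qed
      ultimately show "(1 - t) *\<^sub>R h x y + t *\<^sub>R k y \<noteq> p" using d by auto
    qed
    then show "signed_count k (B x) p = 1" using modelD(4)[OF m[OF x] xB[OF x]] by simp
  qed
  finally show ?thesis using g(4) by simp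
qed

text \<open>A ball around the compact fibre cuts \<open>U\<close> down to a bounded
  \<open>V\<close>. It suffices to find some admissible approximation, since
  \<open>degree_eq_card\<close> then determines the value.\<close>

lemma degree_exists:
  "\<exists>V. open V \<and> bounded V \<and> V \<subseteq> U \<and> K \<subseteq> V \<and> has_brouwer_degree f V p (int (card K))"
proof -
  obtain R where R: "K \<subseteq> ball 0 R"
    using compact_imp_bounded[OF compact_K] bounded_subset_ballD by blast
  define V where "V = U \<inter> ball 0 R"
  have V: "open V" "bounded V" "V \<subseteq> U" "K \<subseteq> V"
    using U R by (auto simp: V_def K_def bounded_Int)
  obtain \<beta> :: "'n bit1 \<Rightarrow> 'n heis" where \<beta>: "bij_betw \<beta> UNIV Basis" by (rule heis_basis_bij)
  have "\<exists>k. C1_map k \<and> regular_value_on k UNIV p \<and> (\<forall>x\<in>closure V. dist (f x) (k x) < infdist p (f ` frontier V))"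
  proof (cases "V = {}")
    \<comment> \<open>Here the frontier is empty and \<open>infdist\<close> takes its default value
      0, but the closeness condition ranges over an empty closure.\<close>
    case True
    obtain k where "C1_map k" "regular_value_on k UNIV p"
      using C1_regular_approximation[OF \<beta> compact_empty continuous_f zero_less_one] by metis
    then show ?thesis using True by auto
  next
    case False
    \<comment> \<open>By connectedness the frontier is then nonempty, so \<open>infdist\<close> is
      an actual distance and positive.\<close>
    have "V \<noteq> UNIV" using V(2) not_bounded_UNIV by metis
    then have "frontier V \<noteq> {}" using False frontier_eq_empty by blast
    moreover have "compact (f ` frontier V)"
      using V(2) by (intro compact_continuous_image continuous_f compact_frontier_bounded)
    moreover have "p \<notin> f ` frontier V"
    proof
      assume "p \<in> f ` frontier V"
      then obtain y where "y \<in> closure V" "y \<notin> V" "f y = p"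
        using V(1) by (auto simp: frontier_def interior_open)
      then show False using closure_U closure_mono[OF V(3)] V(4) by blast
    qed
    ultimately have "infdist p (f ` frontier V) > 0"
      using infdist_pos_not_in_closed[of "f ` frontier V" p] compact_imp_closed by blast
    moreover have "compact (closure V)" using V(2) by simp
    ultimately show ?thesis
      using C1_regular_approximation[OF \<beta> _ continuous_f] by metis
  qed
  then obtain k where k: "C1_map k" "regular_value_on k UNIV p"
      "\<forall>x\<in>closure V. dist (f x) (k x) < infdist p (f ` frontier V)" by blast
  have "has_brouwer_degree f V p (signed_count k V p)"
    unfolding has_brouwer_degree_def signed_count_def
    using k by (intro exI[of _ k]) (auto simp: regular_value_on_def)
  then show ?thesis using degree_eq_card V by metis
qed

lemma brouwer_degree_eq_card: "brouwer_degree f U p = int (card K)"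
proof -
  have "(THE d. \<exists>V. open V \<and> bounded V \<and> V \<subseteq> U \<and> K \<subseteq> V \<and> has_brouwer_degree f V p d) = int (card K)"
    using degree_exists degree_eq_card by (intro the_equality) blast+
  then show ?thesis
    unfolding brouwer_degree_def using bdd by (simp add: K_def)
qed

end

theorem proposition2:
  fixes k :: nat
    and f :: "'n::finite heis \<Rightarrow> 'n heis"
    and U :: "'n heis set"
    and p :: "'n heis"
  assumes "CARD('n) = 2 * k + 1"
    and "cc_lipschitz f"
    and "open U"
    and "p \<notin> f ` frontier U"
    and "p \<notin> f ` P_singular_set f"
  shows "brouwer_degree f U p \<ge> 0"
proof (cases "bounded {x \<in> U. f x = p}")
  case True
  obtain C where "\<And>x y. heis_gauge (heis_mult (heis_inv (f x)) (f y)) \<le> C * heis_gauge (heis_mult (heis_inv x) y)"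
    using cc_lipschitz_gauge[OF assms(2)] by blast
  moreover have "\<exists>A. has_P_differential f x A \<and> inj A" if "f x = p" for x
  proof -
    have "x \<notin> P_singular_set f" using assms(5) that by blast
    then show ?thesis
      using has_P_differential_P_differential[of f x] by (auto simp: P_singular_set_def)
  qed
  ultimately interpret regular_fibre f U p C
    using assms True by unfold_locales auto
  show ?thesis by (simp add: brouwer_degree_eq_card)
\<comment> \<open>An unbounded fibre has degree 0 by the convention in
  \<open>brouwer_degree\<close>.\<close>
qed (simp add: brouwer_degree_def)

end
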